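(* Let $n\ge 2$ be an integer, let $\alpha\in\mathbb C$ with $\alpha\notin -n/2-\mathbb Z^+$, and put $\nu=\alpha+(n-2)/2$. Let $r,s>0$ with $r\neq s$. If $r/s$ is either $j_\nu$-rational or $j_\nu$-Liouville, then there are functions $g,h\in\mathscr E(\mathbb R^n)$ satisfying $g*m_\alpha^r=h*m_\alpha^s$ for which there is no $f\in\mathscr E(\mathbb R^n)$ with $g=f*m_\alpha^s$ and $h=f*m_\alpha^r$.
   Context: $\mathbb Z^+=\{0,1,2,\dots\}$. $\mathscr E(\mathbb R^n)$ is the space of complex-valued $C^\infty$ functions on $\mathbb R^n$ and $\mathscr E'(\mathbb R^n)$ the space of compactly supported distributions on $\mathbb R^n$; for $f\in\mathscr E(\mathbb R^n)$, $\mu\in\mathscr E'(\mathbb R^n)$, $(f*\mu)(x)$ is the value of $\mu$ on the function $y\mapsto f(x-y)$. The distributions $m_\alpha^t$: for $t>0$ and $\mathrm{Re}\,\alpha>0$, $m_\alpha^t\in\mathscr E'(\mathbb R^n)$ is given by $$m_\alpha^t(\varphi)=\frac{\Gamma(\alpha+n/2)}{\pi^{n/2}\Gamma(\alpha)}\,t^{2-n-2\alpha}\int_{\|x\|\le t}\varphi(x)\,(t^2-\|x\|^2)^{\alpha-1}\,dx,\qquad \varphi\in\mathscr E(\mathbb R^n).$$ For fixed $t$ and $\varphi$, the right side extends to a meromorphic function of $\alpha\in\mathbb C$ with poles only in $-n/2-\mathbb Z^+$; this analytic continuation defines $m_\alpha^t\in\mathscr E'(\mathbb R^n)$ for all $\alpha\notin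 -n/2-\mathbb Z^+$. The normalized Bessel function of order $\nu\in\mathbb C$ is the even entire function $j_\nu(z)=\sum_{k=0}^\infty \frac{(-1)^k}{k!\,\Gamma(k+\nu+1)}(z/2)^{2k}$ (equal to $(z/2)^{-\nu}J_\nu(z)$). A nonzero complex number $z$ is $j_\nu$-rational if $z=a/b$ with $a,b$ zeros of $j_\nu$ in $\mathbb C$ and $b\ne0$. A complex number $z$ is $j_\nu$-Liouville if (i) $z$ is not $j_\nu$-rational, and (ii) for every $N\in\mathbb N$ there are zeros $a,b$ of $j_\nu$ with $|b|>1$ such that $|z-a/b|<1/|b|^N$. *)

theory Defs
  imports "HOL-Complex_Analysis.Complex_Analysis"
begin

text \<open>
  \<open>C_diff k f\<close>: \<open>f\<close> is \<open>k\<close> times continuously differentiable on the whole space, by recursion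
  on partial derivatives (\<open>axis i 1\<close> is the \<open>i\<close>-th standard unit vector).
\<close>

primrec C_diff :: "nat \<Rightarrow> (real ^ 'n \<Rightarrow> complex) \<Rightarrow> bool" where
  "C_diff 0 f \<longleftrightarrow> continuous_on UNIV f"
| "C_diff (Suc k) f \<longleftrightarrow>
     (\<forall>x. f differentiable (at x)) \<and>
     (\<forall>i. C_diff k (\<lambda>x. frechet_derivative f (at x) (axis i 1)))"

definition smooth_functions :: "(real ^ 'n \<Rightarrow> complex) set" where
  "smooth_functions = {f. \<forall>k. C_diff k f}"

text \<open>
  A distribution is represented by its action on functions.
\<close>

definition convolve :: "(real ^ 'n \<Rightarrow> complex) \<Rightarrow> ((real ^ 'n \<Rightarrow> complex) \<Rightarrow> complex) \<Rightarrow> real ^ 'n \<Rightarrow> complex" where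
  "convolve f \<mu> x = \<mu> (\<lambda>y. f (x - y))"

definition exceptional_set :: "nat \<Rightarrow> complex set" where
  "exceptional_set n = {- of_nat n / 2 - of_nat k | k :: nat. True}"

definition mean_integral :: "complex \<Rightarrow> real \<Rightarrow> (real ^ 'n \<Rightarrow> complex) \<Rightarrow> complex" where
  "mean_integral \<alpha> t \<phi> =
     Gamma (\<alpha> + of_nat CARD('n) / 2) / (of_real (pi powr (real CARD('n) / 2)) * Gamma \<alpha>)
     * of_real t powr (2 - of_nat CARD('n) - 2 * \<alpha>)
     * (LINT x:cball 0 t|lborel. \<phi> x * of_real (t\<^sup>2 - (norm x)\<^sup>2) powr (\<alpha> - 1))"

text \<open>
  The distribution \<open>m\<^sub>\<alpha>\<^sup>t\<close>: the value at \<open>\<alpha>\<close> of the meromorphic continuation in \<open>\<beta>\<close> of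
  \<open>mean_integral \<beta> t \<phi>\<close> from the half plane \<open>Re \<beta> > 0\<close>, with poles only in the exceptional set.
  The complement of that set is connected, so the value does not depend on the choice of \<open>F\<close>.
  Holomorphy on that complement is required because \<open>meromorphic_on\<close> alone allows poles
  everywhere and arbitrary values at isolated points.
\<close>

definition m_dist :: "complex \<Rightarrow> real \<Rightarrow> (real ^ 'n \<Rightarrow> complex) \<Rightarrow> complex" where
  "m_dist \<alpha> t \<phi> =
     (THE w. \<exists>F. F meromorphic_on UNIV \<and>
                 F holomorphic_on (- exceptional_set CARD('n)) \<and>
                 (\<forall>\<beta>. Re \<beta> > 0 \<longrightarrow> F \<beta> = mean_integral \<beta> t \<phi>) \<and>
                 w = F \<alpha>)"

text \<open>
  \<open>rGamma\<close> is the entire function \<open>1 / \<Gamma>\<close>, so the definition covers every complex order.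
\<close>

definition bessel_j :: "complex \<Rightarrow> complex \<Rightarrow> complex" where
  "bessel_j \<nu> z = (\<Sum>k. (-1) ^ k / fact k * rGamma (of_nat k + \<nu> + 1) * (z / 2) ^ (2 * k))"

definition j_rational :: "complex \<Rightarrow> complex \<Rightarrow> bool" where
  "j_rational \<nu> z \<longleftrightarrow> z \<noteq> 0 \<and>
     (\<exists>a b. bessel_j \<nu> a = 0 \<and> bessel_j \<nu> b = 0 \<and> b \<noteq> 0 \<and> z = a / b)"

definition j_Liouville :: "complex \<Rightarrow> complex \<Rightarrow> bool" where
  "j_Liouville \<nu> z \<longleftrightarrow> \<not> j_rational \<nu> z \<and>
     (\<forall>N::nat. \<exists>a b. bessel_j \<nu> a = 0 \<and> bessel_j \<nu> b = 0 \<and> norm b > 1 \<and>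
        norm (z - a / b) < 1 / norm b ^ N)"

end

theory Submission
  imports Defs
begin

text \<open>
  With \<open>c = \<nu> + 1 = \<alpha> + n/2\<close>, the distribution \<open>m\<^sub>\<alpha>\<^sup>t\<close> acts on an eigenfunction \<open>F\<close> of the Laplacian with
  eigenvalue \<open>- l\<^sup>2\<close> as the scalar \<open>\<Gamma>(c) j\<^sub>\<nu>(l t)\<close>.  If \<open>l s\<close> is a zero of \<open>j\<^sub>\<nu>\<close>, then \<open>m\<^sub>\<alpha>\<^sup>s\<close> is divisible by
  \<open>\<Delta> + l\<^sup>2\<close>; the quotient \<open>E\<close> does not vanish on the wave \<open>e\<^sub>l\<close> of frequency \<open>l\<close>, as zeros are simple.
  Whenever \<open>f * m\<^sub>\<alpha>\<^sup>s = 0\<close>, the function \<open>f * E\<close> is an eigenfunction, so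
  \<open>(f * m\<^sub>\<alpha>\<^sup>r) * E = \<Gamma>(c) j\<^sub>\<nu>(l r) (f * E)\<close>.

  In the rational case \<open>r/s = a/b\<close> the frequency \<open>l = a/r = b/s\<close> is common to both radii, and
  \<open>g = e\<^sub>l\<close>, \<open>h = 0\<close> is a counterexample by this identity with the two radii exchanged.

  In the Liouville case there are zeros \<open>b\<^sub>k\<close>, with frequencies \<open>l\<^sub>k = b\<^sub>k/s\<close>, for which \<open>j\<^sub>\<nu>(l\<^sub>k r)\<close> decays faster
  than any power of \<open>b\<^sub>k\<close> without vanishing.  Take \<open>g = 0\<close> and \<open>h\<close> the sum of \<open>\<bar>b\<^sub>k\<bar>\<^sup>k j\<^sub>\<nu>(l\<^sub>k r)\<close> times the wave of
  frequency \<open>l\<^sub>k\<close>.  A solution \<open>f\<close> would have \<open>f * E\<^sub>k\<close> of size at least \<open>\<bar>b\<^sub>k\<bar>\<^sup>k\<close> up to powers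
  at the origin, whereas \<open>f * E\<^sub>k\<close> is bounded by a fixed power of \<open>\<bar>b\<^sub>k\<bar>\<close>.  This uses that
  the zeros of \<open>j\<^sub>\<nu>\<close> lie in a horizontal strip and that \<open>j\<^sub>\<nu>'\<close> is polynomially bounded below at them.
\<close>

section \<open>Bessel functions\<close>

text \<open>The obstacle is that \<alpha> is an arbitrary complex number: for Re \<alpha> <= 0 there
  is no integrable kernel, only an analytic continuation. What survives at every order is the
  three-term recurrence \<open>bcf_rec\<close> and its operator form \<open>Gd_rec\<close>, with the
  Laplacian in place of - l^2. Facts are obtained at large real part of the order, where kernels are
  continuous, and carried down by the recurrence, or by sending the order to infinity, where
  1/\<Gamma> kills the remainders. To avoid poles, \<Gamma>(c) is divided out: \<open>bcf\<close> is
  the regularised hypergeometric 0F1, entire in both arguments, and the factor returns only at the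
  end, where it is nonzero. The quotient E comes from Lommel's integral of \<sigma> J(l s \<sigma>)
  J(m s \<sigma>) over [0,1], J of order \<nu>: at a zero l s it is a multiple of J(m s) / (l^2 -
  m^2). Replacing the second Bessel function by the mean over radius s \<sigma> turns this identity
  of symbols into one of functionals; the value at m = l is Lommel's integral of \<sigma> J(l s
  \<sigma>)^2.\<close>

definition bcf :: "complex \<Rightarrow> complex \<Rightarrow> complex" where
  "bcf c u = (\<Sum>k. rGamma (c + of_nat k) / fact k * u ^ k)"

lemma rGamma_shift:
  fixes c :: complex
  shows "rGamma (c + of_nat k) = (c + of_nat k) * rGamma (c + 1 + of_nat k)"
  using rGamma_plus1[of "c + of_nat k :: complex"] by (simp add: algebra_simps)

lemma norm_pochhammer_ge:
  fixes c :: complex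
  assumes "Re c \<ge> M" "M \<ge> 0"
  shows "norm (pochhammer c k) \<ge> M ^ k"
proof (induction k)
  case (Suc k)
  have "M \<le> Re (c + of_nat k)" using assms by simp
  also have "\<dots> \<le> norm (c + of_nat k)" by (rule complex_Re_le_cmod)
  finally have "M ^ k * M \<le> norm (pochhammer c k) * norm (c + of_nat k)"
    using assms Suc by (intro mult_mono) auto
  then show ?case by (simp add: pochhammer_Suc norm_mult mult.commute)
qed auto

lemma norm_rGamma_le:
  fixes c :: complex
  assumes "Re c \<ge> M" "M > 0"
  shows "norm (rGamma (c + of_nat k)) \<le> norm (rGamma c) / M ^ k"
proof -
  have "rGamma c = pochhammer c k * rGamma (c + of_nat k)" by (rule pochhammer_rGamma)
  then have "norm (rGamma c) = norm (pochhammer c k) * norm (rGamma (c + of_nat k))"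
    by (simp add: norm_mult)
  also have "\<dots> \<ge> M ^ k * norm (rGamma (c + of_nat k))"
    using norm_pochhammer_ge[of M c k] assms by (intro mult_right_mono) auto
  finally show ?thesis using assms by (simp add: field_simps)
qed

text \<open>1/\<Gamma> decays faster than any geometric sequence: once the real part exceeds M, each
  further factor of the Pochhammer symbol has modulus at least M, and M is chosen so that norm x / M
  is below 1/2.\<close>

lemma rGamma_shift_tendsto_0:
  fixes c x :: complex
  shows "(\<lambda>N. x ^ N * rGamma (c + of_nat N)) \<longlonglongrightarrow> 0"
proof -
  define M where "M = 2 * norm x + 1"
  obtain n :: nat where n: "of_nat n \<ge> M - Re c" using real_arch_simple by blast
  have M: "M > 0" "M \<le> Re (c + of_nat n)" using n by (auto simp: M_def add_nonneg_pos)
  define q where "q = norm x / M"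
  have q: "0 \<le> q" "q < 1" using M by (auto simp: q_def M_def divide_simps)
  have "(\<lambda>N. norm x ^ n * norm (rGamma (c + of_nat n)) * q ^ N) \<longlonglongrightarrow>
     norm x ^ n * norm (rGamma (c + of_nat n)) * 0"
    using q by (intro tendsto_intros LIMSEQ_realpow_zero) auto
  then have *: "(\<lambda>N. norm x ^ n * norm (rGamma (c + of_nat n)) * q ^ N) \<longlonglongrightarrow> 0" by simp
  have "(\<lambda>N. x ^ (N + n) * rGamma (c + of_nat (N + n))) \<longlonglongrightarrow> 0"
  proof (rule Lim_null_comparison[OF _ *], intro always_eventually allI)
    fix N
    have "norm (rGamma (c + of_nat n + of_nat N)) \<le> norm (rGamma (c + of_nat n)) / M ^ N"
      by (rule norm_rGamma_le) (use M in auto)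
    then have "norm x ^ (N + n) * norm (rGamma (c + of_nat (N + n))) \<le>
       norm x ^ (N + n) * (norm (rGamma (c + of_nat n)) / M ^ N)"
      by (intro mult_left_mono) (auto simp: algebra_simps)
    then show "norm (x ^ (N + n) * rGamma (c + of_nat (N + n))) \<le>
        norm x ^ n * norm (rGamma (c + of_nat n)) * q ^ N"
      by (simp add: norm_mult norm_power q_def power_divide power_add algebra_simps)
  qed
  then show ?thesis by (rule LIMSEQ_offset)
qed

lemma rGamma_bounded:
  fixes c :: complex
  obtains K where "K \<ge> 0" "\<And>k. norm (rGamma (c + of_nat k)) \<le> K"
proof -
  have "(\<lambda>N. 1 ^ N * rGamma (c + of_nat N)) \<longlonglongrightarrow> 0" by (rule rGamma_shift_tendsto_0)
  then have "Bseq (\<lambda>N. rGamma (c + of_nat N))" using convergent_imp_Bseq convergentI by fastforce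
  then show ?thesis using that unfolding Bseq_def by (metis less_le)
qed

lemma summable_norm_bcf:
  fixes c u :: complex
  shows "summable (\<lambda>k. norm (rGamma (c + of_nat k) / fact k * u ^ k))"
proof -
  obtain K where K: "K \<ge> 0" "\<And>k. norm (rGamma (c + of_nat k)) \<le> K"
    using rGamma_bounded[of c] by metis
  have "summable (\<lambda>k. K * (norm u ^ k /\<^sub>R fact k))"
    by (intro summable_mult summable_exp_generic)
  then show ?thesis
  proof (rule summable_comparison_test'[where N = 0])
    fix k
    have "norm (rGamma (c + of_nat k)) * (norm u ^ k / fact k) \<le> K * (norm u ^ k / fact k)"
      by (intro mult_right_mono K) auto
    then show "norm (norm (rGamma (c + of_nat k) / fact k * u ^ k)) \<le> K * (norm u ^ k /\<^sub>R fact k)"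
      by (simp add: norm_mult norm_divide norm_power divide_simps mult_ac)
  qed
qed

lemma summable_bcf:
  fixes c u :: complex
  shows "summable (\<lambda>k. rGamma (c + of_nat k) / fact k * u ^ k)"
  using summable_norm_bcf by (rule summable_norm_cancel)

lemma bcf_sums: "(\<lambda>k. rGamma (c + of_nat k) / fact k * u ^ k) sums bcf c u"
  unfolding bcf_def using summable_bcf by (rule summable_sums)

lemma bcf_has_field_derivative: "(bcf c has_field_derivative bcf (c + 1) u) (at u)"
proof -
  have "((\<lambda>u. \<Sum>k. rGamma (c + of_nat k) / fact k * u ^ k) has_field_derivative
     (\<Sum>k. diffs (\<lambda>k. rGamma (c + of_nat k) / fact k) k * u ^ k)) (at u)"
    by (rule termdiffs_strong_converges_everywhere) (rule summable_bcf)
  moreover have "diffs (\<lambda>k. rGamma (c + of_nat k) / fact k) k = rGamma (c + 1 + of_nat k) / fact k" for k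
    by (simp add: diffs_def fact_Suc add_ac divide_simps del: of_nat_Suc) (simp add: add_ac)
  ultimately show ?thesis by (simp add: bcf_def[abs_def])
qed

text \<open>\<open>rGamma_shift\<close> splits off the factor c + k. The summand c gives the first
  term; the summand k cancels against the factorial and shifts the index, which produces u times the
  series at c + 2.\<close>

lemma bcf_rec: "bcf c u = c * bcf (c + 1) u + u * bcf (c + 2) u"
proof -
  let ?t = "\<lambda>k. of_nat k * rGamma (c + 1 + of_nat k) / fact k * u ^ k"
  have "(\<lambda>k. u * (rGamma (c + 2 + of_nat k) / fact k * u ^ k)) sums (u * bcf (c + 2) u)"
    by (intro sums_mult bcf_sums)
  moreover have "u * (rGamma (c + 2 + of_nat k) / fact k * u ^ k) = ?t (Suc k)" for k
    by (simp add: fact_Suc add_ac divide_simps del: of_nat_Suc) (simp add: add_ac)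
  ultimately have "(\<lambda>k. ?t (Suc k)) sums (u * bcf (c + 2) u)" by simp
  then have "?t sums (u * bcf (c + 2) u)" by (subst (asm) sums_Suc_iff) simp
  then have "(\<lambda>k. c * (rGamma (c + 1 + of_nat k) / fact k * u ^ k) + ?t k) sums
     (c * bcf (c + 1) u + u * bcf (c + 2) u)"
    by (intro sums_add sums_mult bcf_sums)
  moreover have "c * (rGamma (c + 1 + of_nat k) / fact k * u ^ k) + ?t k =
      rGamma (c + of_nat k) / fact k * u ^ k" for k
    by (simp add: rGamma_shift[of c k] field_simps)
  ultimately have "(\<lambda>k. rGamma (c + of_nat k) / fact k * u ^ k) sums (c * bcf (c + 1) u + u * bcf (c + 2) u)"
    by simp
  then show ?thesis using bcf_sums[of c u] by (rule sums_unique2[symmetric])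
qed

text \<open>Termwise comparison with the exponential series in norm u / M. Dropping the constant
  term on both sides gives the - 1, and with it smallness for large M.\<close>

lemma norm_bcf_minus_rGamma_le:
  assumes "Re c \<ge> M" "M > 0"
  shows "norm (bcf c u - rGamma c) \<le> norm (rGamma c) * (exp (norm u / M) - 1)"
proof -
  let ?t = "\<lambda>k. rGamma (c + of_nat k) / fact k * u ^ k"
  have 1: "(\<lambda>k. ?t (Suc k)) sums (bcf c u - rGamma c)"
    using bcf_sums[of c u] by (subst sums_Suc_iff) simp
  have "(\<lambda>k. (norm u / M) ^ k /\<^sub>R fact k) sums exp (norm u / M)" by (rule exp_converges)
  then have "(\<lambda>k. (norm u / M) ^ Suc k /\<^sub>R fact (Suc k)) sums (exp (norm u / M) - 1)"
    by (subst sums_Suc_iff) simp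
  then have 2: "(\<lambda>k. norm (rGamma c) * ((norm u / M) ^ Suc k /\<^sub>R fact (Suc k))) sums
      (norm (rGamma c) * (exp (norm u / M) - 1))"
    by (rule sums_mult)
  have "norm (?t k) \<le> norm (rGamma c) * ((norm u / M) ^ k /\<^sub>R fact k)" for k
  proof -
    have "norm (?t k) = norm (rGamma (c + of_nat k)) * (norm u ^ k / fact k)"
      by (simp add: norm_mult norm_divide norm_power)
    also have "\<dots> \<le> norm (rGamma c) / M ^ k * (norm u ^ k / fact k)"
      by (intro mult_right_mono norm_rGamma_le assms) auto
    finally show ?thesis by (simp add: power_divide divide_simps mult_ac)
  qed
  then have "norm (\<Sum>k. ?t (Suc k)) \<le> (\<Sum>k. norm (rGamma c) * ((norm u / M) ^ Suc k /\<^sub>R fact (Suc k)))"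
    by (intro norm_suminf_le sums_summable[OF 2])
  then show ?thesis using sums_unique[OF 1] sums_unique[OF 2] by simp
qed

text \<open>The normalised value 1 at infinite order serves as a boundary condition: it singles out
  the Bessel functions among the solutions of the three-term recurrence.\<close>

lemma Gamma_bcf_tendsto_1:
  "(\<lambda>N. Gamma (c + of_nat N) * bcf (c + of_nat N) u) \<longlonglongrightarrow> 1"
proof -
  obtain n :: nat where n: "of_nat n \<ge> 1 - Re c" using real_arch_simple by blast
  have "(\<lambda>N. exp (norm u / Suc N) - 1) \<longlonglongrightarrow> exp 0 - 1"
    by (intro tendsto_intros tendsto_exp real_tendsto_divide_at_top[OF tendsto_const] filterlim_compose[OF filterlim_real_sequentially filterlim_Suc])
  then have *: "(\<lambda>N. exp (norm u / Suc N) - 1) \<longlonglongrightarrow> 0" by simp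
  have "(\<lambda>N. Gamma (c + of_nat (N + n)) * bcf (c + of_nat (N + n)) u - 1) \<longlonglongrightarrow> 0"
  proof (rule Lim_null_comparison[OF _ *], intro always_eventually allI)
    fix N
    let ?c = "c + of_nat (N + n)"
    have Re: "Re ?c \<ge> Suc N" using n by simp
    then have "?c \<notin> \<int>\<^sub>\<le>\<^sub>0" by (auto elim!: nonpos_Ints_cases simp: complex_eq_iff)
    then have g: "Gamma ?c * rGamma ?c = 1" by (simp add: Gamma_def rGamma_eq_zero_iff)
    then have "norm (Gamma ?c * bcf ?c u - 1) = norm (Gamma ?c) * norm (bcf ?c u - rGamma ?c)"
      by (metis norm_mult right_diff_distrib)
    also have "\<dots> \<le> norm (Gamma ?c) * (norm (rGamma ?c) * (exp (norm u / Suc N) - 1))"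
      by (intro mult_left_mono norm_bcf_minus_rGamma_le) (use Re in auto)
    also have "\<dots> = norm (Gamma ?c * rGamma ?c) * (exp (norm u / Suc N) - 1)"
      by (simp only: norm_mult mult.assoc)
    finally show "norm (Gamma ?c * bcf ?c u - 1) \<le> exp (norm u / Suc N) - 1" using g by simp
  qed
  then have "(\<lambda>N. Gamma (c + of_nat (N + n)) * bcf (c + of_nat (N + n)) u) \<longlonglongrightarrow> 1"
    by (simp add: LIM_zero_iff)
  then show ?thesis by (rule LIMSEQ_offset)
qed

text \<open>Two neighbouring zeros propagate up the recurrence to all orders, against the limit 1.
  As the derivative of \<open>bj c\<close> is - z / 2 times \<open>bj (c + 1)\<close>, this is the
  simplicity of the zeros away from the origin.\<close>

lemma bcf_not_both_zero:
  assumes "u \<noteq> 0" "bcf c u = 0"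
  shows "bcf (c + 1) u \<noteq> 0"
proof
  assume 1: "bcf (c + 1) u = 0"
  have *: "bcf (c + of_nat N) u = 0 \<and> bcf (c + of_nat N + 1) u = 0" for N
  proof (induction N)
    case (Suc N)
    then have "bcf (c + of_nat N + 2) u = 0" using bcf_rec[of "c + of_nat N" u] assms(1) by auto
    moreover have "c + of_nat N + 2 = c + of_nat (Suc N) + 1" by simp
    ultimately show ?case using Suc by (simp add: add_ac)
  qed (use assms 1 in auto)
  then have "(\<lambda>N. Gamma (c + of_nat N) * bcf (c + of_nat N) u) \<longlonglongrightarrow> 0" by simp
  then show False using Gamma_bcf_tendsto_1[of c u] LIMSEQ_unique by fastforce
qed

lemma bcf_shift_tendsto_0: "(\<lambda>N. x ^ N * bcf (c + of_nat N) u) \<longlonglongrightarrow> 0"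
proof -
  have *: "(\<lambda>N. (x ^ N * rGamma (c + of_nat N)) * (Gamma (c + of_nat N) * bcf (c + of_nat N) u)) \<longlonglongrightarrow> 0 * 1"
    by (intro tendsto_mult rGamma_shift_tendsto_0 Gamma_bcf_tendsto_1)
  obtain n :: nat where n: "of_nat n \<ge> 1 - Re c" using real_arch_simple by blast
  have "eventually (\<lambda>N. (x ^ N * rGamma (c + of_nat N)) * (Gamma (c + of_nat N) * bcf (c + of_nat N) u)
     = x ^ N * bcf (c + of_nat N) u) sequentially"
    using eventually_ge_at_top[of n]
  proof eventually_elim
    case (elim N)
    then have "Re (c + of_nat N) > 0" using n by (simp add: algebra_simps)
    then have "c + of_nat N \<notin> \<int>\<^sub>\<le>\<^sub>0" by (auto elim!: nonpos_Ints_cases simp: complex_eq_iff)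
    then show ?case by (simp add: Gamma_def rGamma_eq_zero_iff)
  qed
  from Lim_transform_eventually[OF * this] show ?thesis by simp
qed

text \<open>Bessel functions are indexed by \<open>c = \<nu> + 1\<close>.\<close>

definition bj :: "complex \<Rightarrow> complex \<Rightarrow> complex" where
  "bj c z = bcf c (- (z\<^sup>2) / 4)"

lemma bessel_j_eq_bj: "bessel_j \<nu> z = bj (\<nu> + 1) z"
proof -
  have 1: "- (z\<^sup>2) / 4 = (-1) * (z / 2)\<^sup>2" by (simp add: power2_eq_square)
  have "(-1) ^ k * (z / 2) ^ (2 * k) = (- (z\<^sup>2) / 4) ^ k" for k
    unfolding 1 power_mult power_mult_distrib[of "-1"] ..
  then show ?thesis unfolding bessel_j_def bj_def bcf_def
    by (intro arg_cong[where f = suminf] ext) (simp add: add_ac divide_simps)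
qed

lemma bj_rec: "bj c z = c * bj (c + 1) z - z\<^sup>2 / 4 * bj (c + 2) z"
  using bcf_rec[of c "- (z\<^sup>2) / 4"] by (simp add: bj_def)

lemma bj_has_field_derivative: "(bj c has_field_derivative - (z / 2) * bj (c + 1) z) (at z)"
  unfolding bj_def[abs_def]
  by (rule DERIV_cong[OF DERIV_chain2[OF bcf_has_field_derivative]])
     (auto intro!: derivative_eq_intros simp: field_simps)

lemma bj_holomorphic: "bj c holomorphic_on A"
  using bj_has_field_derivative by (meson field_differentiable_def field_differentiable_at_within holomorphic_on_def)

lemma bj_minus [simp]: "bj c (- z) = bj c z"
  by (simp add: bj_def)

lemma bj_not_both_zero: "z \<noteq> 0 \<Longrightarrow> bj c z = 0 \<Longrightarrow> bj (c + 1) z \<noteq> 0"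
  unfolding bj_def by (rule bcf_not_both_zero) auto

lemma bj_shift_tendsto_0: "(\<lambda>N. x ^ N * bj (c + of_nat N) z) \<longlonglongrightarrow> 0"
  unfolding bj_def by (rule bcf_shift_tendsto_0)

lemma continuous_on_bj [continuous_intros]:
  "continuous_on A f \<Longrightarrow> continuous_on A (\<lambda>x. bj c (f x))"
  using continuous_on_compose2[OF holomorphic_on_imp_continuous_on[OF bj_holomorphic[of c UNIV]]] by auto

section \<open>Zeros of Bessel functions\<close>

text \<open>The function \<open>W = z\<^sup>a j(z)\<close> with \<open>a = c - 1/2\<close> satisfies \<open>W'' = (\<kappa> / z\<^sup>2 - 1) W\<close>, so
  \<open>\<bar>W\<bar>\<^sup>2 + \<bar>W'\<bar>\<^sup>2\<close> is almost constant along horizontal lines.\<close>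

definition bW :: "complex \<Rightarrow> complex \<Rightarrow> complex" where
  "bW c z = z powr (c - 1/2) * bj c z"

definition bW' :: "complex \<Rightarrow> complex \<Rightarrow> complex" where
  "bW' c z = z powr (c - 1/2) * ((c - 1/2) * bj c z / z - z / 2 * bj (c + 1) z)"

definition b\<kappa> :: "complex \<Rightarrow> complex" where
  "b\<kappa> c = (c - 1/2)\<^sup>2 - (c - 1/2)"

definition bS :: "complex \<Rightarrow> complex \<Rightarrow> real" where
  "bS c z = (norm (bW c z))\<^sup>2 + (norm (bW' c z))\<^sup>2"

lemma powr_has_field_derivative:
  fixes z a :: complex
  assumes "z \<notin> \<real>\<^sub>\<le>\<^sub>0"
  shows "((\<lambda>z. z powr a) has_field_derivative a * z powr a / z) (at z)"
proof -
  have "z \<noteq> 0" using assms by auto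
  then have "z powr (a - 1) = z powr a / z" by (simp add: powr_diff)
  then show ?thesis using has_field_derivative_powr[OF assms, of a] by simp
qed

lemma bW_deriv:
  assumes "z \<notin> \<real>\<^sub>\<le>\<^sub>0"
  shows "(bW c has_field_derivative bW' c z) (at z)"
proof -
  have "z \<noteq> 0" using assms by auto
  show ?thesis unfolding bW_def[abs_def] bW'_def
    by (rule DERIV_cong[OF DERIV_mult[OF powr_has_field_derivative[OF assms] bj_has_field_derivative]])
       (use \<open>z \<noteq> 0\<close> in \<open>simp add: field_simps\<close>)
qed

lemma bW'_deriv:
  assumes "z \<notin> \<real>\<^sub>\<le>\<^sub>0"
  shows "(bW' c has_field_derivative (b\<kappa> c / z\<^sup>2 - 1) * bW c z) (at z)"
proof -
  have z: "z \<noteq> 0" using assms by auto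
  define Z where "Z = z powr (c - 1/2)"
  define a where "a = c - 1/2"
  define y0 y1 y2 where "y0 = bj c z" and "y1 = bj (c + 1) z" and "y2 = bj (c + 2) z"
  have rec: "y0 = c * y1 - z\<^sup>2 / 4 * y2" unfolding y0_def y1_def y2_def by (rule bj_rec)
  have d1: "(bj (c + 1) has_field_derivative - (z / 2) * y2) (at z)"
    using bj_has_field_derivative[of "c + 1" z] by (simp add: y2_def add_ac)
  have d0: "(bj c has_field_derivative - (z / 2) * y1) (at z)"
    using bj_has_field_derivative[of c z] by (simp add: y1_def)
  have "((\<lambda>z. (c - 1/2) * bj c z / z - z / 2 * bj (c + 1) z) has_field_derivative
     (a * (- (z / 2) * y1) * z - a * y0) / (z * z) - (1 / 2 * y1 + (- (z / 2) * y2) * (z / 2))) (at z)"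
    unfolding a_def y0_def y1_def using z
    by (auto intro!: derivative_eq_intros d0[unfolded y1_def] d1) (simp add: field_simps)
  from DERIV_mult[OF powr_has_field_derivative[OF assms, of "c - 1/2"] this]
  show ?thesis unfolding bW'_def[abs_def] bW_def
  proof (rule DERIV_cong)
    have "a * Z / z * (a * y0 / z - z / 2 * y1) + ((a * (- (z / 2) * y1) * z - a * y0) / (z * z) - (1 / 2 * y1 + (- (z / 2) * y2) * (z / 2))) * Z
      = Z * ((a\<^sup>2 - a) * y0 / z\<^sup>2 - (a + 1/2) * y1 + z\<^sup>2 / 4 * y2)"
      using z by (simp add: field_simps power2_eq_square)
    also have "\<dots> = Z * ((a\<^sup>2 - a) * y0 / z\<^sup>2 - y0)" by (subst (2) rec) (simp add: a_def algebra_simps)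
    finally show "(c - 1/2) * z powr (c - 1/2) / z * ((c - 1/2) * bj c z / z - z / 2 * bj (c + 1) z) +
      ((a * (- (z / 2) * y1) * z - a * y0) / (z * z) - (1 / 2 * y1 + (- (z / 2) * y2) * (z / 2))) * z powr (c - 1/2) =
       (b\<kappa> c / z\<^sup>2 - 1) * (z powr (c - 1/2) * bj c z)"
      by (simp add: Z_def a_def y0_def y1_def b\<kappa>_def algebra_simps)
  qed
qed

lemma vector_derivative_line:
  assumes "(f has_field_derivative f') (at (Complex x \<eta>))"
  shows "((\<lambda>x. f (Complex x \<eta>)) has_vector_derivative f') (at x)"
proof -
  have "((\<lambda>x. of_real x + \<i> * of_real \<eta> :: complex) has_vector_derivative 1) (at x)"
    by (auto intro!: derivative_eq_intros)
  then have "((\<lambda>x. Complex x \<eta>) has_vector_derivative 1) (at x)" by (simp add: Complex_eq)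
  from field_vector_diff_chain_at[OF this assms] show ?thesis by (simp add: o_def)
qed

lemma norm_sq_deriv:
  fixes f :: "real \<Rightarrow> 'a::real_inner"
  assumes "(f has_vector_derivative f') (at x)"
  shows "((\<lambda>x. (norm (f x))\<^sup>2) has_real_derivative 2 * inner (f x) f') (at x)"
  unfolding power2_norm_eq_inner has_field_derivative_def
  by (rule has_derivative_eq_rhs[OF has_derivative_inner[OF assms[unfolded has_vector_derivative_def] assms[unfolded has_vector_derivative_def]]])
     (auto simp: inner_commute algebra_simps)

text \<open>The integrating factors exp A and exp (- A) make the function increasing and decreasing
  respectively, so one differential inequality yields both bounds.\<close>

lemma gronwall:
  fixes S S' A A' :: "real \<Rightarrow> real"
  assumes "x0 \<le> x1"
    and S: "\<And>x. x0 \<le> x \<Longrightarrow> x \<le> x1 \<Longrightarrow> (S has_real_derivative S' x) (at x)"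
    and A: "\<And>x. x0 \<le> x \<Longrightarrow> x \<le> x1 \<Longrightarrow> (A has_real_derivative A' x) (at x)"
    and le: "\<And>x. x0 \<le> x \<Longrightarrow> x \<le> x1 \<Longrightarrow> \<bar>S' x\<bar> \<le> A' x * S x"
  shows "S x0 * exp (- (A x1 - A x0)) \<le> S x1" "S x1 \<le> S x0 * exp (A x1 - A x0)"
proof -
  have "S x0 * exp (A x0) \<le> S x1 * exp (A x1)"
  proof (rule DERIV_nonneg_imp_nondecreasing[OF assms(1)])
    fix x assume x: "x0 \<le> x" "x \<le> x1"
    have "((\<lambda>x. S x * exp (A x)) has_real_derivative (S' x + A' x * S x) * exp (A x)) (at x)"
      using S[OF x] A[OF x] by (auto intro!: derivative_eq_intros simp: algebra_simps)
    moreover have "(S' x + A' x * S x) * exp (A x) \<ge> 0" using le[OF x] by simp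
    ultimately show "\<exists>y. ((\<lambda>x. S x * exp (A x)) has_real_derivative y) (at x) \<and> 0 \<le> y" by blast
  qed
  then show "S x0 * exp (- (A x1 - A x0)) \<le> S x1" by (simp add: exp_diff exp_minus field_simps)
  have "S x0 * exp (- A x0) \<ge> S x1 * exp (- A x1)"
  proof (rule DERIV_nonpos_imp_nonincreasing[OF assms(1)])
    fix x assume x: "x0 \<le> x" "x \<le> x1"
    have "((\<lambda>x. S x * exp (- A x)) has_real_derivative (S' x - A' x * S x) * exp (- A x)) (at x)"
      using S[OF x] A[OF x] by (auto intro!: derivative_eq_intros simp: algebra_simps)
    moreover have "(S' x - A' x * S x) * exp (- A x) \<le> 0" using le[OF x] by (simp add: mult_nonpos_nonneg)
    ultimately show "\<exists>y. ((\<lambda>x. S x * exp (- A x)) has_real_derivative y) (at x) \<and> y \<le> 0" by blast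
  qed
  then show "S x1 \<le> S x0 * exp (A x1 - A x0)" by (simp add: exp_diff exp_minus field_simps)
qed

lemma variation_bound:
  fixes f f' :: "real \<Rightarrow> complex" and B B' :: "real \<Rightarrow> real"
  assumes f: "\<And>x. (f has_vector_derivative f' x) (at x)"
    and B: "\<And>x. (B has_real_derivative B' x) (at x)"
    and le: "\<And>x. norm (f' x) \<le> B' x"
  shows "norm (f x - f y) \<le> \<bar>B x - B y\<bar>"
proof -
  have *: "norm (f x - f y) \<le> B x - B y" if "y < x" for x y
  proof (rule differentiable_bound_general[OF that])
    show "continuous_on {y..x} f" using f has_vector_derivative_continuous
      by (meson continuous_at_imp_continuous_on)
    show "continuous_on {y..x} B" using B DERIV_continuous by (meson continuous_at_imp_continuous_on)
    show "\<And>t. (f has_vector_derivative f' t) (at t)" by (rule f)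
    show "\<And>t. (B has_vector_derivative B' t) (at t)"
      using B by (simp add: has_real_derivative_iff_has_vector_derivative)
    show "\<And>t. norm (f' t) \<le> B' t" by (rule le)
  qed
  show ?thesis using *[of x y] *[of y x] norm_minus_commute[of "f x" "f y"] by (cases x y rule: linorder_cases) auto
qed

text \<open>In the derivative of the energy the pairing of W with W' cancels against the part - W of
  W'', as for a free oscillator. Only \<kappa> W / z^2 remains, and the squared modulus of z on the
  line is x^2 + \<eta>^2.\<close>

lemma bS_deriv:
  assumes "Complex x \<eta> \<notin> \<real>\<^sub>\<le>\<^sub>0"
  obtains S' where "((\<lambda>x. bS c (Complex x \<eta>)) has_real_derivative S') (at x)"
    "\<bar>S'\<bar> \<le> norm (b\<kappa> c) / (x\<^sup>2 + \<eta>\<^sup>2) * bS c (Complex x \<eta>)"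
proof
  let ?z = "Complex x \<eta>"
  let ?w = "bW c ?z" and ?v = "bW' c ?z"
  let ?u = "(b\<kappa> c / ?z\<^sup>2 - 1) * ?w"
  let ?S' = "2 * inner ?w ?v + 2 * inner ?v ?u"
  show "((\<lambda>x. bS c (Complex x \<eta>)) has_real_derivative ?S') (at x)"
    unfolding bS_def
    by (intro derivative_intros norm_sq_deriv vector_derivative_line bW_deriv bW'_deriv assms)
  have "?S' = 2 * inner ?v (b\<kappa> c / ?z\<^sup>2 * ?w)"
    by (simp add: left_diff_distrib inner_diff_right inner_commute)
  also have "\<bar>\<dots>\<bar> \<le> 2 * (norm ?v * norm (b\<kappa> c / ?z\<^sup>2 * ?w))"
    using Cauchy_Schwarz_ineq2[of ?v "b\<kappa> c / ?z\<^sup>2 * ?w"] by (simp add: abs_mult)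
  also have "\<dots> = norm (b\<kappa> c) / (x\<^sup>2 + \<eta>\<^sup>2) * (2 * norm ?v * norm ?w)"
    by (simp add: norm_mult norm_divide norm_power cmod_power2)
  also have "\<dots> \<le> norm (b\<kappa> c) / (x\<^sup>2 + \<eta>\<^sup>2) * bS c ?z"
    using sum_squares_bound[of "norm ?v" "norm ?w"] by (intro mult_left_mono) (auto simp: bS_def)
  finally show "\<bar>?S'\<bar> \<le> norm (b\<kappa> c) / (x\<^sup>2 + \<eta>\<^sup>2) * bS c ?z" .
qed

lemma bS_nonneg: "bS c z \<ge> 0" by (simp add: bS_def)

lemma arctan_scaled_deriv:
  assumes "\<eta> > 0"
  shows "((\<lambda>x. k / \<eta> * arctan (x / \<eta>)) has_real_derivative k / (x\<^sup>2 + \<eta>\<^sup>2)) (at x)"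
proof -
  have pos: "x\<^sup>2 + \<eta>\<^sup>2 > 0" "1 + (x / \<eta>)\<^sup>2 > 0" using assms by (simp_all add: add_nonneg_pos add_pos_nonneg)
  have "((\<lambda>x. k / \<eta> * arctan (x / \<eta>)) has_real_derivative k / \<eta> * (inverse (1 + (x / \<eta>)\<^sup>2) * (1 / \<eta>))) (at x)"
    using assms by (auto intro!: derivative_eq_intros)
  moreover have "k / \<eta> * (inverse (1 + (x / \<eta>)\<^sup>2) * (1 / \<eta>)) = k / (x\<^sup>2 + \<eta>\<^sup>2)"
  proof -
    have "\<eta> * (1 + (x / \<eta>)\<^sup>2) * \<eta> = x\<^sup>2 + \<eta>\<^sup>2" using assms by (simp add: field_simps power2_eq_square)
    then show ?thesis using pos assms by (simp add: divide_simps) (metis mult.assoc mult.commute)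
  qed
  ultimately show ?thesis by simp
qed

text \<open>The primitive is bounded on the whole real line by a multiple of 1 / \<eta>, using pi /
  2 < 2. Hence the relative change of the energy along an entire horizontal line becomes small high
  up.\<close>

lemma arctan_scaled_bound:
  assumes "\<eta> > 0" "k \<ge> 0"
  shows "\<bar>k / \<eta> * arctan (x / \<eta>)\<bar> \<le> 2 * k / \<eta>"
proof -
  have "\<bar>arctan (x / \<eta>)\<bar> \<le> 2" using arctan_bounded[of "x / \<eta>"] pi_half_less_two by linarith
  then have "k / \<eta> * \<bar>arctan (x / \<eta>)\<bar> \<le> k / \<eta> * 2" using assms by (intro mult_left_mono) auto
  then show ?thesis using assms by (simp add: abs_mult mult.commute)
qed

lemma bS_upper:
  assumes "\<eta> > 0"
  shows "bS c (Complex x \<eta>) \<le> bS c (Complex 0 \<eta>) * exp (2 * norm (b\<kappa> c) / \<eta>)"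
proof -
  let ?k = "norm (b\<kappa> c)"
  let ?A = "\<lambda>x. ?k / \<eta> * arctan (x / \<eta>)"
  have nr: "Complex x \<eta> \<notin> \<real>\<^sub>\<le>\<^sub>0" for x using assms by (auto simp: complex_nonpos_Reals_iff)
  have "\<exists>S'. ((\<lambda>x. bS c (Complex x \<eta>)) has_real_derivative S') (at x) \<and>
    \<bar>S'\<bar> \<le> ?k / (x\<^sup>2 + \<eta>\<^sup>2) * bS c (Complex x \<eta>)" for x
    using bS_deriv[OF nr[of x]] by metis
  then obtain S' where S': "\<And>x. ((\<lambda>x. bS c (Complex x \<eta>)) has_real_derivative S' x) (at x)"
    "\<And>x. \<bar>S' x\<bar> \<le> ?k / (x\<^sup>2 + \<eta>\<^sup>2) * bS c (Complex x \<eta>)" by metis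
  have A0: "?A 0 = 0" by simp
  have e: "exp (\<bar>?A x\<bar>) \<le> exp (2 * ?k / \<eta>)" using arctan_scaled_bound[OF assms, of ?k x] by simp
  have "bS c (Complex x \<eta>) \<le> bS c (Complex 0 \<eta>) * exp (\<bar>?A x\<bar>)"
  proof (cases "x \<ge> 0")
    case True
    then have "bS c (Complex x \<eta>) \<le> bS c (Complex 0 \<eta>) * exp (?A x - ?A 0)"
      by (intro gronwall(2)[where S' = S' and A' = "\<lambda>x. ?k / (x\<^sup>2 + \<eta>\<^sup>2)"] S' arctan_scaled_deriv assms)
    also have "\<dots> \<le> bS c (Complex 0 \<eta>) * exp (\<bar>?A x\<bar>)"
      by (intro mult_left_mono bS_nonneg) (simp only: A0 exp_le_cancel_iff diff_0_right abs_ge_self)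
    finally show ?thesis .
  next
    case False
    then have "bS c (Complex x \<eta>) * exp (- (?A 0 - ?A x)) \<le> bS c (Complex 0 \<eta>)"
      by (intro gronwall(1)[where S' = S' and A' = "\<lambda>x. ?k / (x\<^sup>2 + \<eta>\<^sup>2)"] S' arctan_scaled_deriv assms) auto
    then have "bS c (Complex x \<eta>) \<le> bS c (Complex 0 \<eta>) * exp (- ?A x)"
      by (simp add: exp_minus field_simps)
    also have "\<dots> \<le> bS c (Complex 0 \<eta>) * exp (\<bar>?A x\<bar>)"
      by (intro mult_left_mono bS_nonneg) (simp only: exp_le_cancel_iff abs_ge_minus_self)
    finally show ?thesis .
  qed
  also have "\<dots> \<le> bS c (Complex 0 \<eta>) * exp (2 * ?k / \<eta>)" by (intro mult_left_mono bS_nonneg e)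
  finally show ?thesis .
qed

text \<open>On the imaginary axis \<open>W' + \<i> W\<close> is negligible against \<open>W' - \<i> W\<close> high up, and along
  horizontal lines \<open>e\<^sup>-\<^sup>i\<^sup>x (W' + \<i> W)\<close> and \<open>e\<^sup>i\<^sup>x (W' - \<i> W)\<close> hardly change; hence \<open>W\<close> has no zeros there.\<close>

lemma bj_zeros_in_strip:
  assumes nz: "\<forall>\<^sub>F \<eta> in at_top. bj c (\<i> * of_real \<eta>) \<noteq> 0"
    and lim: "((\<lambda>\<eta>. of_real \<eta> * bj (c + 1) (\<i> * of_real \<eta>) / bj c (\<i> * of_real \<eta>)) \<longlongrightarrow> 2) at_top"
  obtains Y where "Y > 0" "\<And>z. bj c z = 0 \<Longrightarrow> \<bar>Im z\<bar> \<le> Y"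
proof -
  let ?a = "c - 1/2" and ?k = "norm (b\<kappa> c)"
  have l: "((\<lambda>\<eta>. C / \<eta>) \<longlongrightarrow> 0) at_top" for C :: real
    by (intro real_tendsto_divide_at_top[OF tendsto_const] filterlim_ident)
  \<comment> \<open>The thresholds are fitted to the final comparison: 9/4 * 4/3 = 3 gives norm W <=
    3 norm T along the line, so the drift of either combination is at most 6 \<open>?k\<close> /
    \<eta> times norm T, less than norm T / 4. At a zero this yields 7/4 - 1/4 <= 1/4 + 1/4, which
    is false.\<close>
  have "((\<lambda>\<eta>. exp (?k / \<eta>)) \<longlongrightarrow> exp 0) at_top" by (intro tendsto_intros l)
  then have e: "\<forall>\<^sub>F \<eta> in at_top. exp (?k / \<eta>) < 4/3"
    by (rule order_tendstoD(2)) simp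
  have 0: "\<forall>\<^sub>F \<eta> in at_top. \<eta> > (0::real)" by (rule eventually_gt_at_top)
  have 1: "\<forall>\<^sub>F \<eta> in at_top. norm ?a / \<eta> < 1/8" by (rule order_tendstoD(2)[OF l]) simp
  have 2: "\<forall>\<^sub>F \<eta> in at_top. 6 * ?k / \<eta> < 1/4" by (rule order_tendstoD(2)[OF l]) simp
  have 3: "\<forall>\<^sub>F \<eta> in at_top. dist (of_real \<eta> * bj (c + 1) (\<i> * of_real \<eta>) / bj c (\<i> * of_real \<eta>)) 2 < 1/4"
    using lim by (rule tendstoD) simp
  have "\<forall>\<^sub>F \<eta> in at_top. \<forall>x. bj c (Complex x \<eta>) \<noteq> 0"
    using nz e 0 1 2 3
  proof eventually_elim
    case (elim \<eta>)
    define z0 where "z0 = \<i> * complex_of_real \<eta>"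
    have z0: "Complex 0 \<eta> = z0" "z0 \<noteq> 0" using elim by (auto simp: z0_def complex_eq_iff)
    have nr: "Complex x \<eta> \<notin> \<real>\<^sub>\<le>\<^sub>0" for x using elim by (auto simp: complex_nonpos_Reals_iff)
    define T where "T = bW c z0"
    define \<rho> where "\<rho> = of_real \<eta> * bj (c + 1) z0 / bj c z0"
    have nz0: "bj c z0 \<noteq> 0" using elim by (simp add: z0_def)
    have T0: "T \<noteq> 0" using nz0 z0 by (simp add: T_def bW_def)
    have \<rho>: "norm (\<rho> - 2) < 1/4" using elim by (simp add: \<rho>_def z0_def dist_norm)
    \<comment> \<open>For \<rho> = 2 and without the small term \<open>?a / z0\<close> this reads W'
      = - \<i> W, the relation satisfied by e^(-iz), the growing exponential in the upper half
      plane.\<close>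
    have W': "bW' c z0 = T * (?a / z0 - \<i> * \<rho> / 2)"
    proof -
      have "bj (c + 1) z0 = \<rho> * bj c z0 / of_real \<eta>" using nz0 elim by (simp add: \<rho>_def)
      then show ?thesis using elim by (simp add: bW'_def T_def bW_def z0_def field_simps)
    qed
    have az: "norm (?a / z0) < 1/8" using elim by (simp add: norm_divide z0_def norm_mult)
    have p0: "norm (bW' c z0 + \<i> * T) \<le> norm T * (1/4)"
    proof -
      have "bW' c z0 + \<i> * T = T * (?a / z0 - \<i> * (\<rho> - 2) / 2)" by (simp add: W' algebra_simps diff_divide_distrib)
      moreover have "norm (?a / z0 - \<i> * (\<rho> - 2) / 2) \<le> norm (?a / z0) + norm (\<i> * (\<rho> - 2) / 2)"
        by (rule norm_triangle_ineq4)
      moreover have "norm (\<i> * (\<rho> - 2) / 2) = norm (\<rho> - 2) / 2" by (simp add: norm_mult)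
      ultimately have "norm (?a / z0 - \<i> * (\<rho> - 2) / 2) \<le> 1/4" "bW' c z0 + \<i> * T = T * (?a / z0 - \<i> * (\<rho> - 2) / 2)"
        using az \<rho> by linarith+
      then show ?thesis by (simp only: norm_mult mult_left_mono norm_ge_zero)
    qed
    have q0: "norm (bW' c z0 - \<i> * T) \<ge> norm T * (7/4)"
    proof -
      have "bW' c z0 - \<i> * T = T * (?a / z0 - \<i> * (\<rho> - 2) / 2 - 2 * \<i>)" by (simp add: W' algebra_simps diff_divide_distrib)
      moreover have "norm (?a / z0 - \<i> * (\<rho> - 2) / 2) \<le> norm (?a / z0) + norm (\<i> * (\<rho> - 2) / 2)"
        by (rule norm_triangle_ineq4)
      moreover have "norm (?a / z0 - \<i> * (\<rho> - 2) / 2 - 2 * \<i>) \<ge> norm (2 * \<i>) - norm (?a / z0 - \<i> * (\<rho> - 2) / 2)"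
        by (metis norm_minus_commute norm_triangle_ineq2)
      moreover have "norm (2 * \<i>) = 2" "norm (\<i> * (\<rho> - 2) / 2) = norm (\<rho> - 2) / 2" by (auto simp: norm_mult)
      ultimately have "norm (?a / z0 - \<i> * (\<rho> - 2) / 2 - 2 * \<i>) \<ge> 7/4" "bW' c z0 - \<i> * T = T * (?a / z0 - \<i> * (\<rho> - 2) / 2 - 2 * \<i>)"
        using az \<rho> by linarith+
      then show ?thesis by (simp only: norm_mult mult_left_mono norm_ge_zero)
    qed
    have w0: "norm (bW' c z0) \<le> norm T * (5/4)"
    proof -
      have "norm (?a / z0 - \<i> * \<rho> / 2) \<le> norm (?a / z0) + norm (\<i> * \<rho> / 2)" by (rule norm_triangle_ineq4)
      moreover have "norm \<rho> \<le> 2 + norm (\<rho> - 2)" using norm_triangle_ineq[of 2 "\<rho> - 2"] by simp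
      moreover have "norm (\<i> * \<rho> / 2) = norm \<rho> / 2" by (simp add: norm_mult)
      ultimately have "norm (?a / z0 - \<i> * \<rho> / 2) \<le> 5/4" using az \<rho> by linarith
      then show ?thesis unfolding W' by (simp only: norm_mult mult_left_mono norm_ge_zero)
    qed
    have S0: "bS c z0 \<le> (norm T * (9/4))\<^sup>2"
    proof -
      have "bS c z0 \<le> (norm T)\<^sup>2 + (norm T * (5/4))\<^sup>2"
        using power_mono[OF w0, of 2] by (simp add: bS_def T_def)
      also have "\<dots> = (norm T)\<^sup>2 * (41/16)" by (simp add: power_mult_distrib power2_eq_square)
      also have "\<dots> \<le> (norm T)\<^sup>2 * (81/16)" by (intro mult_left_mono) auto
      finally show ?thesis by (simp add: power_mult_distrib power2_eq_square)
    qed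
    have Wb: "norm (bW c (Complex x \<eta>)) \<le> 3 * norm T" for x
    proof -
      have "(norm (bW c (Complex x \<eta>)))\<^sup>2 \<le> bS c (Complex x \<eta>)" by (simp add: bS_def)
      also have "\<dots> \<le> bS c z0 * exp (2 * ?k / \<eta>)" using bS_upper[of \<eta> c x] elim by (simp add: z0)
      also have "\<dots> \<le> (norm T * (9/4))\<^sup>2 * exp (2 * ?k / \<eta>)" by (intro mult_right_mono S0) auto
      also have "exp (2 * ?k / \<eta>) = (exp (?k / \<eta>))\<^sup>2" by (simp add: power2_eq_square flip: exp_add)
      also have "(norm T * (9/4))\<^sup>2 * (exp (?k / \<eta>))\<^sup>2 = (norm T * (9/4) * exp (?k / \<eta>))\<^sup>2"
        by (simp only: power_mult_distrib)
      finally have "norm (bW c (Complex x \<eta>)) \<le> norm T * (9/4) * exp (?k / \<eta>)"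
        by (rule power2_le_imp_le) auto
      also have "\<dots> \<le> norm T * (9/4) * (4/3)" using elim by (intro mult_left_mono) auto
      finally show ?thesis by simp
    qed
    \<comment> \<open>The rotation removes the free oscillation from either combination, so only
      \<kappa> W / z^2 is left in the derivative, and \<open>arctan_scaled_deriv\<close> applies
      with the constant 3 norm T norm \<kappa>.\<close>
    have pq: "norm (exp (- (s * \<i> * of_real x)) * (bW' c (Complex x \<eta>) + s * \<i> * bW c (Complex x \<eta>)) - (bW' c z0 + s * \<i> * T))
        \<le> norm T * (1/4)" if s: "s = 1 \<or> s = -1" for s x
    proof -
      define f where "f x = exp (- (s * \<i> * of_real x)) * (bW' c (Complex x \<eta>) + s * \<i> * bW c (Complex x \<eta>))" for x
      let ?f' = "\<lambda>x. exp (- (s * \<i> * of_real x)) * (b\<kappa> c / (Complex x \<eta>)\<^sup>2 * bW c (Complex x \<eta>))"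
      let ?B = "\<lambda>x. (3 * norm T * ?k) / \<eta> * arctan (x / \<eta>)"
      have e': "((\<lambda>x. exp (- (s * \<i> * of_real x))) has_vector_derivative (- (s * \<i>)) * exp (- (s * \<i> * of_real x))) (at x)" for x :: real
        by (rule has_vector_derivative_eq_rhs[OF field_vector_diff_chain_at[of "\<lambda>x. - (s * \<i> * of_real x)" "- (s * \<i>)" x exp, unfolded o_def]])
           (auto intro!: derivative_eq_intros)
      have fd: "(f has_vector_derivative ?f' x) (at x)" for x
      proof -
        have "(f has_vector_derivative exp (- (s * \<i> * of_real x)) * ((b\<kappa> c / (Complex x \<eta>)\<^sup>2 - 1) * bW c (Complex x \<eta>) + s * \<i> * bW' c (Complex x \<eta>))
          + (- (s * \<i>)) * exp (- (s * \<i> * of_real x)) * (bW' c (Complex x \<eta>) + s * \<i> * bW c (Complex x \<eta>))) (at x)"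
          unfolding f_def
          by (intro has_vector_derivative_mult e' has_vector_derivative_add has_vector_derivative_mult_right vector_derivative_line bW_deriv bW'_deriv nr)
        moreover have "exp (- (s * \<i> * of_real x)) * ((b\<kappa> c / (Complex x \<eta>)\<^sup>2 - 1) * bW c (Complex x \<eta>) + s * \<i> * bW' c (Complex x \<eta>))
          + (- (s * \<i>)) * exp (- (s * \<i> * of_real x)) * (bW' c (Complex x \<eta>) + s * \<i> * bW c (Complex x \<eta>)) = ?f' x"
          using s by (auto simp: algebra_simps)
        ultimately show ?thesis by simp
      qed
      have "norm (f x - f 0) \<le> \<bar>?B x - ?B 0\<bar>"
      proof (rule variation_bound[OF fd])
        show "(?B has_real_derivative 3 * norm T * ?k / (x\<^sup>2 + \<eta>\<^sup>2)) (at x)" for x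
          using elim by (intro arctan_scaled_deriv) auto
        fix x
        have "norm (exp (- (s * \<i> * of_real x))) = 1" using s by (auto simp: norm_exp)
        then have "norm (?f' x) = ?k / (x\<^sup>2 + \<eta>\<^sup>2) * norm (bW c (Complex x \<eta>))"
          by (simp add: norm_mult norm_divide norm_power cmod_power2)
        also have "\<dots> \<le> ?k / (x\<^sup>2 + \<eta>\<^sup>2) * (3 * norm T)" by (intro mult_left_mono Wb) auto
        finally show "norm (?f' x) \<le> 3 * norm T * ?k / (x\<^sup>2 + \<eta>\<^sup>2)" by (simp add: mult_ac)
      qed
      also have "\<dots> \<le> 2 * (3 * norm T * ?k) / \<eta>"
        using arctan_scaled_bound[of \<eta> "3 * norm T * ?k" x] elim by simp
      also have "\<dots> = norm T * (6 * ?k / \<eta>)" by simp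
      also have "\<dots> \<le> norm T * (1/4)" using elim by (intro mult_left_mono) auto
      finally show ?thesis by (simp add: f_def z0 T_def)
    qed
    show ?case
    proof (intro allI notI)
      \<comment> \<open>At a zero of W both rotated combinations have the modulus of V, although on
        the imaginary axis one is at most norm T / 4 and the other at least 7/4 norm T.\<close>
      fix x assume "bj c (Complex x \<eta>) = 0"
      then have w: "bW c (Complex x \<eta>) = 0" by (simp add: bW_def)
      define V where "V = bW' c (Complex x \<eta>)"
      have n1: "norm (exp (- (1 * \<i> * of_real x)) * V) = norm V" "norm (exp (- (- 1 * \<i> * of_real x)) * V) = norm V"
        by (simp_all add: norm_mult norm_exp)
      have "norm V \<le> norm (bW' c z0 + 1 * \<i> * T) + norm T * (1/4)"
        using pq[of 1 x] norm_triangle_sub[of "exp (- (1 * \<i> * of_real x)) * V" "bW' c z0 + 1 * \<i> * T"]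
        unfolding w n1 V_def[symmetric] by simp
      moreover have "norm (bW' c z0 + -1 * \<i> * T) \<le> norm V + norm T * (1/4)"
        using pq[of "-1" x] norm_triangle_sub[of "bW' c z0 + -1 * \<i> * T" "exp (- (- 1 * \<i> * of_real x)) * V"]
          norm_minus_commute[of "bW' c z0 + -1 * \<i> * T" "exp (- (- 1 * \<i> * of_real x)) * V"]
        unfolding w n1 V_def[symmetric] by simp
      ultimately have "norm V \<le> norm (bW' c z0 + \<i> * T) + norm T * (1/4)"
        "norm (bW' c z0 - \<i> * T) \<le> norm V + norm T * (1/4)" by simp_all
      then have "norm T * (7/4) \<le> norm T * (3/4)" using p0 q0 by linarith
      moreover have "norm T > 0" using T0 by simp
      ultimately show False by simp
    qed
  qed
  then obtain Y0 where Y0: "\<And>\<eta> x. \<eta> \<ge> Y0 \<Longrightarrow> bj c (Complex x \<eta>) \<noteq> 0"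
    by (auto simp: eventually_at_top_linorder)
  show ?thesis
  proof (rule that[of "max Y0 1"])
    fix z assume z: "bj c z = 0"
    have "Im z < Y0" using Y0[of "Im z" "Re z"] z by (metis complex_surj not_le)
    moreover have "- Im z < Y0" using Y0[of "Im (-z)" "Re (-z)"] z bj_minus[of c z]
      by (metis complex_surj not_le uminus_complex.simps(2))
    ultimately show "\<bar>Im z\<bar> \<le> max Y0 1" by auto
  qed auto
qed

lemma norm_powr_le:
  assumes "z \<noteq> 0" "norm z \<ge> 1" "Re s \<le> real A"
  shows "norm (z powr s) \<le> exp (\<bar>Im s\<bar> * pi) * norm z ^ A"
proof -
  have "norm (z powr s) = exp (Re s * ln (norm z) - Im s * Im (Ln z))"
    using assms by (simp add: powr_def norm_exp)
  also have "\<dots> \<le> exp (real A * ln (norm z) + \<bar>Im s\<bar> * pi)"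
  proof -
    have "\<bar>Im (Ln z)\<bar> \<le> pi" using mpi_less_Im_Ln[OF assms(1)] Im_Ln_le_pi[OF assms(1)] by linarith
    then have "\<bar>Im s * Im (Ln z)\<bar> \<le> \<bar>Im s\<bar> * pi" unfolding abs_mult by (intro mult_left_mono) auto
    moreover have "Re s * ln (norm z) \<le> real A * ln (norm z)" using assms by (intro mult_right_mono) auto
    ultimately show ?thesis by simp
  qed
  also have "\<dots> = exp (\<bar>Im s\<bar> * pi) * norm z ^ A"
    using assms by (simp add: exp_add exp_of_nat_mult)
  finally show ?thesis .
qed

text \<open>At a zero the energy is all in W', which equals - z^(c + 1/2) / 2 times
  \<open>bj (c + 1) z\<close>. On the segment Re z = 1 of the strip the energy has a positive
  minimum, because \<open>bj c\<close> and \<open>bj (c + 1)\<close> have no common zero there; to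
  the right it loses at most a factor exp (- norm \<kappa>), since \<kappa> / x^2 is integrable.
  Evenness covers the left half.\<close>

lemma bj_zero_derivative_lower:
  assumes "Y > 0"
  obtains \<delta> A where "\<delta> > 0"
    "\<And>z. bj c z = 0 \<Longrightarrow> \<bar>Im z\<bar> \<le> Y \<Longrightarrow> \<bar>Re z\<bar> \<ge> 1 \<Longrightarrow> \<delta> \<le> norm z ^ A * norm (bj (c + 1) z)"
proof -
  let ?a = "c - 1/2" and ?k = "norm (b\<kappa> c)"
  have nr: "Complex x \<eta> \<notin> \<real>\<^sub>\<le>\<^sub>0" if "x > 0" for x \<eta> using that by (auto simp: complex_nonpos_Reals_iff)
  have cont: "continuous_on {-Y..Y} (\<lambda>\<eta>. bS c (Complex 1 \<eta>))"
  proof -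
    have sub: "Complex 1 ` {-Y..Y} \<subseteq> - \<real>\<^sub>\<le>\<^sub>0" using nr[of 1] by auto
    have c1: "continuous_on (- \<real>\<^sub>\<le>\<^sub>0) (bW c)" "continuous_on (- \<real>\<^sub>\<le>\<^sub>0) (bW' c)"
      using bW_deriv bW'_deriv DERIV_isCont by (metis ComplD continuous_at_imp_continuous_on)+
    have "continuous_on {-Y..Y} (\<lambda>\<eta>. 1 + \<i> * complex_of_real \<eta>)" by (intro continuous_intros)
    then have c2: "continuous_on {-Y..Y} (Complex 1)" by (simp add: Complex_eq[abs_def])
    show ?thesis unfolding bS_def
      by (intro continuous_intros continuous_on_compose2[OF c1(1) c2 sub] continuous_on_compose2[OF c1(2) c2 sub])
  qed
  obtain \<eta>0 where \<eta>0: "\<eta>0 \<in> {-Y..Y}" "\<And>\<eta>. \<eta> \<in> {-Y..Y} \<Longrightarrow> bS c (Complex 1 \<eta>0) \<le> bS c (Complex 1 \<eta>)"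
    using continuous_attains_inf[OF _ _ cont] assms by auto
  define m where "m = bS c (Complex 1 \<eta>0)"
  have m: "m > 0"
  proof -
    let ?z = "Complex 1 \<eta>0"
    have z: "?z \<noteq> 0" by (simp add: complex_eq_iff)
    have "bW c ?z \<noteq> 0 \<or> bW' c ?z \<noteq> 0"
      using bj_not_both_zero[OF z, of c] z by (auto simp: bW_def bW'_def)
    then show ?thesis by (auto simp: m_def bS_def add_nonneg_pos add_pos_nonneg)
  qed
  obtain A :: nat where A: "Re (?a + 1) \<le> real A" using real_arch_simple by blast
  define C where "C = exp (\<bar>Im (?a + 1)\<bar> * pi)"
  define \<delta> where "\<delta> = 2 * sqrt (m * exp (- ?k)) / C"
  have \<delta>: "\<delta> > 0" using m by (simp add: \<delta>_def C_def)
  have main: "\<delta> \<le> norm z ^ A * norm (bj (c + 1) z)" if z: "bj c z = 0" "\<bar>Im z\<bar> \<le> Y" "Re z \<ge> 1" for z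
  proof -
    define \<eta> x1 where "\<eta> = Im z" and "x1 = Re z"
    have zc: "z = Complex x1 \<eta>" by (simp add: \<eta>_def x1_def)
    have z0: "z \<noteq> 0" using z by auto
    have z1: "norm z \<ge> 1" using complex_Re_le_cmod[of z] z by linarith
    have "\<exists>S'. ((\<lambda>x. bS c (Complex x \<eta>)) has_real_derivative S') (at x) \<and>
      \<bar>S'\<bar> \<le> ?k / (x\<^sup>2 + \<eta>\<^sup>2) * bS c (Complex x \<eta>)" if "x > 0" for x
      using bS_deriv[OF nr[OF that]] by metis
    then obtain S' where S': "\<And>x. x > 0 \<Longrightarrow> ((\<lambda>x. bS c (Complex x \<eta>)) has_real_derivative S' x) (at x)"
      "\<And>x. x > 0 \<Longrightarrow> \<bar>S' x\<bar> \<le> ?k / (x\<^sup>2 + \<eta>\<^sup>2) * bS c (Complex x \<eta>)" by metis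
    have "bS c (Complex 1 \<eta>) * exp (- (- ?k / x1 - (- ?k / 1))) \<le> bS c (Complex x1 \<eta>)"
    proof (rule gronwall(1)[where S' = S' and A' = "\<lambda>x. ?k / x\<^sup>2" and A = "\<lambda>x. - ?k / x"])
      show "1 \<le> x1" using z by (simp add: x1_def)
      fix x :: real assume x: "1 \<le> x" "x \<le> x1"
      show "((\<lambda>x. bS c (Complex x \<eta>)) has_real_derivative S' x) (at x)" using x by (intro S') auto
      show "((\<lambda>x. - ?k / x) has_real_derivative ?k / x\<^sup>2) (at x)"
        using x by (auto intro!: derivative_eq_intros simp: power2_eq_square)
      have "\<bar>S' x\<bar> \<le> ?k / (x\<^sup>2 + \<eta>\<^sup>2) * bS c (Complex x \<eta>)" using x by (intro S') auto
      also have "\<dots> \<le> ?k / x\<^sup>2 * bS c (Complex x \<eta>)"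
        using x by (intro mult_right_mono bS_nonneg divide_left_mono mult_pos_pos) (auto simp: add_pos_nonneg)
      finally show "\<bar>S' x\<bar> \<le> ?k / x\<^sup>2 * bS c (Complex x \<eta>)" .
    qed
    moreover have "m * exp (- ?k) \<le> bS c (Complex 1 \<eta>) * exp (- (- ?k / x1 - (- ?k / 1)))"
    proof (intro mult_mono)
      show "m \<le> bS c (Complex 1 \<eta>)" unfolding m_def using z by (intro \<eta>0) (auto simp: \<eta>_def)
      show "exp (- ?k) \<le> exp (- (- ?k / x1 - (- ?k / 1)))" using z by (simp add: x1_def)
    qed (auto intro: bS_nonneg)
    ultimately have "m * exp (- ?k) \<le> bS c z" using zc by simp
    also have "bS c z = (norm (bW' c z))\<^sup>2" using z by (simp add: bS_def bW_def)
    finally have "m * exp (- ?k) \<le> (norm (bW' c z))\<^sup>2" .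
    then have "sqrt (m * exp (- ?k)) \<le> norm (bW' c z)" by (simp add: real_le_lsqrt)
    also have "bW' c z = - (z powr (?a + 1) / 2 * bj (c + 1) z)"
      using z z0 powr_add[of z ?a 1] by (simp add: bW'_def)
    also have "norm \<dots> = norm (z powr (?a + 1)) / 2 * norm (bj (c + 1) z)"
      by (simp add: norm_mult)
    also have "\<dots> \<le> (C * norm z ^ A) / 2 * norm (bj (c + 1) z)"
      unfolding C_def by (intro mult_right_mono divide_right_mono norm_powr_le z0 z1 A) auto
    finally show ?thesis by (simp add: \<delta>_def C_def field_simps)
  qed
  show ?thesis
  proof (rule that[OF \<delta>])
    fix z assume z: "bj c z = 0" "\<bar>Im z\<bar> \<le> Y" "\<bar>Re z\<bar> \<ge> 1"
    then consider "Re z \<ge> 1" | "Re (- z) \<ge> 1" by fastforce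
    then show "\<delta> \<le> norm z ^ A * norm (bj (c + 1) z)"
      using main[of z] main[of "- z"] z by cases auto
  qed
qed

text \<open>With the modified Bessel functions I, the quotient is twice I of order \<nu> + 1 divided
  by I of order \<nu>, at \<eta>. The limit says that neighbouring orders grow alike on the
  imaginary axis.\<close>

definition bj_ratio :: "complex \<Rightarrow> bool" where
  "bj_ratio c \<longleftrightarrow> (\<forall>\<^sub>F \<eta> in at_top. bj c (\<i> * of_real \<eta>) \<noteq> 0) \<and>
     ((\<lambda>\<eta>. of_real \<eta> * bj (c + 1) (\<i> * of_real \<eta>) / bj c (\<i> * of_real \<eta>)) \<longlongrightarrow> 2) at_top"

text \<open>Dividing \<open>bj_rec\<close> by \<eta> times \<open>bj (c + 1)\<close> gives c /
  \<eta> plus a quarter of the quotient at c + 1, hence 1/2 in the limit; its reciprocal is again 2.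
  So the limit has to be computed only at orders where Poisson's integral is available.\<close>

lemma bj_ratio_pred:
  assumes "bj_ratio (c + 1)"
  shows "bj_ratio c"
proof -
  let ?y = "\<lambda>k \<eta>. bj (c + k) (\<i> * of_real \<eta>)"
  let ?q = "\<lambda>\<eta>. c / of_real \<eta> + (of_real \<eta> * ?y 2 \<eta> / ?y 1 \<eta>) / 4"
  have l: "((\<lambda>\<eta>. c / of_real \<eta>) \<longlongrightarrow> 0) at_top"
  proof (rule Lim_null_comparison)
    show "((\<lambda>\<eta>. norm c / \<eta>) \<longlongrightarrow> 0) at_top"
      by (intro real_tendsto_divide_at_top[OF tendsto_const] filterlim_ident)
    show "\<forall>\<^sub>F \<eta> in at_top. norm (c / of_real \<eta>) \<le> norm c / \<eta>"
      using eventually_gt_at_top[of 0] by eventually_elim (simp add: norm_divide)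
  qed
  have as: "\<forall>\<^sub>F \<eta> in at_top. ?y 1 \<eta> \<noteq> 0" "((\<lambda>\<eta>. of_real \<eta> * ?y 2 \<eta> / ?y 1 \<eta>) \<longlongrightarrow> 2) at_top"
    using assms by (auto simp: bj_ratio_def add_ac)
  have q: "(?q \<longlongrightarrow> 0 + 2 / 4) at_top" by (intro tendsto_intros l as) auto
  have rel: "\<forall>\<^sub>F \<eta> in at_top. ?y 0 \<eta> = of_real \<eta> * ?y 1 \<eta> * ?q \<eta>"
    using as(1) eventually_gt_at_top[of 0]
  proof eventually_elim
    case (elim \<eta>)
    then have "of_real \<eta> * ?y 1 \<eta> * ?q \<eta> = c * ?y 1 \<eta> + (of_real \<eta>)\<^sup>2 / 4 * ?y 2 \<eta>"
      by (simp add: field_simps power2_eq_square)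
    then show ?case using bj_rec[of c "\<i> * of_real \<eta>"] by (simp add: power_mult_distrib)
  qed
  have qn: "\<forall>\<^sub>F \<eta> in at_top. ?q \<eta> \<noteq> 0" using tendsto_imp_eventually_ne[OF q, of 0] by simp
  have 1: "\<forall>\<^sub>F \<eta> in at_top. ?y 0 \<eta> \<noteq> 0"
    using rel qn as(1) eventually_gt_at_top[of 0]
    by eventually_elim auto
  have "((\<lambda>\<eta>. 1 / ?q \<eta>) \<longlongrightarrow> 1 / (0 + 2 / 4)) at_top" by (intro tendsto_intros q) auto
  then have l2: "((\<lambda>\<eta>. 1 / ?q \<eta>) \<longlongrightarrow> 2) at_top" by simp
  have "\<forall>\<^sub>F \<eta> in at_top. 1 / ?q \<eta> = of_real \<eta> * ?y 1 \<eta> / ?y 0 \<eta>"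
    using rel qn as(1) eventually_gt_at_top[of 0]
    by eventually_elim (simp only:, auto simp: divide_simps)
  from Lim_transform_eventually[OF l2 this] 1 show ?thesis unfolding bj_ratio_def by simp
qed

lemma bj_ratio_of_shift: "bj_ratio (c + of_nat N) \<Longrightarrow> bj_ratio c"
proof (induction N arbitrary: c)
  case (Suc N)
  then show ?case using bj_ratio_pred[of "c + of_nat N"] by (simp add: add_ac)
qed auto

section \<open>Smooth functions and convolution\<close>

definition pd :: "'a \<Rightarrow> ('a::euclidean_space \<Rightarrow> complex) \<Rightarrow> 'a \<Rightarrow> complex" where
  "pd i f x = frechet_derivative f (at x) i"

definition lap :: "('a::euclidean_space \<Rightarrow> complex) \<Rightarrow> 'a \<Rightarrow> complex" where
  "lap f x = (\<Sum>i\<in>Basis. pd i (pd i f) x)"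

text \<open>Differentiability is set up over an arbitrary Euclidean space because the same
  functionals are used on the real line, where they give Poisson's integral for the Bessel
  functions.\<close>

primrec C_diff' :: "nat \<Rightarrow> ('a::euclidean_space \<Rightarrow> complex) \<Rightarrow> bool" where
  "C_diff' 0 f \<longleftrightarrow> continuous_on UNIV f"
| "C_diff' (Suc k) f \<longleftrightarrow> (\<forall>x. f differentiable (at x)) \<and> (\<forall>i\<in>Basis. C_diff' k (pd i f))"

definition smooth :: "('a::euclidean_space \<Rightarrow> complex) \<Rightarrow> bool" where
  "smooth f \<longleftrightarrow> (\<forall>k. C_diff' k f)"

lemma C_diff_iff: "C_diff k f \<longleftrightarrow> C_diff' k (f :: real ^ 'n::finite \<Rightarrow> complex)"
  by (induction k arbitrary: f) (auto simp: Basis_vec_def pd_def[abs_def])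

lemma smooth_functions_iff: "f \<in> smooth_functions \<longleftrightarrow> smooth f"
  by (simp add: smooth_functions_def smooth_def C_diff_iff)

lemma pd_eq: "(f has_derivative f') (at x) \<Longrightarrow> pd i f x = f' i"
  unfolding pd_def by (metis frechet_derivative_at)

text \<open>A coinduction principle: it suffices to lie in a class closed under partial derivatives.
  In the applications F is a set of expressions of one shape, so the order of differentiability
  never has to be followed.\<close>

lemma smooth_coinduct:
  assumes "f \<in> F"
    and step: "\<And>g. g \<in> F \<Longrightarrow> \<exists>g'. (\<forall>x. (g has_derivative g' x) (at x)) \<and> (\<forall>i\<in>Basis. (\<lambda>x. g' x i) \<in> F)"
  shows "smooth f"
proof -
  have "C_diff' k g" if "g \<in> F" for k g
    using that
  proof (induction k arbitrary: g)
    case 0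
    then obtain g' where "\<forall>x. (g has_derivative g' x) (at x)" using step by blast
    then show ?case by (auto intro!: continuous_at_imp_continuous_on has_derivative_continuous)
  next
    case (Suc k)
    then obtain g' where g': "\<forall>x. (g has_derivative g' x) (at x)" "\<forall>i\<in>Basis. (\<lambda>x. g' x i) \<in> F"
      using step by blast
    then have "pd i g = (\<lambda>x. g' x i)" for i using pd_eq[of g] by blast
    then show ?case using g' Suc.IH by (auto simp: differentiable_def)
  qed
  then show ?thesis using assms(1) by (auto simp: smooth_def)
qed

lemma smooth_pd: "smooth f \<Longrightarrow> i \<in> Basis \<Longrightarrow> smooth (pd i f)"
  unfolding smooth_def by (metis C_diff'.simps(2))

lemma smooth_differentiable: "smooth f \<Longrightarrow> f differentiable (at x)"
  unfolding smooth_def by (metis C_diff'.simps(2))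

lemma smooth_has_derivative:
  assumes "smooth f"
  shows "(f has_derivative (\<lambda>h. \<Sum>i\<in>Basis. (h \<bullet> i) *\<^sub>R pd i f x)) (at x)"
proof -
  have d: "(f has_derivative frechet_derivative f (at x)) (at x)"
    using smooth_differentiable[OF assms] frechet_derivative_works by blast
  then have l: "linear (frechet_derivative f (at x))" using has_derivative_linear by blast
  have "frechet_derivative f (at x) h = (\<Sum>i\<in>Basis. (h \<bullet> i) *\<^sub>R pd i f x)" for h
  proof -
    have "frechet_derivative f (at x) h = frechet_derivative f (at x) (\<Sum>i\<in>Basis. (h \<bullet> i) *\<^sub>R i)"
      by (simp add: euclidean_representation)
    then show ?thesis using l by (simp add: linear_sum linear_scale pd_def)
  qed
  then have "frechet_derivative f (at x) = (\<lambda>h. \<Sum>i\<in>Basis. (h \<bullet> i) *\<^sub>R pd i f x)" by (rule ext)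
  then show ?thesis using d by simp
qed

lemma smooth_continuous: "smooth f \<Longrightarrow> continuous_on A f"
  unfolding smooth_def by (metis C_diff'.simps(1) continuous_on_subset subset_UNIV)

lemma smooth_compose_continuous: "smooth f \<Longrightarrow> continuous_on A g \<Longrightarrow> continuous_on A (\<lambda>x. f (g x))"
  using continuous_on_compose2[of UNIV f A g] smooth_continuous by blast

lemma smooth_coinduct1:
  assumes "f \<in> F"
    and step: "\<And>g. g \<in> F \<Longrightarrow> \<exists>g'. (\<forall>x. (g has_derivative (\<lambda>h. \<Sum>i\<in>Basis. (h \<bullet> i) *\<^sub>R g' i x)) (at x)) \<and> (\<forall>i\<in>Basis. g' i \<in> F)"
  shows "smooth f"
proof (rule smooth_coinduct[OF assms(1)])
  fix g assume "g \<in> F"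
  then obtain g' where g': "\<forall>x. (g has_derivative (\<lambda>h. \<Sum>i\<in>Basis. (h \<bullet> i) *\<^sub>R g' i x)) (at x)" "\<forall>i\<in>Basis. g' i \<in> F"
    using step by blast
  have "(\<Sum>i\<in>Basis. (j \<bullet> i) *\<^sub>R g' i x) = g' j x" if "j \<in> Basis" for j x
    using that by (simp add: inner_Basis if_distrib[of "\<lambda>r. r *\<^sub>R _"] cong: if_cong)
  then show "\<exists>g'. (\<forall>x. (g has_derivative g' x) (at x)) \<and> (\<forall>i\<in>Basis. (\<lambda>x. g' x i) \<in> F)"
    using g' by (intro exI[of _ "\<lambda>x h. \<Sum>i\<in>Basis. (h \<bullet> i) *\<^sub>R g' i x"]) auto
qed

lemma add_has_derivative:
  assumes "smooth f" "smooth g"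
  shows "((\<lambda>x. f x + g x) has_derivative (\<lambda>h. \<Sum>i\<in>Basis. (h \<bullet> i) *\<^sub>R (pd i f x + pd i g x))) (at x)"
  using has_derivative_add[OF smooth_has_derivative[OF assms(1)] smooth_has_derivative[OF assms(2)]]
  by (simp add: scaleR_add_right sum.distrib)

lemma smooth_add:
  assumes "smooth f" "smooth g"
  shows "smooth (\<lambda>x. f x + g x)"
proof (rule smooth_coinduct1[where F = "{(\<lambda>x. f x + g x) | f g. smooth f \<and> smooth g}"])
  fix u assume "u \<in> {(\<lambda>x. f x + g x) | f g :: 'a \<Rightarrow> complex. smooth f \<and> smooth g}"
  then obtain f g where u: "u = (\<lambda>x. f x + g x)" "smooth f" "smooth g" by blast
  show "\<exists>g'. (\<forall>x. (u has_derivative (\<lambda>h. \<Sum>i\<in>Basis. (h \<bullet> i) *\<^sub>R g' i x)) (at x)) \<and>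
    (\<forall>i\<in>Basis. g' i \<in> {(\<lambda>x. f x + g x) | f g. smooth f \<and> smooth g})"
    using u add_has_derivative smooth_pd
    by (intro exI[of _ "\<lambda>i x. pd i f x + pd i g x"]) blast
qed (use assms in blast)

lemma cmult_has_derivative:
  assumes "smooth f"
  shows "((\<lambda>x. c * f x) has_derivative (\<lambda>h. \<Sum>i\<in>Basis. (h \<bullet> i) *\<^sub>R (c * pd i f x))) (at x)"
  using has_derivative_mult_right[OF smooth_has_derivative[OF assms], of c]
  by (simp add: sum_distrib_left scaleR_conv_of_real mult_ac)

lemma smooth_cmult:
  assumes "smooth f"
  shows "smooth (\<lambda>x. c * f x)"
proof (rule smooth_coinduct1[where F = "{(\<lambda>x. c * f x) | f. smooth f}"])
  fix u assume "u \<in> {(\<lambda>x. c * f x) | f :: 'a \<Rightarrow> complex. smooth f}"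
  then obtain f where u: "u = (\<lambda>x. c * f x)" "smooth f" by blast
  show "\<exists>g'. (\<forall>x. (u has_derivative (\<lambda>h. \<Sum>i\<in>Basis. (h \<bullet> i) *\<^sub>R g' i x)) (at x)) \<and>
    (\<forall>i\<in>Basis. g' i \<in> {(\<lambda>x. c * f x) | f. smooth f})"
    using u cmult_has_derivative smooth_pd
    by (intro exI[of _ "\<lambda>i x. c * pd i f x"]) blast
qed (use assms in blast)

lemma affine_has_derivative:
  assumes "smooth f"
  shows "((\<lambda>x. f (v + a *\<^sub>R x)) has_derivative (\<lambda>h. \<Sum>i\<in>Basis. (h \<bullet> i) *\<^sub>R (of_real a * pd i f (v + a *\<^sub>R x)))) (at x)"
proof -
  have "((\<lambda>x. v + a *\<^sub>R x) has_derivative (\<lambda>h. a *\<^sub>R h)) (at x)" by (auto intro!: derivative_eq_intros)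
  from has_derivative_compose[OF this smooth_has_derivative[OF assms]] show ?thesis
    by (simp add: scaleR_conv_of_real mult_ac)
qed

lemma smooth_affine:
  assumes "smooth f"
  shows "smooth (\<lambda>x. f (v + a *\<^sub>R x))"
proof -
  \<comment> \<open>The chain rule brings out powers of a, so the invariant class needs a free
    scalar c; the factor 1 puts the function into it.\<close>
  have "smooth (\<lambda>x. 1 * f (v + a *\<^sub>R x))"
  proof (rule smooth_coinduct1[where F = "{(\<lambda>x. c * f (v + a *\<^sub>R x)) | c f. smooth f}"])
    fix u assume "u \<in> {(\<lambda>x. c * f (v + a *\<^sub>R x)) | (c :: complex) f. smooth f}"
    then obtain c f where u: "u = (\<lambda>x. c * f (v + a *\<^sub>R x))" "smooth f" by blast
    have "(u has_derivative (\<lambda>h. \<Sum>i\<in>Basis. (h \<bullet> i) *\<^sub>R ((c * of_real a) * pd i f (v + a *\<^sub>R x)))) (at x)" for x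
      using has_derivative_mult_right[OF affine_has_derivative[OF u(2), of v a x], of c]
      by (simp add: u sum_distrib_left scaleR_conv_of_real mult_ac)
    then show "\<exists>g'. (\<forall>x. (u has_derivative (\<lambda>h. \<Sum>i\<in>Basis. (h \<bullet> i) *\<^sub>R g' i x)) (at x)) \<and>
      (\<forall>i\<in>Basis. g' i \<in> {(\<lambda>x. c * f (v + a *\<^sub>R x)) | (c :: complex) f. smooth f})"
      using u smooth_pd
      by (intro exI[of _ "\<lambda>i x. (c * of_real a) * pd i f (v + a *\<^sub>R x)"]) blast
  qed (use assms in blast)
  then show ?thesis by simp
qed

lemma pd_eq':
  assumes "(f has_derivative (\<lambda>h. \<Sum>i\<in>Basis. (h \<bullet> i) *\<^sub>R g i)) (at x)" "j \<in> Basis"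
  shows "pd j f x = g j"
  using pd_eq[OF assms(1), of j] assms(2)
  by (simp add: inner_Basis if_distrib[of "\<lambda>r. r *\<^sub>R _"] cong: if_cong)

lemma smooth_const [simp]: "smooth (\<lambda>x. c)"
proof (rule smooth_coinduct1[where F = "{(\<lambda>x. c) | c. True}"])
  fix g :: "'a \<Rightarrow> complex" assume "g \<in> {(\<lambda>x. c) | c. True}"
  then obtain c where "g = (\<lambda>x. c)" by blast
  then show "\<exists>g'. (\<forall>x. (g has_derivative (\<lambda>h. \<Sum>i\<in>Basis. (h \<bullet> i) *\<^sub>R g' i x)) (at x)) \<and> (\<forall>i\<in>Basis. g' i \<in> {(\<lambda>x. c) | c. True})"
    by (intro exI[of _ "\<lambda>_ _. 0"]) auto
qed auto

lemma smooth_sum: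
  assumes "finite A" "\<And>a. a \<in> A \<Longrightarrow> smooth (f a)"
  shows "smooth (\<lambda>x. \<Sum>a\<in>A. f a x)"
  using assms by (induction A rule: finite_induct) (auto intro!: smooth_add)

lemma smooth_lap: "smooth f \<Longrightarrow> smooth (lap f)"
  unfolding lap_def[abs_def] by (intro smooth_sum smooth_pd) auto

lemma lap_add:
  assumes "smooth f" "smooth g"
  shows "lap (\<lambda>x. f x + g x) = (\<lambda>x. lap f x + lap g x)"
proof -
  have *: "pd i (\<lambda>x. f x + g x) = (\<lambda>x. pd i f x + pd i g x)" if "smooth f" "smooth g" "i \<in> Basis" for f g :: "'a \<Rightarrow> complex" and i
    by (intro ext pd_eq'[OF add_has_derivative]) (use that in auto)
  show ?thesis unfolding lap_def[abs_def] using assms by (simp add: * smooth_pd sum.distrib)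
qed

lemma lap_cmult:
  assumes "smooth f"
  shows "lap (\<lambda>x. c * f x) = (\<lambda>x. c * lap f x)"
proof -
  have *: "pd i (\<lambda>x. c * f x) = (\<lambda>x. c * pd i f x)" if "smooth f" "i \<in> Basis" for f :: "'a \<Rightarrow> complex" and i
    by (intro ext pd_eq'[OF cmult_has_derivative]) (use that in auto)
  show ?thesis unfolding lap_def[abs_def] using assms by (simp add: * smooth_pd sum_distrib_left)
qed

lemma lap_affine:
  assumes "smooth f"
  shows "lap (\<lambda>x. f (v + a *\<^sub>R x)) = (\<lambda>x. (of_real a)\<^sup>2 * lap f (v + a *\<^sub>R x))"
proof -
  have *: "pd i (\<lambda>x. f (v + a *\<^sub>R x)) = (\<lambda>x. of_real a * pd i f (v + a *\<^sub>R x))"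
    if "smooth f" "i \<in> Basis" for f :: "'a \<Rightarrow> complex" and i
    by (intro ext pd_eq'[OF affine_has_derivative]) (use that in auto)
  have **: "pd i (\<lambda>x. c * f x) = (\<lambda>x. c * pd i f x)" if "smooth f" "i \<in> Basis" for f :: "'a \<Rightarrow> complex" and i c
    by (intro ext pd_eq'[OF cmult_has_derivative]) (use that in auto)
  show ?thesis unfolding lap_def[abs_def] using assms
    by (simp add: * ** smooth_pd smooth_affine sum_distrib_left power2_eq_square mult.assoc)
qed

lemma smooth_reflect: "smooth f \<Longrightarrow> smooth (\<lambda>y. f (x - y))"
  using smooth_affine[of f x "-1"] by simp

lemma lap_reflect: "smooth f \<Longrightarrow> lap (\<lambda>y. f (x - y)) = (\<lambda>y. lap f (x - y))"
  using lap_affine[of f x "-1"] by simp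

section \<open>Differentiation under the integral sign\<close>

lemma integral_has_derivative:
  fixes f :: "'a::euclidean_space \<Rightarrow> complex" and X :: "'w::euclidean_space \<Rightarrow> 'a"
  assumes f: "smooth f" and k: "continuous_on (cbox a b) k" and X: "continuous_on (cbox a b) X"
  shows "((\<lambda>x. integral (cbox a b) (\<lambda>z. k z * f (x + X z))) has_derivative
     (\<lambda>h. \<Sum>i\<in>Basis. (h \<bullet> i) *\<^sub>R integral (cbox a b) (\<lambda>z. k z * pd i f (x + X z)))) (at x)"
proof -
  define D where "D x h = (\<Sum>i\<in>Basis. (h \<bullet> i) *\<^sub>R pd i f x)" for x h
  have D: "(f has_derivative D x) (at x)" for x unfolding D_def by (rule smooth_has_derivative[OF f])
  have bl: "bounded_linear (\<lambda>h. k z * D x h)" for x z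
    by (intro bounded_linear_const_mult has_derivative_bounded_linear[OF D])
  define fx where "fx x z = Blinfun (\<lambda>h. k z * D (x + X z) h)" for x z
  have fx: "blinfun_apply (fx x z) = (\<lambda>h. k z * D (x + X z) h)" for x z
    unfolding fx_def using bl by (rule bounded_linear_Blinfun_apply)
  have cX: "continuous_on (UNIV \<times> cbox a b) (\<lambda>p. fst p + X (snd p))"
    by (intro continuous_intros continuous_on_compose2[OF X]) auto
  have ck: "continuous_on (UNIV \<times> cbox a b) (\<lambda>p. k (snd p))"
    by (intro continuous_intros continuous_on_compose2[OF k]) auto
  have cX': "continuous_on (cbox a b) (\<lambda>z. x + X z)" for x by (intro continuous_intros X)
  have cont: "continuous_on (UNIV \<times> cbox a b) (\<lambda>(x, z). fx x z)"
  proof (rule continuous_on_blinfun_componentwise)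
    fix i :: 'a assume "i \<in> Basis"
    then have "continuous_on (UNIV \<times> cbox a b) (\<lambda>p. k (snd p) * D (fst p + X (snd p)) i)"
      unfolding D_def by (intro continuous_intros ck smooth_compose_continuous[OF _ cX] smooth_pd f)
    then show "continuous_on (UNIV \<times> cbox a b) (\<lambda>p. blinfun_apply (case p of (x, z) \<Rightarrow> fx x z) i)"
      by (simp add: case_prod_beta fx)
  qed
  have "((\<lambda>x. integral (cbox a b) (\<lambda>z. k z * f (x + X z))) has_derivative blinfun_apply (integral (cbox a b) (fx x))) (at x within UNIV)"
  proof (rule leibniz_rule[OF _ _ cont])
    fix x z assume "z \<in> cbox a b"
    have "((\<lambda>x. x + X z) has_derivative (\<lambda>h. h)) (at x)" by (auto intro!: derivative_eq_intros)
    from has_derivative_compose[OF this D] have "((\<lambda>x. f (x + X z)) has_derivative D (x + X z)) (at x)" .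
    from has_derivative_mult_right[OF this, of "k z"]
    show "((\<lambda>x. k z * f (x + X z)) has_derivative blinfun_apply (fx x z)) (at x within UNIV)" by (simp add: fx)
  next
    fix x show "(\<lambda>z. k z * f (x + X z)) integrable_on cbox a b"
      by (intro integrable_continuous continuous_intros k smooth_compose_continuous[OF f cX'])
  qed auto
  moreover have "blinfun_apply (integral (cbox a b) (fx x)) h =
    (\<Sum>i\<in>Basis. (h \<bullet> i) *\<^sub>R integral (cbox a b) (\<lambda>z. k z * pd i f (x + X z)))" for h
  proof -
    have "continuous_on (cbox a b) (fx x)"
      using continuous_on_compose2[OF cont, of "cbox a b" "\<lambda>z. (x, z)"]
      by (simp add: continuous_on_Pair continuous_on_const continuous_on_id image_subset_iff)
    then have "blinfun_apply (integral (cbox a b) (fx x)) h = integral (cbox a b) (\<lambda>z. fx x z h)"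
      by (intro blinfun_apply_integral integrable_continuous)
    also have "\<dots> = integral (cbox a b) (\<lambda>z. \<Sum>i\<in>Basis. (h \<bullet> i) *\<^sub>R (k z * pd i f (x + X z)))"
      by (simp add: fx D_def sum_distrib_left)
    also have "\<dots> = (\<Sum>i\<in>Basis. integral (cbox a b) (\<lambda>z. (h \<bullet> i) *\<^sub>R (k z * pd i f (x + X z))))"
      by (intro integral_sum integrable_cmul integrable_continuous continuous_intros k smooth_compose_continuous[OF _ cX'] smooth_pd f) auto
    finally show ?thesis by simp
  qed
  then have "blinfun_apply (integral (cbox a b) (fx x)) =
      (\<lambda>h. \<Sum>i\<in>Basis. (h \<bullet> i) *\<^sub>R integral (cbox a b) (\<lambda>z. k z * pd i f (x + X z)))" by (rule ext)
  ultimately show ?thesis by simp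
qed

lemma smooth_integral:
  fixes f :: "'a::euclidean_space \<Rightarrow> complex" and X :: "'w::euclidean_space \<Rightarrow> 'a"
  assumes f: "smooth f" and k: "continuous_on (cbox a b) k" and X: "continuous_on (cbox a b) X"
  shows "smooth (\<lambda>x. integral (cbox a b) (\<lambda>z. k z * f (x + X z)))"
proof (rule smooth_coinduct1[where F = "{(\<lambda>x. integral (cbox a b) (\<lambda>z. k z * f (x + X z))) | f. smooth f}"])
  fix u assume "u \<in> {(\<lambda>x. integral (cbox a b) (\<lambda>z. k z * f (x + X z))) | f. smooth f}"
  then obtain f where u: "u = (\<lambda>x. integral (cbox a b) (\<lambda>z. k z * f (x + X z)))" "smooth f" by blast
  show "\<exists>g'. (\<forall>x. (u has_derivative (\<lambda>h. \<Sum>i\<in>Basis. (h \<bullet> i) *\<^sub>R g' i x)) (at x)) \<and>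
    (\<forall>i\<in>Basis. g' i \<in> {(\<lambda>x. integral (cbox a b) (\<lambda>z. k z * f (x + X z))) | f. smooth f})"
    using u integral_has_derivative[OF u(2) k X] smooth_pd
    by (intro exI[of _ "\<lambda>i x. integral (cbox a b) (\<lambda>z. k z * pd i f (x + X z))"]) blast
qed (use f in blast)

lemma pd_integral:
  fixes f :: "'a::euclidean_space \<Rightarrow> complex" and X :: "'w::euclidean_space \<Rightarrow> 'a"
  assumes f: "smooth f" and k: "continuous_on (cbox a b) k" and X: "continuous_on (cbox a b) X" and i: "i \<in> Basis"
  shows "pd i (\<lambda>x. integral (cbox a b) (\<lambda>z. k z * f (x + X z))) = (\<lambda>x. integral (cbox a b) (\<lambda>z. k z * pd i f (x + X z)))"
  by (intro ext pd_eq'[OF integral_has_derivative[OF f k X]] i)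

lemma lap_integral:
  fixes f :: "'a::euclidean_space \<Rightarrow> complex" and X :: "'w::euclidean_space \<Rightarrow> 'a"
  assumes f: "smooth f" and k: "continuous_on (cbox a b) k" and X: "continuous_on (cbox a b) X"
  shows "lap (\<lambda>x. integral (cbox a b) (\<lambda>z. k z * f (x + X z))) = (\<lambda>x. integral (cbox a b) (\<lambda>z. k z * lap f (x + X z)))"
proof
  fix x
  have cX': "continuous_on (cbox a b) (\<lambda>z. x + X z)" for x by (intro continuous_intros X)
  have "lap (\<lambda>x. integral (cbox a b) (\<lambda>z. k z * f (x + X z))) x = (\<Sum>i\<in>Basis. integral (cbox a b) (\<lambda>z. k z * pd i (pd i f) (x + X z)))"
    by (simp add: lap_def pd_integral[OF f k X] pd_integral[OF smooth_pd[OF f] k X])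
  also have "\<dots> = integral (cbox a b) (\<lambda>z. k z * lap f (x + X z))"
    unfolding lap_def sum_distrib_left
    by (intro integral_sum[symmetric] integrable_continuous continuous_intros k smooth_compose_continuous[OF _ cX'] smooth_pd f) auto
  finally show "lap (\<lambda>x. integral (cbox a b) (\<lambda>z. k z * f (x + X z))) x = integral (cbox a b) (\<lambda>z. k z * lap f (x + X z))" .
qed

text \<open>A class of compactly supported distributions that is large enough to contain everything below
  and for which commutativity of convolution reduces to Fubini's theorem on boxes.\<close>

inductive nice :: "(('a::euclidean_space \<Rightarrow> complex) \<Rightarrow> complex) \<Rightarrow> bool" where
  nice_base: "continuous_on (cbox a b) k \<Longrightarrow> continuous_on (cbox a b) X \<Longrightarrow>
     nice (\<lambda>\<phi>. integral (cbox a b) (\<lambda>z :: real \<times> 'a. k z * \<phi> (X z)))"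
| nice_lap: "nice T \<Longrightarrow> nice (\<lambda>\<phi>. T (lap \<phi>))"
| nice_sum: "nice T \<Longrightarrow> nice S \<Longrightarrow> nice (\<lambda>\<phi>. T \<phi> + S \<phi>)"
| nice_scale: "nice T \<Longrightarrow> nice (\<lambda>\<phi>. c * T \<phi>)"
| nice_ext: "nice T \<Longrightarrow> (\<And>\<phi>. smooth \<phi> \<Longrightarrow> S \<phi> = T \<phi>) \<Longrightarrow> nice S"

definition cv :: "('a::euclidean_space \<Rightarrow> complex) \<Rightarrow> (('a \<Rightarrow> complex) \<Rightarrow> complex) \<Rightarrow> 'a \<Rightarrow> complex" where
  "cv f T x = T (\<lambda>y. f (x - y))"

lemma nice_add:
  assumes "nice T" "smooth \<phi>" "smooth \<psi>"
  shows "T (\<lambda>y. \<phi> y + \<psi> y) = T \<phi> + T \<psi>"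
  using assms
proof (induction arbitrary: \<phi> \<psi>)
  case (nice_base a b k X)
  then show ?case unfolding distrib_left
    by (intro integral_add integrable_continuous continuous_on_mult nice_base(1)
        smooth_compose_continuous[OF nice_base(3) nice_base(2)] smooth_compose_continuous[OF nice_base(4) nice_base(2)])
next
  case (nice_lap T)
  then show ?case by (simp add: lap_add smooth_lap)
next
  case (nice_scale T c)
  then show ?case by (simp add: algebra_simps)
next
  case (nice_ext T S)
  then show ?case by (simp add: smooth_add)
qed auto

lemma nice_cmult:
  assumes "nice T" "smooth \<phi>"
  shows "T (\<lambda>y. c * \<phi> y) = c * T \<phi>"
  using assms
proof (induction arbitrary: \<phi>)
  case (nice_base a b k X)
  have "integral (cbox a b) (\<lambda>z. k z * (c * \<phi> (X z))) = integral (cbox a b) (\<lambda>z. c * (k z * \<phi> (X z)))"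
    by (simp add: mult_ac)
  then show ?case by simp
next
  case (nice_lap T)
  then show ?case by (simp add: lap_cmult smooth_lap)
next
  case (nice_sum T S)
  then show ?case by (simp add: algebra_simps)
next
  case (nice_ext T S)
  then show ?case by (simp add: smooth_cmult)
qed auto

lemma nice_cv:
  assumes "nice T" "smooth \<phi>"
  shows "smooth (cv \<phi> T)" "lap (cv \<phi> T) = cv (lap \<phi>) T"
proof -
  have "smooth (cv \<phi> T) \<and> lap (cv \<phi> T) = cv (lap \<phi>) T"
    using assms
  proof (induction arbitrary: \<phi>)
    case (nice_base a b k X)
    then have X: "continuous_on (cbox a b) (\<lambda>z. - X z)" by (intro continuous_intros)
    have "cv \<phi> (\<lambda>\<phi>. integral (cbox a b) (\<lambda>z. k z * \<phi> (X z))) = (\<lambda>x. integral (cbox a b) (\<lambda>z. k z * \<phi> (x + - X z)))" for \<phi>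
      by (simp add: cv_def fun_eq_iff)
    then show ?case using smooth_integral[OF nice_base(3,1) X] lap_integral[OF nice_base(3,1) X] by simp
  next
    case (nice_lap T)
    then have "cv \<phi> (\<lambda>\<phi>. T (lap \<phi>)) = cv (lap \<phi>) T" if "smooth \<phi>" for \<phi>
      using that by (simp add: cv_def fun_eq_iff lap_reflect)
    then show ?case using nice_lap by (simp add: smooth_lap)
  next
    case (nice_sum T S)
    have "cv \<phi> (\<lambda>\<phi>. T \<phi> + S \<phi>) = (\<lambda>x. cv \<phi> T x + cv \<phi> S x)" for \<phi> by (simp add: cv_def fun_eq_iff)
    then show ?case using nice_sum by (simp add: smooth_add lap_add)
  next
    case (nice_scale T c)
    have "cv \<phi> (\<lambda>\<phi>. c * T \<phi>) = (\<lambda>x. c * cv \<phi> T x)" for \<phi> by (simp add: cv_def fun_eq_iff)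
    then show ?case using nice_scale by (simp add: smooth_cmult lap_cmult)
  next
    case (nice_ext T S)
    then have "cv \<phi> S = cv \<phi> T" if "smooth \<phi>" for \<phi> using that by (simp add: cv_def fun_eq_iff smooth_reflect)
    then show ?case using nice_ext by (simp add: smooth_lap)
  qed
  then show "smooth (cv \<phi> T)" "lap (cv \<phi> T) = cv (lap \<phi>) T" by auto
qed

text \<open>This is commutativity when one factor is a kernel on a box. Only the base case needs
  Fubini, for a continuous function on a product of two boxes; the other constructors pass through
  the integral by linearity and by \<open>lap_integral\<close>.\<close>

lemma nice_integral:
  fixes X :: "real \<times> 'a::euclidean_space \<Rightarrow> 'a"
  assumes "nice T" "smooth \<phi>" and k: "continuous_on (cbox a b) k" and X: "continuous_on (cbox a b) X"
  shows "T (\<lambda>y. integral (cbox a b) (\<lambda>z. k z * \<phi> (x - y - X z))) = integral (cbox a b) (\<lambda>z. k z * T (\<lambda>y. \<phi> (x - y - X z)))"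
  using assms(1,2)
proof (induction arbitrary: \<phi>)
  case (nice_base a' b' k' X')
  have 1: "continuous_on (cbox (a', a) (b', b)) (\<lambda>p. k' (fst p))"
    by (intro continuous_intros continuous_on_compose2[OF nice_base(1)]) (auto simp: cbox_Pair_eq)
  have 2: "continuous_on (cbox (a', a) (b', b)) (\<lambda>p. k (snd p))"
    by (intro continuous_intros continuous_on_compose2[OF k]) (auto simp: cbox_Pair_eq)
  have 3: "continuous_on (cbox (a', a) (b', b)) (\<lambda>p. X' (fst p))"
    by (intro continuous_intros continuous_on_compose2[OF nice_base(2)]) (auto simp: cbox_Pair_eq)
  have 4: "continuous_on (cbox (a', a) (b', b)) (\<lambda>p. X (snd p))"
    by (intro continuous_intros continuous_on_compose2[OF X]) (auto simp: cbox_Pair_eq)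
  have "continuous_on (cbox (a', a) (b', b)) (\<lambda>p. k' (fst p) * (k (snd p) * \<phi> (x - X' (fst p) - X (snd p))))"
    by (intro continuous_intros 1 2 3 4 smooth_compose_continuous[OF nice_base(3)])
  then have "continuous_on (cbox (a', a) (b', b)) (\<lambda>(z', z). k' z' * (k z * \<phi> (x - X' z' - X z)))"
    by (simp add: case_prod_beta)
  from integral_swap_continuous[OF this]
  have "integral (cbox a' b') (\<lambda>z'. integral (cbox a b) (\<lambda>z. k' z' * (k z * \<phi> (x - X' z' - X z)))) =
      integral (cbox a b) (\<lambda>z. integral (cbox a' b') (\<lambda>z'. k z * (k' z' * \<phi> (x - X' z' - X z))))"
    by (simp add: mult_ac)
  then show ?case by simp
next
  case (nice_lap T)
  have X': "continuous_on (cbox a b) (\<lambda>z. - X z)" by (intro continuous_intros X)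
  let ?I = "\<lambda>\<phi> u. integral (cbox a b) (\<lambda>z. k z * \<phi> (u + - X z))"
  have "lap (\<lambda>y. ?I \<phi> (x - y)) = (\<lambda>y. lap (?I \<phi>) (x - y))"
    by (rule lap_reflect[OF smooth_integral[OF nice_lap(3) k X']])
  also have "lap (?I \<phi>) = ?I (lap \<phi>)" by (rule lap_integral[OF nice_lap(3) k X'])
  finally have "lap (\<lambda>y. integral (cbox a b) (\<lambda>z. k z * \<phi> (x - y - X z))) = (\<lambda>y. integral (cbox a b) (\<lambda>z. k z * lap \<phi> (x - y - X z)))"
    by simp
  moreover have "lap (\<lambda>y. \<phi> (x - y - X z)) = (\<lambda>y. lap \<phi> (x - y - X z))" for z
    using lap_reflect[OF nice_lap(3), of "x - X z"] by (simp add: algebra_simps)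
  ultimately show ?case using nice_lap.IH[OF smooth_lap[OF nice_lap(3)]] by simp
next
  case (nice_sum T S)
  have i: "(\<lambda>z. k z * R (\<lambda>y. \<phi> (x - y - X z))) integrable_on cbox a b" if "nice R" for R
  proof (intro integrable_continuous continuous_intros k)
    have "R (\<lambda>y. \<phi> (x - y - X z)) = cv \<phi> R (x - X z)" for z by (simp add: cv_def algebra_simps)
    then show "continuous_on (cbox a b) (\<lambda>z. R (\<lambda>y. \<phi> (x - y - X z)))"
      using smooth_compose_continuous[OF nice_cv(1)[OF that nice_sum(5)], of "cbox a b" "\<lambda>z. x - X z"]
        continuous_on_diff[OF continuous_on_const X] by simp
  qed
  show ?case unfolding distrib_left
    by (subst integral_add) (use nice_sum i in auto)
next
  case (nice_scale T c)
  have "integral (cbox a b) (\<lambda>z. k z * (c * T (\<lambda>y. \<phi> (x - y - X z)))) = integral (cbox a b) (\<lambda>z. c * (k z * T (\<lambda>y. \<phi> (x - y - X z))))"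
    by (simp add: mult_ac)
  then show ?case using nice_scale by simp
next
  case (nice_ext T S)
  have X': "continuous_on (cbox a b) (\<lambda>z. - X z)" by (intro continuous_intros X)
  have 1: "smooth (\<lambda>y. integral (cbox a b) (\<lambda>z. k z * \<phi> (x - y - X z)))"
    using smooth_reflect[OF smooth_integral[OF nice_ext(4) k X'], of x] by simp
  have 2: "smooth (\<lambda>y. \<phi> (x - y - X z))" for z
    using smooth_reflect[OF nice_ext(4), of "x - X z"] by (simp add: algebra_simps)
  show ?case using nice_ext 1 2 by simp
qed

text \<open>Induction on \<open>S\<close> only: its base case is \<open>nice_integral\<close> for an
  arbitrary \<open>T\<close>, so the two inductions together cover all pairs of
  constructors.\<close>

theorem nice_commute:
  assumes "nice S" "nice T" "smooth \<phi>"
  shows "cv (cv \<phi> S) T = cv (cv \<phi> T) S"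
  using assms(1,3)
proof (induction arbitrary: \<phi>)
  case (nice_base a b k X)
  show ?case
  proof
    fix x
    have "cv (cv \<phi> (\<lambda>\<phi>. integral (cbox a b) (\<lambda>z. k z * \<phi> (X z)))) T x = T (\<lambda>y. integral (cbox a b) (\<lambda>z. k z * \<phi> (x - y - X z)))"
      by (simp add: cv_def)
    also have "\<dots> = integral (cbox a b) (\<lambda>z. k z * T (\<lambda>y. \<phi> (x - y - X z)))"
      by (rule nice_integral[OF assms(2) nice_base(3,1,2)])
    finally show "cv (cv \<phi> (\<lambda>\<phi>. integral (cbox a b) (\<lambda>z. k z * \<phi> (X z)))) T x = cv (cv \<phi> T) (\<lambda>\<phi>. integral (cbox a b) (\<lambda>z. k z * \<phi> (X z))) x"
      by (simp add: cv_def algebra_simps)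
  qed
next
  case (nice_lap S)
  have e: "cv \<phi> (\<lambda>\<phi>. S (lap \<phi>)) = cv (lap \<phi>) S" if "smooth \<phi>" for \<phi>
    using that by (simp add: cv_def fun_eq_iff lap_reflect)
  show ?case using nice_lap nice_cv[OF assms(2)] by (simp add: e smooth_lap)
next
  case (nice_sum R S)
  have e: "cv \<phi> (\<lambda>\<phi>. R \<phi> + S \<phi>) = (\<lambda>x. cv \<phi> R x + cv \<phi> S x)" for \<phi> by (simp add: cv_def fun_eq_iff)
  have "cv (\<lambda>x. cv \<phi> R x + cv \<phi> S x) T = (\<lambda>x. cv (cv \<phi> R) T x + cv (cv \<phi> S) T x)"
    unfolding cv_def[of _ T]
    by (intro ext nice_add[OF assms(2)] smooth_reflect nice_cv(1) nice_sum)
  then show ?case using nice_sum by (simp add: e)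
next
  case (nice_scale S c)
  have e: "cv \<phi> (\<lambda>\<phi>. c * S \<phi>) = (\<lambda>x. c * cv \<phi> S x)" for \<phi> by (simp add: cv_def fun_eq_iff)
  have "cv (\<lambda>x. c * cv \<phi> S x) T = (\<lambda>x. c * cv (cv \<phi> S) T x)"
    unfolding cv_def[of _ T]
    by (intro ext nice_cmult[OF assms(2)] smooth_reflect nice_cv(1) nice_scale)
  then show ?case using nice_scale by (simp add: e)
next
  case (nice_ext R S)
  have e: "cv \<phi> S = cv \<phi> R" if "smooth \<phi>" for \<phi> using that nice_ext by (simp add: cv_def fun_eq_iff smooth_reflect)
  show ?case using nice_ext nice_cv(1)[OF assms(2)] by (simp add: e)
qed

section \<open>Plane waves of complex frequency and rapidly convergent series of them\<close>

definition wave :: "complex \<Rightarrow> 'a::euclidean_space \<Rightarrow> 'a \<Rightarrow> complex" where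
  "wave l u x = exp (\<i> * l * of_real (x \<bullet> u))"

lemma basis_sum_eq:
  fixes h u :: "'a::euclidean_space" and a b :: complex
  shows "(\<Sum>i\<in>Basis. (h \<bullet> i) *\<^sub>R (a * of_real (i \<bullet> u) * b)) = (a * b) * of_real (h \<bullet> u)"
  by (subst euclidean_inner[of h u])
     (simp add: sum_distrib_left scaleR_conv_of_real inner_commute mult_ac)

lemma wave_has_derivative:
  "(wave l u has_derivative (\<lambda>h. \<Sum>i\<in>Basis. (h \<bullet> i) *\<^sub>R (\<i> * l * of_real (i \<bullet> u) * wave l u x))) (at x)"
proof -
  have "((\<lambda>x. \<i> * l * of_real (x \<bullet> u)) has_derivative (\<lambda>h. \<i> * l * of_real (h \<bullet> u))) (at x)"
    by (auto intro!: derivative_eq_intros)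
  from has_derivative_compose[OF this, of exp "(*) (wave l u x)"]
  have "(wave l u has_derivative (\<lambda>h. wave l u x * (\<i> * l * of_real (h \<bullet> u)))) (at x)"
    using DERIV_exp[of "\<i> * l * of_real (x \<bullet> u)"] by (simp add: wave_def[abs_def] has_field_derivative_def)
  moreover have "wave l u x * (\<i> * l * of_real (h \<bullet> u)) = (\<Sum>i\<in>Basis. (h \<bullet> i) *\<^sub>R (\<i> * l * of_real (i \<bullet> u) * wave l u x))" for h
    unfolding basis_sum_eq by (simp add: mult_ac)
  ultimately show ?thesis by simp
qed

lemma smooth_wave [simp]: "smooth (wave l u)"
proof -
  have "smooth (\<lambda>x. 1 * wave l u x)"
  proof (rule smooth_coinduct1[where F = "{(\<lambda>x. c * wave l u x) | c. True}"])
    fix g assume "g \<in> {(\<lambda>x. c * wave l u x) | c. True}"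
    then obtain c where g: "g = (\<lambda>x. c * wave l u x)" by blast
    have "(g has_derivative (\<lambda>h. \<Sum>i\<in>Basis. (h \<bullet> i) *\<^sub>R ((c * \<i> * l * of_real (i \<bullet> u)) * wave l u x))) (at x)" for x
      using has_derivative_mult_right[OF wave_has_derivative[of l u x], of c]
      by (simp add: g sum_distrib_left scaleR_conv_of_real mult_ac)
    then show "\<exists>g'. (\<forall>x. (g has_derivative (\<lambda>h. \<Sum>i\<in>Basis. (h \<bullet> i) *\<^sub>R g' i x)) (at x)) \<and> (\<forall>i\<in>Basis. g' i \<in> {(\<lambda>x. c * wave l u x) | c. True})"
      by (intro exI[of _ "\<lambda>i x. (c * \<i> * l * of_real (i \<bullet> u)) * wave l u x"]) auto
  qed (simp, rule exI[of _ 1], simp)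
  then show ?thesis by simp
qed

lemma pd_wave: "i \<in> Basis \<Longrightarrow> pd i (wave l u) = (\<lambda>x. (\<i> * l * of_real (i \<bullet> u)) * wave l u x)"
  by (intro ext pd_eq'[OF wave_has_derivative])

lemma lap_wave:
  assumes "u \<in> Basis"
  shows "lap (wave l u) = (\<lambda>x. - (l\<^sup>2) * wave l u x)"
proof -
  have *: "pd i (\<lambda>x. c * f x) = (\<lambda>x. c * pd i f x)" if "smooth f" "i \<in> Basis" for f :: "'a \<Rightarrow> complex" and i c
    by (intro ext pd_eq'[OF cmult_has_derivative]) (use that in auto)
  have "pd i (pd i (wave l u)) x = (if i = u then - (l\<^sup>2) * wave l u x else 0)" if "i \<in> Basis" for i x
  proof -
    have "\<i> * l * (\<i> * l * wave l u x) = (\<i> * \<i>) * (l * l * wave l u x)" by (simp only: mult_ac)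
    then show ?thesis using that assms by (simp add: pd_wave * inner_Basis power2_eq_square)
  qed
  then show ?thesis unfolding lap_def[abs_def] using assms by (simp cong: sum.cong)
qed

definition wave_series :: "(nat \<Rightarrow> complex) \<Rightarrow> (nat \<Rightarrow> complex) \<Rightarrow> 'a::euclidean_space \<Rightarrow> 'a \<Rightarrow> complex" where
  "wave_series d l u x = (\<Sum>j. d j * wave (l j) u x)"

definition rapid :: "(nat \<Rightarrow> complex) \<Rightarrow> (nat \<Rightarrow> complex) \<Rightarrow> bool" where
  "rapid l d \<longleftrightarrow> (\<forall>m. summable (\<lambda>j. norm (d j) * norm (l j) ^ m))"

lemma rapid_mult: "rapid l d \<Longrightarrow> rapid l (\<lambda>j. l j * d j)"
  unfolding rapid_def
proof
  fix m assume "\<forall>m. summable (\<lambda>j. norm (d j) * norm (l j) ^ m)"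
  then have "summable (\<lambda>j. norm (d j) * norm (l j) ^ Suc m)" by blast
  then show "summable (\<lambda>j. norm (l j * d j) * norm (l j) ^ m)" by (simp add: norm_mult mult_ac)
qed

lemma rapid_cmult: "rapid l d \<Longrightarrow> rapid l (\<lambda>j. c * d j)"
  unfolding rapid_def by (auto simp: norm_mult mult.assoc intro!: summable_mult)

lemma norm_wave_le:
  assumes "\<bar>Im l\<bar> \<le> Y" "norm x \<le> R" "norm u \<le> 1"
  shows "norm (wave l u x) \<le> exp (Y * R)"
proof -
  have "\<bar>x \<bullet> u\<bar> \<le> norm x * norm u" by (rule Cauchy_Schwarz_ineq2)
  also have "\<dots> \<le> R * 1" using assms by (intro mult_mono) (auto intro: order_trans[OF norm_ge_zero])
  finally have "\<bar>Im l\<bar> * \<bar>x \<bullet> u\<bar> \<le> Y * R" using assms by (intro mult_mono) auto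
  then have "\<bar>Im l * (x \<bullet> u)\<bar> \<le> Y * R" by (simp add: abs_mult)
  then show ?thesis by (simp add: wave_def norm_exp)
qed

lemma wave_series_uniform:
  assumes "rapid l d" "\<And>j. \<bar>Im (l j)\<bar> \<le> Y" "norm u \<le> 1"
  shows "uniform_limit (cball 0 R) (\<lambda>n x. \<Sum>j<n. d j * wave (l j) u x) (wave_series d l u) sequentially"
  unfolding wave_series_def[abs_def]
proof (rule Weierstrass_m_test)
  have "summable (\<lambda>j. norm (d j) * norm (l j) ^ 0)" using assms(1) unfolding rapid_def by blast
  then show "summable (\<lambda>j. norm (d j) * exp (Y * R))" by (intro summable_mult2) simp
  show "norm (d j * wave (l j) u x) \<le> norm (d j) * exp (Y * R)" if "x \<in> cball 0 R" for j x
    unfolding norm_mult using that assms by (intro mult_left_mono norm_wave_le) auto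
qed

lemma wave_series_sums:
  assumes "rapid l d" "\<And>j. \<bar>Im (l j)\<bar> \<le> Y" "norm u \<le> 1"
  shows "(\<lambda>j. d j * wave (l j) u x) sums wave_series d l u x"
  using tendsto_uniform_limitI[OF wave_series_uniform[OF assms, of "norm x"], of x]
  by (simp add: sums_def)

lemma wave_series_has_derivative:
  assumes r: "rapid l d" and Y: "\<And>j. \<bar>Im (l j)\<bar> \<le> Y" and u: "norm u \<le> 1"
  shows "(wave_series d l u has_derivative (\<lambda>h. \<Sum>i\<in>Basis. (h \<bullet> i) *\<^sub>R (\<i> * of_real (i \<bullet> u) * wave_series (\<lambda>j. l j * d j) l u x))) (at x)"
proof -
  define R where "R = norm x + 1"
  let ?d' = "\<lambda>j. l j * d j"
  let ?f' = "\<lambda>j x h. d j * (\<Sum>i\<in>Basis. (h \<bullet> i) *\<^sub>R (\<i> * l j * of_real (i \<bullet> u) * wave (l j) u x))"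
  \<comment> \<open>All the derivatives have rank one, with the common direction u. The uniform
    estimate for the operators thus reduces to the scalar series with coefficients
    \<open>l j * d j\<close>.\<close>
  have f': "?f' j x h = (\<i> * of_real (h \<bullet> u)) * (?d' j * wave (l j) u x)" for j x h
    unfolding basis_sum_eq by (simp add: mult_ac)
  let ?g' = "\<lambda>x h. (\<i> * of_real (h \<bullet> u)) * wave_series ?d' l u x"
  have "\<exists>g. \<forall>x\<in>ball 0 R. (\<lambda>j. d j * wave (l j) u x) sums g x \<and> (g has_derivative ?g' x) (at x within ball 0 R)"
  proof (rule has_derivative_series[where f = "\<lambda>j x. d j * wave (l j) u x" and f' = ?f' and g' = ?g' and S = "ball 0 R" and x = 0 and l = "wave_series d l u 0"])
    show "((\<lambda>x. d j * wave (l j) u x) has_derivative ?f' j x) (at x within ball 0 R)" for j x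
      by (rule has_derivative_at_withinI[OF has_derivative_mult_right[OF wave_has_derivative]])
    fix e :: real assume e: "e > 0"
    have "\<forall>\<^sub>F n in sequentially. \<forall>x\<in>cball 0 R. dist (\<Sum>j<n. ?d' j * wave (l j) u x) (wave_series ?d' l u x) < e"
      using uniform_limitD[OF wave_series_uniform[OF rapid_mult[OF r] Y u] e] .
    then show "\<forall>\<^sub>F n in sequentially. \<forall>x\<in>ball 0 R. \<forall>h. norm ((\<Sum>j<n. ?f' j x h) - ?g' x h) \<le> e * norm h"
    proof eventually_elim
      case (elim n)
      show ?case
      proof (intro ballI allI)
        fix x h assume x: "x \<in> ball (0::'a) R"
        have "(\<Sum>j<n. ?f' j x h) - ?g' x h = (\<i> * of_real (h \<bullet> u)) * ((\<Sum>j<n. ?d' j * wave (l j) u x) - wave_series ?d' l u x)"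
          by (simp only: f') (simp only: right_diff_distrib sum_distrib_left)
        then have "norm ((\<Sum>j<n. ?f' j x h) - ?g' x h) = \<bar>h \<bullet> u\<bar> * dist (\<Sum>j<n. ?d' j * wave (l j) u x) (wave_series ?d' l u x)"
          by (simp add: norm_mult dist_norm)
        also have "\<dots> \<le> (norm h * norm u) * e"
          using elim x by (intro mult_mono Cauchy_Schwarz_ineq2) (auto intro: less_imp_le)
        also have "\<dots> \<le> (norm h * 1) * e" using u e by (intro mult_right_mono mult_left_mono) auto
        finally show "norm ((\<Sum>j<n. ?f' j x h) - ?g' x h) \<le> e * norm h" by (simp add: mult.commute)
      qed
    qed
  next
    show "(0::'a) \<in> ball 0 R" by (simp add: R_def add_nonneg_pos)
    show "(\<lambda>j. d j * wave (l j) u 0) sums wave_series d l u 0" by (rule wave_series_sums[OF r Y u])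
  qed auto
  then obtain g where g: "\<And>x. x \<in> ball 0 R \<Longrightarrow> (\<lambda>j. d j * wave (l j) u x) sums g x"
    "\<And>x. x \<in> ball 0 R \<Longrightarrow> (g has_derivative ?g' x) (at x within ball 0 R)" by blast
  have xR: "x \<in> ball 0 R" by (simp add: R_def)
  have "g y = wave_series d l u y" if "y \<in> ball 0 R" for y
    using g(1)[OF that] wave_series_sums[OF r Y u, of y] sums_unique2 by blast
  then have "(wave_series d l u has_derivative ?g' x) (at x within ball 0 R)"
    using has_derivative_transform[OF xR _ g(2)[OF xR], of "wave_series d l u"] by simp
  then have "(wave_series d l u has_derivative ?g' x) (at x)"
    using at_within_open[OF xR open_ball] by simp
  moreover have "?g' x h = (\<Sum>i\<in>Basis. (h \<bullet> i) *\<^sub>R (\<i> * of_real (i \<bullet> u) * wave_series ?d' l u x))" for h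
    unfolding basis_sum_eq by (simp add: mult_ac)
  ultimately show ?thesis by (rule has_derivative_eq_rhs[OF _ ext])
qed

lemma wave_series_cmult:
  assumes "rapid l d" "\<And>j. \<bar>Im (l j)\<bar> \<le> Y" "norm u \<le> 1"
  shows "wave_series (\<lambda>j. c * d j) l u x = c * wave_series d l u x"
proof -
  have 1: "(\<lambda>j. c * d j * wave (l j) u x) sums (c * wave_series d l u x)"
    using sums_mult[OF wave_series_sums[OF assms], of c x] by (simp add: mult.assoc)
  have 2: "(\<lambda>j. c * d j * wave (l j) u x) sums wave_series (\<lambda>j. c * d j) l u x"
    by (rule wave_series_sums[OF rapid_cmult[OF assms(1)] assms(2,3)])
  show ?thesis by (rule sums_unique2[OF 2 1])
qed

lemma smooth_wave_series:
  assumes r: "rapid l d" and Y: "\<And>j. \<bar>Im (l j)\<bar> \<le> Y" and u: "norm u \<le> 1"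
  shows "smooth (wave_series d l u)"
proof (rule smooth_coinduct1[where F = "{wave_series d l u | d. rapid l d}"])
  fix g assume "g \<in> {wave_series d l u | d. rapid l d}"
  then obtain d where g: "g = wave_series d l u" "rapid l d" by blast
  have "\<i> * of_real (i \<bullet> u) * wave_series (\<lambda>j. l j * d j) l u x = wave_series (\<lambda>j. (\<i> * of_real (i \<bullet> u)) * (l j * d j)) l u x" for i x
    by (rule wave_series_cmult[OF rapid_mult[OF g(2)] Y u, symmetric])
  then show "\<exists>g'. (\<forall>x. (g has_derivative (\<lambda>h. \<Sum>i\<in>Basis. (h \<bullet> i) *\<^sub>R g' i x)) (at x)) \<and> (\<forall>i\<in>Basis. g' i \<in> {wave_series d l u | d. rapid l d})"
    using wave_series_has_derivative[OF g(2) Y u] rapid_cmult[OF rapid_mult[OF g(2)]]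
    by (intro exI[of _ "\<lambda>i. wave_series (\<lambda>j. (\<i> * of_real (i \<bullet> u)) * (l j * d j)) l u"]) (auto simp: g)
qed (use r in blast)

lemma lap_wave_series:
  assumes r: "rapid l d" and Y: "\<And>j. \<bar>Im (l j)\<bar> \<le> Y" and u: "u \<in> Basis"
  shows "lap (wave_series d l u) = wave_series (\<lambda>j. - ((l j)\<^sup>2) * d j) l u"
proof -
  have u1: "norm u \<le> 1" using u by simp
  have p: "pd i (wave_series d l u) = wave_series (\<lambda>j. (\<i> * of_real (i \<bullet> u)) * (l j * d j)) l u"
    if "i \<in> Basis" "rapid l d" for i d
    by (intro ext, subst pd_eq'[OF wave_series_has_derivative[OF that(2) Y u1] that(1)])
       (rule wave_series_cmult[OF rapid_mult[OF that(2)] Y u1, symmetric])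
  have "pd i (pd i (wave_series d l u)) x = (if i = u then wave_series (\<lambda>j. - ((l j)\<^sup>2) * d j) l u x else 0)"
    if "i \<in> Basis" for i x
  proof -
    define c where "c = \<i> * of_real (i \<bullet> u)"
    have "pd i (pd i (wave_series d l u)) = wave_series (\<lambda>j. c * (l j * (c * (l j * d j)))) l u"
      unfolding c_def p[OF that r] by (rule p[OF that rapid_cmult[OF rapid_mult[OF r]]])
    moreover have "c * (l j * (c * (l j * d j))) = (if i = u then - ((l j)\<^sup>2) * d j else 0)" for j
    proof -
      have A: "c * (l j * (c * (l j * d j))) = (c * c) * ((l j)\<^sup>2 * d j)" by (simp only: power2_eq_square mult_ac)
      have B: "c * c = (if i = u then -1 else 0)" using that u by (simp add: c_def inner_Basis)
      show ?thesis unfolding A B by simp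
    qed
    ultimately show ?thesis by (simp add: wave_series_def)
  qed
  then show ?thesis unfolding lap_def[abs_def] using u by (simp cong: sum.cong)
qed

text \<open>Stands in for the continuity of T in the topology of smooth functions. Uniform
  convergence on compact sets settles the base case, and the Laplacian only multiplies the
  coefficients by - (l j)^2, which keeps them rapid.\<close>

lemma nice_wave_series:
  assumes "nice T" and Y: "\<And>j. \<bar>Im (l j)\<bar> \<le> Y" and u: "u \<in> Basis"
  shows "rapid l d \<Longrightarrow> (\<lambda>j. d j * T (wave (l j) u)) sums T (wave_series d l u)"
  using assms(1)
proof (induction arbitrary: d)
  case (nice_base a b k X)
  have u1: "norm u \<le> 1" using u by simp
  have "compact (X ` cbox a b)" using nice_base by (intro compact_continuous_image) auto
  then have "bounded (X ` cbox a b)" by (rule compact_imp_bounded)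
  then obtain R where "\<forall>x\<in>X ` cbox a b. norm x \<le> R" unfolding bounded_iff by auto
  then have R: "X ` cbox a b \<subseteq> cball 0 R" by auto
  have "compact (k ` cbox a b)" using nice_base by (intro compact_continuous_image) auto
  then have bk: "bounded (k ` cbox a b)" by (rule compact_imp_bounded)
  have ul: "uniform_limit (cbox a b) (\<lambda>n z. \<Sum>j<n. d j * wave (l j) u (X z)) (\<lambda>z. wave_series d l u (X z)) sequentially"
    by (rule uniform_limit_compose'[OF wave_series_uniform[OF nice_base(3) Y u1, of R]]) (use R in auto)
  have sm: "bounded ((\<lambda>z. wave_series d l u (X z)) ` cbox a b)"
    by (rule compact_imp_bounded[OF compact_continuous_image[OF smooth_compose_continuous[OF smooth_wave_series[OF nice_base(3) Y u1] nice_base(2)] compact_cbox]])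
  have "uniform_limit (cbox a b) (\<lambda>n z. k z * (\<Sum>j<n. d j * wave (l j) u (X z))) (\<lambda>z. k z * wave_series d l u (X z)) sequentially"
    by (intro uniform_lim_mult uniform_limit_const ul bk sm)
  then obtain I J where IJ:
    "\<And>n. ((\<lambda>z. k z * (\<Sum>j<n. d j * wave (l j) u (X z))) has_integral I n) (cbox a b)"
    "((\<lambda>z. k z * wave_series d l u (X z)) has_integral J) (cbox a b)" "I \<longlonglongrightarrow> J"
    by (rule uniform_limit_integral_cbox)
       (intro continuous_on_mult continuous_on_sum continuous_on_const nice_base(1) smooth_compose_continuous[OF smooth_wave nice_base(2)], simp, blast)
  have "I n = (\<Sum>j<n. d j * integral (cbox a b) (\<lambda>z. k z * wave (l j) u (X z)))" for n
  proof -
    have "I n = integral (cbox a b) (\<lambda>z. \<Sum>j<n. d j * (k z * wave (l j) u (X z)))"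
      using IJ(1)[of n] by (simp add: integral_unique sum_distrib_left mult_ac)
    also have "\<dots> = (\<Sum>j<n. integral (cbox a b) (\<lambda>z. d j * (k z * wave (l j) u (X z))))"
      by (intro integral_sum integrable_continuous continuous_on_mult continuous_on_const nice_base(1) smooth_compose_continuous[OF smooth_wave nice_base(2)]) auto
    finally show ?thesis by simp
  qed
  then have "I = (\<lambda>n. \<Sum>j<n. d j * integral (cbox a b) (\<lambda>z. k z * wave (l j) u (X z)))" by (rule ext)
  then show ?case using IJ(2,3) by (simp add: sums_def integral_unique)
next
  case (nice_lap T)
  have r2: "rapid l (\<lambda>j. - ((l j)\<^sup>2) * d j)"
    using rapid_cmult[OF rapid_mult[OF rapid_mult[OF nice_lap(3)]], of "-1"] by (simp add: power2_eq_square mult.assoc)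
  have "T (lap (wave (l j) u)) = - ((l j)\<^sup>2) * T (wave (l j) u)" for j
    unfolding lap_wave[OF u] by (rule nice_cmult[OF nice_lap(1)]) simp
  then show ?case using nice_lap.IH[OF r2] by (simp add: lap_wave_series[OF nice_lap(3) Y u] mult_ac)
next
  case (nice_sum T S)
  then show ?case by (simp add: distrib_left sums_add)
next
  case (nice_scale T c)
  show ?case using sums_mult[OF nice_scale.IH[OF nice_scale(3)], of c] by (simp add: mult_ac)
next
  case (nice_ext T S)
  have "norm u \<le> 1" using u by simp
  then have "smooth (wave_series d l u)" by (rule smooth_wave_series[OF nice_ext(4) Y])
  then show ?case using nice_ext.IH[OF nice_ext(4)] by (simp add: nice_ext(2))
qed

section \<open>Integrals against powers of the distance to the sphere\<close>

text \<open>The truncated power of distribution theory. The value 0 for negative x, where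
  \<open>powr\<close> would take a complex branch, extends the kernel (1 - norm y ^ 2)^(b - 1) by
  zero outside the unit ball.\<close>

definition pw :: "real \<Rightarrow> complex \<Rightarrow> complex" where
  "pw x b = (if x \<le> 0 then 0 else exp (b * of_real (ln x)))"

lemma pw_eq_powr: "x > 0 \<Longrightarrow> pw x b = of_real x powr b"
  by (simp add: pw_def powr_def Ln_of_real)

lemma norm_pw: "norm (pw x b) = (if x \<le> 0 then 0 else x powr Re b)"
  by (simp add: pw_def powr_def norm_exp)

lemma pw_add1: "pw x (b + 1) = of_real x * pw x b" if "x \<ge> 0"
  using that by (cases "x = 0") (simp_all add: pw_def distrib_right exp_add exp_of_real)

lemma measurable_pw [measurable]: "(\<lambda>x. pw x b) \<in> borel_measurable borel"
  unfolding pw_def by measurable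

lemma pw_has_vector_derivative_nz:
  assumes "x \<noteq> 0"
  shows "((\<lambda>x. pw x b) has_vector_derivative b * pw x (b - 1)) (at x)"
proof (cases "x > 0")
  case True
  have "((\<lambda>x. exp (b * of_real (ln x))) has_vector_derivative (b * of_real (1 / x)) * exp (b * of_real (ln x))) (at x)"
  proof (rule field_vector_diff_chain_at[of "\<lambda>x. b * of_real (ln x)" "b * of_real (1 / x)" x exp "exp (b * of_real (ln x))", unfolded o_def])
    have "(ln has_real_derivative 1 / x) (at x)" by (rule DERIV_ln_divide[OF True])
    then show "((\<lambda>x. b * of_real (ln x)) has_vector_derivative b * of_real (1 / x)) (at x)"
      by (intro has_vector_derivative_mult_right has_vector_derivative_of_real)
  qed (rule DERIV_exp)
  moreover have "(b * of_real (1 / x)) * exp (b * of_real (ln x)) = b * pw x (b - 1)"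
    using True by (simp add: pw_def left_diff_distrib exp_diff exp_of_real)
  ultimately have "((\<lambda>x. exp (b * of_real (ln x))) has_vector_derivative b * pw x (b - 1)) (at x)" by simp
  then show ?thesis
    by (rule has_vector_derivative_transform_within_open[where S = "{0<..}"]) (use True in \<open>auto simp: pw_def\<close>)
next
  case False
  then have "((\<lambda>x. 0) has_vector_derivative b * pw x (b - 1)) (at x)" using assms by (simp add: pw_def)
  then show ?thesis
    by (rule has_vector_derivative_transform_within_open[where S = "{..<0}"]) (use False assms in \<open>auto simp: pw_def\<close>)
qed

lemma abs_powr_tendsto_0: "((\<lambda>x::real. \<bar>x\<bar> powr p) \<longlongrightarrow> 0) (at 0)" if "p > 0"
proof -
  have "((\<lambda>x::real. \<bar>x\<bar> powr p) \<longlongrightarrow> \<bar>0\<bar> powr p) (at 0)"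
    using that by (intro tendsto_powr' tendsto_intros) auto
  then show ?thesis by simp
qed

lemma continuous_on_pw:
  assumes "Re b > 0"
  shows "continuous_on A (\<lambda>x. pw x b)"
proof (rule continuous_at_imp_continuous_on, intro ballI)
  fix x
  show "isCont (\<lambda>x. pw x b) x"
  proof (cases "x = 0")
    case True
    have "((\<lambda>x. pw x b) \<longlongrightarrow> 0) (at 0)"
      by (rule Lim_null_comparison[OF _ abs_powr_tendsto_0[OF assms]]) (auto simp: norm_pw)
    then show ?thesis using True by (simp add: isCont_def pw_def)
  next
    case False
    from has_vector_derivative_continuous[OF pw_has_vector_derivative_nz[OF this]] show ?thesis .
  qed
qed

lemma pw_has_vector_derivative:
  assumes "Re b > 1"
  shows "((\<lambda>x. pw x b) has_vector_derivative b * pw x (b - 1)) (at x)"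
proof (cases "x = 0")
  case True
  have "((\<lambda>x. pw x b) has_derivative (\<lambda>_. 0)) (at 0)"
  proof (rule has_derivativeI_sandwich[where e = 1 and H = "\<lambda>x. \<bar>x\<bar> powr (Re b - 1)"])
    fix y :: real assume "y \<noteq> 0"
    then show "norm (pw y b - pw 0 b - 0) / norm (y - 0) \<le> \<bar>y\<bar> powr (Re b - 1)"
      by (auto simp: norm_pw pw_def[of 0] powr_diff intro: divide_nonneg_nonpos)
  qed (use abs_powr_tendsto_0[of "Re b - 1"] assms in auto)
  then show ?thesis using True by (simp add: has_vector_derivative_def pw_def)
qed (rule pw_has_vector_derivative_nz)

section \<open>Radial integrals over the unit ball\<close>

definition half_dim :: "'a::euclidean_space itself \<Rightarrow> real" where
  "half_dim _ = real DIM('a) / 2"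

definition rker :: "real \<Rightarrow> 'a::euclidean_space \<Rightarrow> real" where
  "rker x y = (if norm y < 1 then (1 - (norm y)\<^sup>2) powr (x - 1) else 0)"

lemma measurable_rker [measurable]: "rker x \<in> borel_measurable borel"
  unfolding rker_def[abs_def] by measurable

lemma radial_density_emeasure:
  fixes x :: real
  assumes "a > 0" "V > 0"
  shows "emeasure (density lborel (\<lambda>v. ennreal (a * V * v powr (a - 1)) * indicator {0<..<1} v)) {x<..} =
    ennreal (V * (1 - (max 0 (min x 1)) powr a))"
proof -
  define m where "m = max 0 (min x 1)"
  have m: "0 \<le> m" "m \<le> 1" by (auto simp: m_def)
  have "((\<lambda>v. a * V * v powr (a - 1)) has_integral (V * 1 powr a - V * m powr a)) {m..1}"
  proof (rule fundamental_theorem_of_calculus_interior)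
    show "continuous_on {m..1} (\<lambda>v. V * v powr a)"
      using m assms by (intro continuous_on_mult continuous_on_const continuous_on_powr' continuous_on_id) auto
    fix v assume "v \<in> {m<..<1}"
    then have "v > 0" using m by auto
    then have "((\<lambda>v. V * v powr a) has_real_derivative a * V * v powr (a - 1)) (at v)"
      using has_real_derivative_powr[of v a] by (auto intro!: derivative_eq_intros simp: mult_ac)
    then show "((\<lambda>v. V * v powr a) has_vector_derivative a * V * v powr (a - 1)) (at v)"
      by (simp add: has_real_derivative_iff_has_vector_derivative)
  qed (use m in auto)
  then have i: "((\<lambda>v. a * V * v powr (a - 1)) has_integral (V * (1 - m powr a))) {m..1}"
    by (simp add: algebra_simps)
  have "emeasure (density lborel (\<lambda>v. ennreal (a * V * v powr (a - 1)) * indicator {0<..<1} v)) {x<..} =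
    (\<integral>\<^sup>+v. ennreal (a * V * v powr (a - 1)) * indicator {0<..<1} v * indicator {x<..} v \<partial>lborel)"
    by (subst emeasure_density) auto
  also have "\<dots> = (\<integral>\<^sup>+v. ennreal (indicator {m..1} v * (a * V * v powr (a - 1))) \<partial>lborel)"
  proof (rule nn_integral_cong_AE)
    have "AE v in lborel. v \<noteq> m \<and> v \<noteq> 1" using AE_lborel_singleton[of m] AE_lborel_singleton[of 1] by eventually_elim auto
    then show "AE v in lborel. ennreal (a * V * v powr (a - 1)) * indicator {0<..<1} v * indicator {x<..} v =
       ennreal (indicator {m..1} v * (a * V * v powr (a - 1)))"
      by eventually_elim (auto simp: m_def indicator_def max_def min_def split: if_splits)
  qed
  also have "\<dots> = ennreal (V * (1 - m powr a))"
    by (rule nn_integral_has_integral_lebesgue[OF _ i]) (use assms in auto)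
  finally show ?thesis by (simp add: m_def)
qed

text \<open>Polar coordinates in the form used here: the distribution of the squared norm. Two
  measures on the line agree if they agree, finitely, on all rays \<open>{x<..}\<close>; for the
  left one this is the volume V (1 - m^a) of a shell, m being the level x clipped to [0,1], since
  the ball of radius sqrt m has volume V m^a.\<close>

lemma radial_distr:
  defines "a \<equiv> real DIM('a) / 2" and "V \<equiv> unit_ball_vol (real DIM('a))"
  shows "distr (density lborel (indicator (ball (0::'a::euclidean_space) 1))) borel (\<lambda>y. (norm y)\<^sup>2) =
    density lborel (\<lambda>v. ennreal (a * V * v powr (a - 1)) * indicator {0<..<1} v)" (is "?M = ?N")
proof (rule measure_eqI_lessThan)
  have a: "a > 0" "V > 0" by (auto simp: a_def V_def)
  have em: "emeasure ?M {x<..} = ennreal (V * (1 - (max 0 (min x 1)) powr a))" for x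
  proof -
    define m where "m = max 0 (min x 1)"
    have m: "0 \<le> m" "m \<le> 1" by (auto simp: m_def)
    have ma: "m powr a = sqrt m ^ DIM('a)"
    proof (cases "m = 0")
      case False
      then have "m powr a = (m powr (1/2)) powr (real DIM('a))" by (simp add: powr_powr a_def)
      then show ?thesis using False m by (simp add: powr_realpow powr_half_sqrt)
    qed (use a in auto)
    have "emeasure ?M {x<..} = emeasure (density lborel (indicator (ball (0::'a) 1))) ((\<lambda>y. (norm y)\<^sup>2) -` {x<..})"
      by (subst emeasure_distr) auto
    also have "\<dots> = (\<integral>\<^sup>+y. indicator (ball (0::'a) 1) y * indicator ((\<lambda>y. (norm y)\<^sup>2) -` {x<..}) y \<partial>lborel)"
      by (subst emeasure_density) (auto simp: borel_measurable_indicator measurable_sets_borel[of "\<lambda>y::'a. (norm y)\<^sup>2" borel])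
    also have "\<dots> = (\<integral>\<^sup>+y. indicator (ball (0::'a) 1 \<inter> (\<lambda>y. (norm y)\<^sup>2) -` {x<..}) y \<partial>lborel)"
      by (intro nn_integral_cong) (auto simp: indicator_def)
    also have "\<dots> = (\<integral>\<^sup>+y. indicator (ball (0::'a) 1 - cball 0 (sqrt m)) y \<partial>lborel)"
    proof (rule nn_integral_cong_AE)
      have "AE y in lborel. y \<noteq> (0::'a)" by (rule AE_lborel_singleton)
      then show "AE y in lborel. (indicator (ball (0::'a) 1 \<inter> (\<lambda>y. (norm y)\<^sup>2) -` {x<..}) y :: ennreal) = indicator (ball 0 1 - cball 0 (sqrt m)) y"
      proof eventually_elim
        case (elim y)
        define q where "q = (norm y)\<^sup>2"
        have "norm y < 1 \<longleftrightarrow> q < 1" using abs_square_less_1[of "norm y"] by (simp add: q_def)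
        moreover have "norm y \<le> sqrt m \<longleftrightarrow> q \<le> m"
          using real_le_rsqrt[of "norm y" m] sqrt_ge_absD[of "norm y" m] by (auto simp: q_def)
        moreover have "q > 0" using elim by (simp add: q_def)
        moreover have "(norm y)\<^sup>2 = q" by (simp add: q_def)
        ultimately have "y \<in> ball (0::'a) 1 \<inter> (\<lambda>y. (norm y)\<^sup>2) -` {x<..} \<longleftrightarrow> y \<in> ball 0 1 - cball 0 (sqrt m)"
          by (auto simp: m_def max_def min_def split: if_splits)
        then show ?case by (simp add: indicator_def)
      qed
    qed
    also have "\<dots> = emeasure lborel (ball (0::'a) 1 - cball 0 (sqrt m))" by simp
    also have "\<dots> = emeasure lborel (cball (0::'a) 1 - cball 0 (sqrt m) - sphere 0 1)"
      by (intro arg_cong[where f = "emeasure lborel"]) (auto simp: sphere_def)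
    also have "\<dots> = emeasure lborel (cball (0::'a) 1 - cball 0 (sqrt m))"
    proof (rule emeasure_Diff_null_set)
      have "negligible (sphere (0::'a) 1)" by (rule negligible_sphere)
      then show "sphere (0::'a) 1 \<in> null_sets lborel"
        by (simp add: negligible_iff_null_sets null_sets_completion_iff closed_sphere borel_closed)
    qed auto
    also have "\<dots> = emeasure lborel (cball (0::'a) 1) - emeasure lborel (cball (0::'a) (sqrt m))"
      using m by (intro emeasure_Diff subset_cball) (auto simp: emeasure_cball)
    also have "\<dots> = ennreal (V * (1 - m powr a))"
      using m a by (simp add: emeasure_cball V_def ma ennreal_minus algebra_simps)
    finally show ?thesis by (simp add: m_def)
  qed
  show "emeasure ?M {x<..} = emeasure ?N {x<..}" for x
    unfolding em radial_density_emeasure[OF a] ..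
  show "emeasure ?M {x<..} < \<infinity>" for x unfolding em by simp
qed auto

text \<open>In the variable v = norm y ^ 2 this is a Beta integral, and the volume of the unit ball
  cancels \<Gamma>(a). The value explains the constant in \<open>mean_integral\<close>: it gives
  total mass 1.\<close>

lemma rker_nn_integral:
  fixes x :: real
  assumes x: "x > 0"
  defines "a \<equiv> half_dim TYPE('a::euclidean_space)"
  shows "(\<integral>\<^sup>+y. ennreal (rker x (y::'a)) \<partial>lborel) = ennreal (pi powr a * Gamma x / Gamma (x + a))"
proof -
  define V where "V = unit_ball_vol (real DIM('a))"
  have aD: "a = real DIM('a) / 2" by (simp add: a_def half_dim_def)
  have a: "a > 0" "V > 0" by (auto simp: aD V_def)
  let ?g = "\<lambda>v. ennreal ((1 - v) powr (x - 1))"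
  have "(\<integral>\<^sup>+y. ennreal (rker x (y::'a)) \<partial>lborel) = (\<integral>\<^sup>+y. indicator (ball (0::'a) 1) y * ?g ((norm y)\<^sup>2) \<partial>lborel)"
    by (intro nn_integral_cong) (auto simp: rker_def indicator_def)
  also have "\<dots> = (\<integral>\<^sup>+y. ?g ((norm y)\<^sup>2) \<partial>density lborel (indicator (ball (0::'a) 1)))"
    by (subst nn_integral_density) (auto intro!: borel_measurable_indicator)
  also have "\<dots> = (\<integral>\<^sup>+v. ?g v \<partial>distr (density lborel (indicator (ball (0::'a) 1))) borel (\<lambda>y. (norm y)\<^sup>2))"
    by (subst nn_integral_distr) auto
  also have "\<dots> = (\<integral>\<^sup>+v. ennreal (a * V * v powr (a - 1)) * indicator {0<..<1} v * ?g v \<partial>lborel)"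
    unfolding radial_distr aD V_def by (subst nn_integral_density) auto
  also have "\<dots> = (\<integral>\<^sup>+v. ennreal (indicator {0..1} v * (a * V * (v powr (a - 1) * (1 - v) powr (x - 1)))) \<partial>lborel)"
    by (intro nn_integral_cong) (use a in \<open>auto simp: indicator_def mult_ac simp flip: ennreal_mult\<close>)
  also have "\<dots> = ennreal (a * V * Beta a x)"
    by (intro nn_integral_has_integral_lebesgue has_integral_mult_right has_integral_Beta_real) (use a x in auto)
  also have "a * V * Beta a x = pi powr a * Gamma x / Gamma (x + a)"
  proof -
    have "V = pi powr a / Gamma (a + 1)" by (simp add: V_def unit_ball_vol_def aD)
    moreover have "Gamma (a + 1) = a * Gamma a"
      by (rule Gamma_plus1) (use a in \<open>auto elim!: nonpos_Ints_cases\<close>)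
    ultimately have "V = pi powr a / (a * Gamma a)" by simp
    moreover have "Gamma a > 0" using a by (simp add: Gamma_real_pos)
    ultimately show ?thesis using a by (simp add: Beta_def field_simps)
  qed
  finally show ?thesis .
qed

lemma rker_integrable:
  assumes "x > 0"
  shows "integrable lborel (rker x :: 'a::euclidean_space \<Rightarrow> real)"
    "(LINT y|lborel. rker x (y::'a)) = pi powr half_dim TYPE('a) * Gamma x / Gamma (x + half_dim TYPE('a))"
proof -
  have "half_dim TYPE('a) > 0" by (simp add: half_dim_def)
  then have p: "pi powr half_dim TYPE('a) * Gamma x / Gamma (x + half_dim TYPE('a)) \<ge> 0"
    using assms by (intro divide_nonneg_nonneg mult_nonneg_nonneg less_imp_le[OF Gamma_real_pos]) auto
  have "integrable lborel (rker x :: 'a \<Rightarrow> real) \<and> (LINT y|lborel. rker x (y::'a)) = pi powr half_dim TYPE('a) * Gamma x / Gamma (x + half_dim TYPE('a))"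
    by (subst nn_integral_eq_integrable[symmetric]) (use p rker_nn_integral[OF assms, where 'a = 'a] in \<open>auto simp: rker_def\<close>)
  then show "integrable lborel (rker x :: 'a \<Rightarrow> real)"
    "(LINT y|lborel. rker x (y::'a)) = pi powr half_dim TYPE('a) * Gamma x / Gamma (x + half_dim TYPE('a))" by auto
qed

definition kern :: "complex \<Rightarrow> 'a::euclidean_space \<Rightarrow> complex" where
  "kern b y = pw (1 - (norm y)\<^sup>2) (b - 1)"

lemma measurable_kern [measurable]: "kern b \<in> borel_measurable borel"
  unfolding kern_def[abs_def] by measurable

lemma norm_kern: "norm (kern b y) = rker (Re b) y"
proof -
  have "1 - (norm y)\<^sup>2 \<le> 0 \<longleftrightarrow> \<not> norm y < 1" by (simp add: not_less power2_nonneg_ge_1_iff)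
  then show ?thesis by (simp add: kern_def rker_def norm_pw)
qed

lemma kern_outside: "norm y \<ge> 1 \<Longrightarrow> kern b y = 0"
  using norm_kern[of b y] by (simp add: rker_def)

lemma kern_integrable:
  fixes \<phi> :: "'a::euclidean_space \<Rightarrow> complex"
  assumes "Re b > 0" and \<phi>[measurable]: "\<phi> \<in> borel_measurable borel" and B: "\<And>y. norm y < 1 \<Longrightarrow> norm (\<phi> y) \<le> B"
  shows "integrable lborel (\<lambda>y. \<phi> y * kern b y)"
proof (rule Bochner_Integration.integrable_bound)
  show "integrable lborel (\<lambda>y::'a. B * rker (Re b) y)" by (intro integrable_mult_right rker_integrable(1) assms(1))
  have "norm (\<phi> y * kern b y) \<le> norm (B * rker (Re b) y)" for y
  proof (cases "norm y < 1")
    case True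
    then have "norm (\<phi> y) \<le> \<bar>B\<bar>" using B[of y] by auto
    then show ?thesis by (auto simp: norm_mult norm_kern abs_mult rker_def intro!: mult_right_mono)
  qed (simp add: kern_outside)
  then show "AE y in lborel. norm (\<phi> y * kern b y) \<le> norm (B * rker (Re b) y)" by simp
qed measurable

lemma kern_integral_norm_le:
  fixes \<phi> :: "'a::euclidean_space \<Rightarrow> complex"
  assumes "Re b > 0" and \<phi>[measurable]: "\<phi> \<in> borel_measurable borel" and B: "\<And>y. norm y < 1 \<Longrightarrow> norm (\<phi> y) \<le> B"
  shows "norm (LINT y|lborel. \<phi> y * kern b y) \<le> B * (LINT y|lborel. rker (Re b) (y::'a))"
proof -
  have "norm (LINT y|lborel. \<phi> y * kern b y) \<le> (LINT y|lborel. B * rker (Re b) (y::'a))"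
  proof (rule Bochner_Integration.integral_norm_bound_integral)
    show "integrable lborel (\<lambda>y. \<phi> y * kern b y)" by (rule kern_integrable[OF assms])
    show "integrable lborel (\<lambda>y::'a. B * rker (Re b) y)" by (intro integrable_mult_right rker_integrable(1) assms(1))
    show "norm (\<phi> y * kern b y) \<le> B * rker (Re b) y" for y
      using B[of y] by (cases "norm y < 1") (auto simp: norm_mult norm_kern rker_def kern_outside intro!: mult_right_mono)
  qed
  then show ?thesis by simp
qed

text \<open>Expanding \<open>(1 - \<bar>y\<bar>\<^sup>2)\<^sup>b\<close> in powers of \<open>b - b\<^sub>0\<close> under the integral.\<close>

lemma kern_integral_holomorphic_ball:
  fixes \<phi> :: "'a::euclidean_space \<Rightarrow> complex"
  assumes b0: "b0 > 0" and \<phi>[measurable]: "\<phi> \<in> borel_measurable borel" and B: "\<And>y. norm y < 1 \<Longrightarrow> norm (\<phi> y) \<le> B"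
  shows "(\<lambda>b. LINT y|lborel. \<phi> y * kern b y) holomorphic_on ball (of_real b0) b0"
proof -
  define L where "L y = ln (1 - (norm y)\<^sup>2)" for y :: 'a
  have [measurable]: "L \<in> borel_measurable borel" unfolding L_def[abs_def] by measurable
  define c where "c k = (LINT y|lborel. \<phi> y * kern (of_real b0) y * of_real (L y) ^ k / fact k)" for k
  show ?thesis
  proof (rule power_series_holomorphic[where a = c])
    fix b assume b: "b \<in> ball (complex_of_real b0) b0"
    define d where "d = norm (b - of_real b0)"
    have d: "d < b0" using b by (simp add: d_def dist_norm norm_minus_commute)
    define f where "f k y = (b - of_real b0) ^ k * (\<phi> y * kern (of_real b0) y * of_real (L y) ^ k / fact k)" for k y
    have [measurable]: "f k \<in> borel_measurable borel" for k unfolding f_def[abs_def] by measurable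
    have norm_sums: "(\<lambda>k. norm (f k y)) sums (norm (\<phi> y) * rker b0 y * exp (d * \<bar>L y\<bar>))" for y
    proof -
      have "(\<lambda>k. norm (\<phi> y) * rker b0 y * ((d * \<bar>L y\<bar>) ^ k /\<^sub>R fact k)) sums (norm (\<phi> y) * rker b0 y * exp (d * \<bar>L y\<bar>))"
        by (intro sums_mult exp_converges)
      moreover have "norm (f k y) = norm (\<phi> y) * rker b0 y * ((d * \<bar>L y\<bar>) ^ k /\<^sub>R fact k)" for k
        by (simp add: f_def norm_mult norm_divide norm_power norm_kern d_def power_mult_distrib) (simp add: field_simps)
      ultimately show ?thesis by simp
    qed
    \<comment> \<open>For norm y < 1 the factor exp (d * abs (L y)) equals (1 - norm y ^ 2)^(-d),
      which lowers the exponent from \<open>b0\<close> to \<open>b0 - d\<close>. Integrability asks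
      for d < \<open>b0\<close>; hence the radius \<open>b0\<close> of the disc.\<close>
    have bound: "norm (\<phi> y) * rker b0 y * exp (d * \<bar>L y\<bar>) \<le> B * rker (b0 - d) y" for y
    proof (cases "norm y < 1")
      case True
      then have u: "0 < 1 - (norm y)\<^sup>2" "1 - (norm y)\<^sup>2 \<le> 1" by (simp_all add: power_less_one_iff)
      then have "\<bar>L y\<bar> = - L y" by (simp add: L_def)
      then have "exp (d * \<bar>L y\<bar>) = (1 - (norm y)\<^sup>2) powr (- d)" using u by (simp add: L_def powr_def)
      then have "rker b0 y * exp (d * \<bar>L y\<bar>) = rker (b0 - d) y"
        using True by (simp add: rker_def powr_add[symmetric] algebra_simps)
      then show ?thesis using B[OF True] by (simp add: mult.assoc mult_right_mono rker_def)
    qed (simp add: rker_def)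
    have int_b: "integrable lborel (\<lambda>y::'a. B * rker (b0 - d) y)"
      by (intro integrable_mult_right rker_integrable(1)) (use d in simp)
    have le: "norm (f k y) \<le> B * rker (b0 - d) y" for k y
    proof -
      have "norm (f k y) = (\<Sum>k\<in>{k}. norm (f k y))" by simp
      also have "\<dots> \<le> (\<Sum>k. norm (f k y))" by (rule sum_le_suminf[OF sums_summable[OF norm_sums]]) auto
      also have "\<dots> = norm (\<phi> y) * rker b0 y * exp (d * \<bar>L y\<bar>)" using norm_sums[of y] by (simp add: sums_iff)
      finally show ?thesis using bound[of y] by simp
    qed
    have int_f: "integrable lborel (f k)" for k
      by (rule Bochner_Integration.integrable_bound[OF int_b]) (use le in \<open>auto intro!: order_trans[OF le] AE_I2\<close>)
    have sm: "summable (\<lambda>k. LINT y|lborel. norm (f k y))"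
    proof (rule summableI_nonneg_bounded)
      fix n
      have "(\<Sum>k<n. (LINT y|lborel. norm (f k y))) = (LINT y|lborel. (\<Sum>k<n. norm (f k y)))"
        by (rule Bochner_Integration.integral_sum[symmetric]) (use int_f in auto)
      also have "\<dots> \<le> (LINT y|lborel. B * rker (b0 - d) (y::'a))"
      proof (rule Bochner_Integration.integral_mono)
        show "integrable lborel (\<lambda>y. \<Sum>k<n. norm (f k y))" using int_f by auto
        show "(\<Sum>k<n. norm (f k y)) \<le> B * rker (b0 - d) y" for y
        proof -
          have "(\<Sum>k<n. norm (f k y)) \<le> (\<Sum>k. norm (f k y))" by (rule sum_le_suminf[OF sums_summable[OF norm_sums]]) auto
          also have "\<dots> = norm (\<phi> y) * rker b0 y * exp (d * \<bar>L y\<bar>)" using norm_sums[of y] by (simp add: sums_iff)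
          finally show ?thesis using bound[of y] by simp
        qed
      qed (rule int_b)
      finally show "(\<Sum>k<n. (LINT y|lborel. norm (f k y))) \<le> (LINT y|lborel. B * rker (b0 - d) (y::'a))" .
    qed auto
    have "AE y in lborel. summable (\<lambda>k. norm (f k y))" using sums_summable[OF norm_sums] by simp
    from sums_integral[OF int_f this sm]
    have "(\<lambda>k. LINT y|lborel. f k y) sums (LINT y|lborel. (\<Sum>k. f k y))" .
    moreover have "(LINT y|lborel. f k y) = c k * (b - of_real b0) ^ k" for k
      unfolding f_def c_def by (subst integral_mult_right_zero) (rule mult.commute)
    moreover have "(\<Sum>k. f k y) = \<phi> y * kern b y" for y
    proof (cases "norm y < 1")
      case True
      then have u: "0 < 1 - (norm y)\<^sup>2" by (simp add: power_less_one_iff)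
      have "(\<lambda>k. (\<phi> y * kern (of_real b0) y) * (((b - of_real b0) * of_real (L y)) ^ k /\<^sub>R fact k)) sums
        ((\<phi> y * kern (of_real b0) y) * exp ((b - of_real b0) * of_real (L y)))"
        by (intro sums_mult exp_converges)
      moreover have "(\<phi> y * kern (of_real b0) y) * (((b - of_real b0) * of_real (L y)) ^ k /\<^sub>R fact k) = f k y" for k
        by (simp add: f_def power_mult_distrib scaleR_conv_of_real divide_inverse mult_ac)
      moreover have "kern (of_real b0) y * exp ((b - of_real b0) * of_real (L y)) = kern b y"
        using u by (simp add: kern_def pw_def L_def exp_add[symmetric] algebra_simps)
      ultimately show ?thesis by (simp add: sums_iff mult.assoc)
    qed (simp add: f_def kern_outside)
    ultimately show "(\<lambda>k. c k * (b - of_real b0) ^ k) sums (LINT y|lborel. \<phi> y * kern b y)" by simp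
  qed
qed

lemma kern_integral_holomorphic:
  fixes \<phi> :: "'a::euclidean_space \<Rightarrow> complex"
  assumes \<phi>: "\<phi> \<in> borel_measurable borel" and B: "\<And>y. norm y < 1 \<Longrightarrow> norm (\<phi> y) \<le> B"
  shows "(\<lambda>b. LINT y|lborel. \<phi> y * kern b y) holomorphic_on {b. Re b > 0}"
proof -
  have "(\<lambda>b. LINT y|lborel. \<phi> y * kern b y) field_differentiable at b" if "Re b > 0" for b
  proof -
    \<comment> \<open>The discs with centre N and radius N exhaust the right half plane: b lies in
      the N-th one exactly when norm b ^ 2 < 2 N Re b.\<close>
    obtain N :: nat where N: "real N > (norm b)\<^sup>2 / (2 * Re b)" using reals_Archimedean2 by blast
    define b0 where "b0 = real N"
    have "(norm b)\<^sup>2 / (2 * Re b) \<ge> 0" using that by simp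
    then have b0: "b0 > 0" using N by (simp add: b0_def)
    have "(norm b)\<^sup>2 < b0 * (2 * Re b)" using N that by (simp add: b0_def pos_divide_less_eq)
    then have "(norm (of_real b0 - b))\<^sup>2 < b0\<^sup>2"
      by (simp add: cmod_power2 power2_diff algebra_simps)
    then have "b \<in> ball (of_real b0) b0" using b0 by (simp add: dist_norm power2_less_imp_less)
    then show ?thesis
      using kern_integral_holomorphic_ball[OF b0 \<phi> B] by (meson holomorphic_on_imp_differentiable_at open_ball)
  qed
  then show ?thesis by (auto simp: holomorphic_on_def field_differentiable_at_within)
qed

lemma continuous_on_kern:
  assumes "Re b > 1"
  shows "continuous_on A (kern b)"
  unfolding kern_def[abs_def]
  by (rule continuous_on_compose2[OF continuous_on_pw[of "b - 1" UNIV]]) (use assms in \<open>auto intro!: continuous_intros\<close>)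

lemma ball_subset_cbox: "norm y < 1 \<Longrightarrow> y \<in> cbox (- One) (One :: 'a::euclidean_space)"
  using Basis_le_norm[of _ y] by (fastforce simp: mem_box abs_le_iff)

lemma kern_integral_cbox:
  fixes \<phi> :: "'a::euclidean_space \<Rightarrow> complex"
  assumes "Re b > 1" "continuous_on UNIV \<phi>"
  shows "(LINT y|lborel. \<phi> y * kern b y) = integral (cbox (- One) One) (\<lambda>y. \<phi> y * kern b y)"
proof -
  have "compact (\<phi> ` cball 0 1)" using assms by (intro compact_continuous_image continuous_on_subset[OF assms(2)]) auto
  then have "bounded (\<phi> ` cball 0 1)" by (rule compact_imp_bounded)
  then obtain B where B: "\<forall>x\<in>\<phi> ` cball 0 1. norm x \<le> B" unfolding bounded_iff by auto
  have "integrable lborel (\<lambda>y. \<phi> y * kern b y)"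
    by (rule kern_integrable[where B = B]) (use assms B in \<open>auto intro!: borel_measurable_continuous_onI\<close>)
  then have "(LINT y|lborel. \<phi> y * kern b y) = integral UNIV (\<lambda>y. \<phi> y * kern b y)" by (rule integral_lborel[symmetric])
  also have "\<dots> = integral UNIV (\<lambda>y. if y \<in> cbox (- One) One then \<phi> y * kern b y else 0)"
    by (intro arg_cong[where f = "integral UNIV"] ext) (use ball_subset_cbox kern_outside not_less in fastforce)
  also have "\<dots> = integral (cbox (- One) One) (\<lambda>y. \<phi> y * kern b y)" by (rule integral_restrict_UNIV)
  finally show ?thesis .
qed

section \<open>The averaging functionals\<close>

lemma integral_translate_UNIV:
  fixes f :: "'a::euclidean_space \<Rightarrow> complex"
  assumes "integrable lborel f"
  shows "integral UNIV (\<lambda>y. f (y + v)) = integral UNIV f"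
proof -
  have f[measurable]: "f \<in> borel_measurable borel" using assms borel_measurable_integrable by auto
  have i: "integrable lborel (\<lambda>y. f (y + v))"
    using assms by (subst (asm) lborel_distr_plus[of v, symmetric]) (simp add: integrable_distr_eq add.commute)
  have "integral UNIV f = (LINT y|lborel. f y)" by (rule integral_lborel[OF assms])
  also have "\<dots> = (LINT y|distr lborel borel ((+) v). f y)" by (simp add: lborel_distr_plus)
  also have "\<dots> = (LINT y|lborel. f (v + y))" by (rule integral_distr) auto
  also have "\<dots> = (LINT y|lborel. f (y + v))" by (simp add: add.commute)
  also have "\<dots> = integral UNIV (\<lambda>y. f (y + v))" by (rule integral_lborel[OF i, symmetric])
  finally show ?thesis ..
qed

text \<open>Integration by parts: the integral of a directional derivative of a compactly supported
  function vanishes, because integrals are translation invariant.\<close>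

lemma integral_derivative_zero:
  fixes \<psi> D :: "'a::euclidean_space \<Rightarrow> complex"
  assumes i: "i \<in> Basis"
    and \<psi>: "continuous_on UNIV \<psi>" "\<And>y. norm y \<ge> 1 \<Longrightarrow> \<psi> y = 0"
    and D: "continuous_on UNIV D" "\<And>y. norm y \<ge> 1 \<Longrightarrow> D y = 0"
    and d: "\<And>y h. ((\<lambda>h. \<psi> (y + h *\<^sub>R i)) has_vector_derivative D (y + h *\<^sub>R i)) (at h)"
  shows "integral (cbox (- One) One) D = 0"
proof -
  \<comment> \<open>The doubled box contains the support after every shift by h in [-1,1], so the
    integral over it is constant in h and may be differentiated under the integral sign.\<close>
  let ?B = "cbox (- (2 *\<^sub>R One)) (2 *\<^sub>R One) :: 'a set"
  have sub: "y \<in> ?B" if "norm y < 2" for y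
    using Basis_le_norm[of _ y] that by (fastforce simp: mem_box abs_le_iff)
  have res: "integral UNIV f = integral (cbox a b) f" if "\<And>y. y \<notin> cbox a b \<Longrightarrow> f y = 0" for f :: "'a \<Rightarrow> complex" and a b
  proof -
    have "integral (cbox a b) f = integral UNIV (\<lambda>y. if y \<in> cbox a b then f y else 0)"
      by (rule integral_restrict_UNIV[symmetric])
    also have "(\<lambda>y. if y \<in> cbox a b then f y else 0) = f" using that by auto
    finally show ?thesis ..
  qed
  have out: "\<psi> (y + h *\<^sub>R i) = 0" if "y \<notin> ?B" "h \<in> {-1..1}" for y h
  proof (rule \<psi>(2))
    have "2 \<le> norm y" using sub[of y] that by force
    also have "\<dots> \<le> norm (y + h *\<^sub>R i) + norm (h *\<^sub>R i)" using norm_triangle_ineq4[of "y + h *\<^sub>R i" "h *\<^sub>R i"] by simp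
    also have "\<dots> \<le> norm (y + h *\<^sub>R i) + 1" using that i by auto
    finally show "1 \<le> norm (y + h *\<^sub>R i)" by simp
  qed
  have int: "integrable lborel \<psi>"
  proof -
    have "set_integrable lborel (cbox (-One) One) \<psi>"
      unfolding set_integrable_def
      by (rule borel_integrable_compact) (use continuous_on_subset[OF \<psi>(1)] in auto)
    moreover have "(\<lambda>x. indicator (cbox (-One) One) x *\<^sub>R \<psi> x) = \<psi>"
      using ball_subset_cbox \<psi>(2) by (fastforce simp: indicator_def not_less)
    ultimately show ?thesis by (simp add: set_integrable_def)
  qed
  define u where "u h = integral ?B (\<lambda>y. \<psi> (y + h *\<^sub>R i))" for h
  have u: "u h = integral UNIV \<psi>" if "h \<in> {-1..1}" for h
    unfolding u_def integral_translate_UNIV[OF int, of "h *\<^sub>R i", symmetric]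
    by (rule res[symmetric]) (rule out[OF _ that])
  have "(u has_vector_derivative integral ?B (\<lambda>y. D (y + 0 *\<^sub>R i))) (at 0 within {-1..1})"
    unfolding u_def
  proof (rule leibniz_rule_vector_derivative[where fx = "\<lambda>h y. D (y + h *\<^sub>R i)"])
    show "((\<lambda>h. \<psi> (y + h *\<^sub>R i)) has_vector_derivative D (y + h *\<^sub>R i)) (at h within {-1..1})" for y h
      by (rule has_vector_derivative_at_within[OF d])
    show "(\<lambda>y. \<psi> (y + h *\<^sub>R i)) integrable_on ?B" for h
      by (intro integrable_continuous continuous_on_compose2[OF \<psi>(1)] continuous_intros) auto
    have "continuous_on ({- 1..1} \<times> ?B) (\<lambda>p. D (snd p + fst p *\<^sub>R i))"
      by (intro continuous_on_compose2[OF D(1)] continuous_intros) auto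
    then show "continuous_on ({- 1..1} \<times> ?B) (\<lambda>(h, y). D (y + h *\<^sub>R i))" by (simp add: case_prod_beta)
  qed auto
  then have 1: "(u has_vector_derivative integral ?B D) (at 0 within {-1..1})" by simp
  have "((\<lambda>h. integral UNIV \<psi>) has_vector_derivative 0) (at 0 within {-1..1})" by simp
  then have "(u has_vector_derivative 0) (at 0 within {-1..1})"
    by (rule has_vector_derivative_transform[rotated 2]) (auto simp: u)
  moreover have "at (0::real) within {-1..1} \<noteq> bot"
    by (simp add: trivial_limit_within islimpt_Icc)
  ultimately have "integral ?B D = 0" using 1 vector_derivative_unique_within by blast
  moreover have "integral ?B D = integral UNIV D"
    by (rule res[symmetric], rule D(2)) (use sub in force)
  moreover have "integral UNIV D = integral (cbox (- One) One) D"
    by (rule res, rule D(2)) (use ball_subset_cbox in force)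
  ultimately show ?thesis by simp
qed

text \<open>The quotient \<Gamma>(b + n/2) / \<Gamma>(b) of the original normalisation is reduced to
  1 / \<Gamma>(b). The omitted factor is the only source of poles in b, so the means formed with
  \<open>nker\<close> continue to entire functions.\<close>

definition nker :: "complex \<Rightarrow> 'a::euclidean_space \<Rightarrow> complex" where
  "nker b y = rGamma b / of_real (pi powr half_dim TYPE('a)) * kern b y"

definition GL :: "complex \<Rightarrow> real \<Rightarrow> ('a::euclidean_space \<Rightarrow> complex) \<Rightarrow> complex" where
  "GL b t \<phi> = (LINT y|lborel. \<phi> (t *\<^sub>R y) * nker b y)"

definition hc :: "'a::euclidean_space itself \<Rightarrow> complex" where
  "hc T = of_real (half_dim T)"

lemma nker_outside: "norm y \<ge> 1 \<Longrightarrow> nker b y = 0"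
  by (simp add: nker_def kern_outside)

lemma continuous_on_nker: "Re b > 1 \<Longrightarrow> continuous_on A (nker b)"
  unfolding nker_def[abs_def] by (intro continuous_intros continuous_on_kern)

lemma nker_succ: "b * nker (b + 1) y = of_real (1 - (norm y)\<^sup>2) * nker b y"
proof (cases "norm y < 1")
  case True
  then have "kern (b + 1) y = of_real (1 - (norm y)\<^sup>2) * kern b y"
    using pw_add1[of "1 - (norm y)\<^sup>2" "b - 1"] by (simp add: kern_def abs_square_le_1)
  moreover have "b * rGamma (b + 1) = rGamma b" by (rule rGamma_plus1)
  ultimately show ?thesis by (simp add: nker_def mult_ac)
qed (simp add: nker_outside)

text \<open>The normalisation absorbs the exponent: differentiating order b + 1 gives order b with
  no constant depending on b. The integrations by parts for \<open>GL\<close> rest on this.\<close>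

lemma nker_derivative:
  fixes y i :: "'a::euclidean_space"
  assumes "Re b > 1" "i \<in> Basis"
  shows "((\<lambda>h. nker (b + 1) (y + h *\<^sub>R i)) has_vector_derivative - (2 * of_real ((y + h *\<^sub>R i) \<bullet> i)) * nker b (y + h *\<^sub>R i)) (at h)"
proof -
  let ?C = "of_real (pi powr half_dim TYPE('a)) :: complex"
  let ?z = "y + h *\<^sub>R i"
  have "((\<lambda>h. 1 - (norm (y + h *\<^sub>R i))\<^sup>2) has_real_derivative - (2 * (?z \<bullet> i))) (at h)"
    unfolding power2_norm_eq_inner has_field_derivative_def
    by (auto intro!: derivative_eq_intros simp: inner_commute algebra_simps)
  then have "((\<lambda>h. 1 - (norm (y + h *\<^sub>R i))\<^sup>2) has_vector_derivative - (2 * (?z \<bullet> i))) (at h)"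
    by (simp add: has_real_derivative_iff_has_vector_derivative)
  from vector_diff_chain_at[OF this pw_has_vector_derivative[OF assms(1)]]
  have "((\<lambda>h. kern (b + 1) (y + h *\<^sub>R i)) has_vector_derivative (- (2 * (?z \<bullet> i))) *\<^sub>R (b * kern b ?z)) (at h)"
    by (simp add: kern_def o_def)
  from has_vector_derivative_mult_right[OF this, of "rGamma (b + 1) / ?C"]
  have "((\<lambda>h. nker (b + 1) (y + h *\<^sub>R i)) has_vector_derivative rGamma (b + 1) / ?C * ((- (2 * (?z \<bullet> i))) *\<^sub>R (b * kern b ?z))) (at h)"
    by (simp add: nker_def)
  moreover have "rGamma (b + 1) / ?C * ((- (2 * (?z \<bullet> i))) *\<^sub>R (b * kern b ?z)) = - (2 * of_real (?z \<bullet> i)) * ((b * rGamma (b + 1)) / ?C * kern b ?z)"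
    by (simp add: scaleR_conv_of_real)
  ultimately show ?thesis by (simp add: nker_def rGamma_plus1)
qed

lemma smooth_scale_continuous: "smooth \<phi> \<Longrightarrow> continuous_on A (\<lambda>y. \<phi> (t *\<^sub>R y))"
  by (intro smooth_compose_continuous[of \<phi> A "\<lambda>y. t *\<^sub>R y"] continuous_intros)

lemma GL_eq_cbox:
  fixes \<phi> :: "'a::euclidean_space \<Rightarrow> complex"
  assumes "Re b > 1" "smooth \<phi>"
  shows "GL b t \<phi> = integral (cbox (- One) One) (\<lambda>y. \<phi> (t *\<^sub>R y) * nker b y)"
proof -
  let ?C = "rGamma b / of_real (pi powr half_dim TYPE('a))"
  have "GL b t \<phi> = (LINT y|lborel. ?C * (\<phi> (t *\<^sub>R y) * kern b y))"
    by (simp add: GL_def nker_def mult_ac)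
  also have "\<dots> = ?C * (LINT y|lborel. \<phi> (t *\<^sub>R y) * kern b y)" by (rule integral_mult_right_zero)
  also have "\<dots> = ?C * integral (cbox (- One) One) (\<lambda>y. \<phi> (t *\<^sub>R y) * kern b y)"
    by (subst kern_integral_cbox[OF assms(1) smooth_scale_continuous[OF assms(2)]]) simp
  also have "\<dots> = integral (cbox (- One) One) (\<lambda>y. ?C * (\<phi> (t *\<^sub>R y) * kern b y))" by simp
  finally show ?thesis by (simp add: nker_def mult_ac)
qed

lemma smooth_line_derivative:
  assumes "smooth \<phi>" "i \<in> Basis"
  shows "((\<lambda>h. \<phi> (t *\<^sub>R (y + h *\<^sub>R i))) has_vector_derivative of_real t * pd i \<phi> (t *\<^sub>R (y + h *\<^sub>R i))) (at h)"
proof -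
  have "((\<lambda>h. t *\<^sub>R (y + h *\<^sub>R i)) has_derivative (\<lambda>k. t *\<^sub>R (k *\<^sub>R i))) (at h)"
    by (auto intro!: derivative_eq_intros)
  from has_derivative_compose[OF this smooth_has_derivative[OF assms(1)]]
  have "((\<lambda>h. \<phi> (t *\<^sub>R (y + h *\<^sub>R i))) has_derivative
     (\<lambda>k. \<Sum>j\<in>Basis. (t *\<^sub>R (k *\<^sub>R i) \<bullet> j) *\<^sub>R pd j \<phi> (t *\<^sub>R (y + h *\<^sub>R i)))) (at h)" .
  moreover have "(\<Sum>j\<in>Basis. (t *\<^sub>R (k *\<^sub>R i) \<bullet> j) *\<^sub>R pd j \<phi> z) = k *\<^sub>R (of_real t * pd i \<phi> z)" for k z
  proof -
    have "(\<Sum>j\<in>Basis. (t *\<^sub>R (k *\<^sub>R i) \<bullet> j) *\<^sub>R pd j \<phi> z) = (\<Sum>j\<in>Basis. if j = i then k *\<^sub>R (of_real t * pd j \<phi> z) else 0)"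
      using assms(2) by (intro sum.cong) (auto simp: inner_Basis scaleR_conv_of_real mult_ac)
    then show ?thesis using assms(2) by simp
  qed
  ultimately show ?thesis by (simp add: has_vector_derivative_def)
qed

lemma GL_has_vector_derivative_aux:
  fixes \<phi> :: "'a::euclidean_space \<Rightarrow> complex"
  assumes b: "Re b > 1" and \<phi>: "smooth \<phi>"
  shows "((\<lambda>t. GL b t \<phi>) has_vector_derivative
    (\<Sum>i\<in>Basis. integral (cbox (- One) One) (\<lambda>y. of_real (y \<bullet> i) * pd i \<phi> (t *\<^sub>R y) * nker b y))) (at t)"
proof -
  let ?D = "\<lambda>t y. (\<Sum>i\<in>Basis. of_real (y \<bullet> i) * pd i \<phi> (t *\<^sub>R y) * nker b y)"
  have c1: "continuous_on (cbox (- One) One) (\<lambda>y. of_real (y \<bullet> i) * pd i \<phi> (t *\<^sub>R y) * nker b y)" if "i \<in> Basis" for i t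
    by (intro continuous_intros smooth_scale_continuous smooth_pd \<phi> that continuous_on_nker b)
  have "((\<lambda>t. integral (cbox (- One) One) (\<lambda>y. \<phi> (t *\<^sub>R y) * nker b y)) has_vector_derivative
      integral (cbox (- One) One) (?D t)) (at t within UNIV)"
  proof (rule leibniz_rule_vector_derivative)
    fix t :: real and y :: 'a
    have "((\<lambda>t. t *\<^sub>R y) has_derivative (\<lambda>k. k *\<^sub>R y)) (at t)" by (auto intro!: derivative_eq_intros)
    from has_derivative_compose[OF this smooth_has_derivative[OF \<phi>]]
    have "((\<lambda>t. \<phi> (t *\<^sub>R y)) has_derivative (\<lambda>k. \<Sum>i\<in>Basis. (k *\<^sub>R y \<bullet> i) *\<^sub>R pd i \<phi> (t *\<^sub>R y))) (at t)" .
    moreover have "(\<Sum>i\<in>Basis. (k *\<^sub>R y \<bullet> i) *\<^sub>R pd i \<phi> (t *\<^sub>R y)) = k *\<^sub>R (\<Sum>i\<in>Basis. of_real (y \<bullet> i) * pd i \<phi> (t *\<^sub>R y))" for k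
      by (simp add: scaleR_sum_right scaleR_conv_of_real sum_distrib_left mult_ac)
    ultimately have "((\<lambda>t. \<phi> (t *\<^sub>R y)) has_vector_derivative (\<Sum>i\<in>Basis. of_real (y \<bullet> i) * pd i \<phi> (t *\<^sub>R y))) (at t)"
      by (simp add: has_vector_derivative_def)
    from has_vector_derivative_mult_left[OF this, of "nker b y"]
    show "((\<lambda>t. \<phi> (t *\<^sub>R y) * nker b y) has_vector_derivative ?D t y) (at t within UNIV)" by (simp add: sum_distrib_right)
  next
    show "(\<lambda>y. \<phi> (t *\<^sub>R y) * nker b y) integrable_on cbox (- One) One" for t
      by (intro integrable_continuous continuous_intros smooth_scale_continuous \<phi> continuous_on_nker b)
    have "continuous_on (UNIV \<times> cbox (- One) One) (\<lambda>p. nker b (snd p))"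
      by (rule continuous_on_compose2[OF continuous_on_nker[OF b, of UNIV]]) (auto intro!: continuous_intros)
    moreover have "continuous_on (UNIV \<times> cbox (- One) One) (\<lambda>p. pd i \<phi> (fst p *\<^sub>R snd p))" if "i \<in> Basis" for i
      by (rule smooth_compose_continuous[OF smooth_pd[OF \<phi> that]]) (intro continuous_intros)
    ultimately have "continuous_on (UNIV \<times> cbox (- One) One) (\<lambda>p. ?D (fst p) (snd p))"
      by (intro continuous_intros) auto
    then show "continuous_on (UNIV \<times> cbox (- One) One) (\<lambda>(t, y). ?D t y)" by (simp add: case_prod_beta)
  qed auto
  moreover have "integral (cbox (- One) One) (?D t) = (\<Sum>i\<in>Basis. integral (cbox (- One) One) (\<lambda>y. of_real (y \<bullet> i) * pd i \<phi> (t *\<^sub>R y) * nker b y))"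
    by (intro integral_sum integrable_continuous c1) auto
  ultimately show ?thesis using GL_eq_cbox[OF b \<phi>] by simp
qed

text \<open>The scaling derivative brings in the weight y_i times \<open>nker b\<close>, which is -
  1/2 times the i-th derivative of \<open>nker (b + 1)\<close>. Integration by parts moves it onto a
  second derivative of \<phi> and brings out a factor t.\<close>

lemma GL_has_vector_derivative:
  fixes \<phi> :: "'a::euclidean_space \<Rightarrow> complex"
  assumes b: "Re b > 1" and \<phi>: "smooth \<phi>"
  shows "((\<lambda>t. GL b t \<phi>) has_vector_derivative of_real t / 2 * GL (b + 1) t (lap \<phi>)) (at t)"
proof -
  have b1: "Re (b + 1) > 1" using b by simp
  have parts: "integral (cbox (- One) One) (\<lambda>y. of_real (y \<bullet> i) * pd i \<phi> (t *\<^sub>R y) * nker b y) =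
     of_real t / 2 * integral (cbox (- One) One) (\<lambda>y. pd i (pd i \<phi>) (t *\<^sub>R y) * nker (b + 1) y)" if i: "i \<in> Basis" for i
  proof -
    let ?a = "\<lambda>y. of_real (y \<bullet> i) * pd i \<phi> (t *\<^sub>R y) * nker b y"
    let ?c = "\<lambda>y. pd i (pd i \<phi>) (t *\<^sub>R y) * nker (b + 1) y"
    let ?D = "\<lambda>y. of_real t * ?c y - 2 * ?a y"
    have ca: "continuous_on A ?a" for A
      by (intro continuous_intros smooth_scale_continuous smooth_pd \<phi> i continuous_on_nker b)
    have cc: "continuous_on A ?c" for A
      by (intro continuous_intros smooth_scale_continuous smooth_pd \<phi> i continuous_on_nker b1)
    have "integral (cbox (- One) One) ?D = 0"
    proof (rule integral_derivative_zero[OF i, where \<psi> = "\<lambda>y. pd i \<phi> (t *\<^sub>R y) * nker (b + 1) y"])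
      show "continuous_on UNIV (\<lambda>y. pd i \<phi> (t *\<^sub>R y) * nker (b + 1) y)"
        by (intro continuous_intros smooth_scale_continuous smooth_pd \<phi> i continuous_on_nker b1)
      show "continuous_on UNIV ?D" by (intro continuous_intros ca cc)
      fix y h
      show "((\<lambda>h. pd i \<phi> (t *\<^sub>R (y + h *\<^sub>R i)) * nker (b + 1) (y + h *\<^sub>R i)) has_vector_derivative ?D (y + h *\<^sub>R i)) (at h)"
        by (rule has_vector_derivative_eq_rhs[OF has_vector_derivative_mult[OF smooth_line_derivative[OF smooth_pd[OF \<phi> i] i] nker_derivative[OF b i]]])
           (simp add: algebra_simps)
    qed (auto simp: nker_outside)
    moreover have "integral (cbox (- One) One) ?D = integral (cbox (- One) One) (\<lambda>y. of_real t * ?c y) - integral (cbox (- One) One) (\<lambda>y. 2 * ?a y)"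
      by (intro integral_diff integrable_continuous continuous_intros ca cc)
    ultimately show ?thesis by simp
  qed
  have "(\<Sum>i\<in>Basis. integral (cbox (- One) One) (\<lambda>y. of_real (y \<bullet> i) * pd i \<phi> (t *\<^sub>R y) * nker b y)) =
     of_real t / 2 * (\<Sum>i\<in>Basis. integral (cbox (- One) One) (\<lambda>y. pd i (pd i \<phi>) (t *\<^sub>R y) * nker (b + 1) y))"
    by (simp add: parts sum_distrib_left)
  also have "(\<Sum>i\<in>Basis. integral (cbox (- One) One) (\<lambda>y. pd i (pd i \<phi>) (t *\<^sub>R y) * nker (b + 1) y)) = GL (b + 1) t (lap \<phi>)"
    unfolding GL_eq_cbox[OF b1 smooth_lap[OF \<phi>]] lap_def sum_distrib_right
    by (intro integral_sum[symmetric] integrable_continuous continuous_intros smooth_scale_continuous smooth_pd \<phi> continuous_on_nker b1) auto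
  finally show ?thesis using GL_has_vector_derivative_aux[OF b \<phi>, of t] by (simp only:)
qed

text \<open>Obtained by integrating the divergence of y \<phi>(t y) \<open>nker (b + 1) y\<close>.
  The divergence of y contributes n, hence \<open>hc\<close> = n/2; the weight norm y ^ 2 is removed
  by \<open>nker_succ\<close>; the gradient term is the scaling derivative, known from
  \<open>GL_has_vector_derivative\<close>. On eigenfunctions of the Laplacian the formula has the
  shape of \<open>bj_rec\<close>.\<close>

lemma GL_recurrence_gt1:
  fixes \<phi> :: "'a::euclidean_space \<Rightarrow> complex"
  assumes b: "Re b > 1" and \<phi>: "smooth \<phi>"
  shows "GL b t \<phi> = (b + hc TYPE('a)) * GL (b + 1) t \<phi> + (of_real t)\<^sup>2 / 4 * GL (b + 2) t (lap \<phi>)"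
proof -
  have b1: "Re (b + 1) > 1" using b by simp
  let ?I = "integral (cbox (- One) One)"
  let ?A = "\<lambda>i y. of_real (y \<bullet> i) * pd i \<phi> (t *\<^sub>R y) * nker (b + 1) y"
  let ?P = "\<lambda>y. \<phi> (t *\<^sub>R y) * nker (b + 1) y"
  let ?Q = "\<lambda>i y. (of_real (y \<bullet> i))\<^sup>2 * (\<phi> (t *\<^sub>R y) * nker b y)"
  have cA: "continuous_on A (?A i)" if "i \<in> Basis" for A i
    by (intro continuous_intros smooth_scale_continuous smooth_pd \<phi> that continuous_on_nker b1)
  have cP: "continuous_on A ?P" for A
    by (intro continuous_intros smooth_scale_continuous \<phi> continuous_on_nker b1)
  have cQ: "continuous_on A (?Q i)" for A i
    by (intro continuous_intros smooth_scale_continuous \<phi> continuous_on_nker b)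
  have cR: "continuous_on A (\<lambda>y. \<phi> (t *\<^sub>R y) * nker b y)" for A
    by (intro continuous_intros smooth_scale_continuous \<phi> continuous_on_nker b)
  have parts: "of_real t * ?I (?A i) = 2 * ?I (?Q i) - ?I ?P" if i: "i \<in> Basis" for i
  proof -
    let ?D = "\<lambda>y. of_real t * ?A i y + ?P y - 2 * ?Q i y"
    have "?I ?D = 0"
    proof (rule integral_derivative_zero[OF i, where \<psi> = "\<lambda>y. of_real (y \<bullet> i) * (\<phi> (t *\<^sub>R y) * nker (b + 1) y)"])
      show "continuous_on UNIV (\<lambda>y. of_real (y \<bullet> i) * (\<phi> (t *\<^sub>R y) * nker (b + 1) y))"
        by (intro continuous_intros cP)
      show "continuous_on UNIV ?D" by (intro continuous_intros cA cP cQ i)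
      fix y h
      have lin: "((\<lambda>h. of_real ((y + h *\<^sub>R i) \<bullet> i)) has_vector_derivative (1::complex)) (at h)"
      proof -
        have "((\<lambda>h. (y + h *\<^sub>R i) \<bullet> i) has_real_derivative 1) (at h)"
          using i by (auto intro!: derivative_eq_intros simp: inner_left_distrib)
        from has_vector_derivative_of_real[OF this] show ?thesis by simp
      qed
      show "((\<lambda>h. of_real ((y + h *\<^sub>R i) \<bullet> i) * (\<phi> (t *\<^sub>R (y + h *\<^sub>R i)) * nker (b + 1) (y + h *\<^sub>R i))) has_vector_derivative ?D (y + h *\<^sub>R i)) (at h)"
        by (rule has_vector_derivative_eq_rhs[OF has_vector_derivative_mult[OF lin has_vector_derivative_mult[OF smooth_line_derivative[OF \<phi> i] nker_derivative[OF b i]]]])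
           (simp add: algebra_simps power2_eq_square)
    qed (auto simp: nker_outside)
    moreover have "?I ?D = ?I (\<lambda>y. of_real t * ?A i y) + ?I ?P - ?I (\<lambda>y. 2 * ?Q i y)"
      by (subst integral_diff integral_add, intro integrable_continuous continuous_intros cA cP cQ i, intro integrable_continuous continuous_intros cA cP cQ i)+ simp
    ultimately show ?thesis by (simp add: algebra_simps)
  qed
  have "GL_sum": "(\<Sum>i\<in>Basis. ?I (?Q i)) = GL b t \<phi> - b * GL (b + 1) t \<phi>"
  proof -
    have "(\<Sum>i\<in>Basis. ?I (?Q i)) = ?I (\<lambda>y. \<Sum>i\<in>Basis. ?Q i y)"
      by (intro integral_sum[symmetric] integrable_continuous cQ) auto
    also have "(\<lambda>y. \<Sum>i\<in>Basis. ?Q i y) = (\<lambda>y. \<phi> (t *\<^sub>R y) * nker b y - b * ?P y)"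
    proof
      fix y :: 'a
      have "(\<Sum>i\<in>Basis. (of_real (y \<bullet> i))\<^sup>2 :: complex) = of_real ((norm y)\<^sup>2)"
        unfolding norm_eq_sqrt_inner by (subst (2) euclidean_inner) (simp add: power2_eq_square sum_nonneg)
      then have "(\<Sum>i\<in>Basis. ?Q i y) = of_real ((norm y)\<^sup>2) * (\<phi> (t *\<^sub>R y) * nker b y)"
        by (simp only: sum_distrib_right[symmetric])
      also have "\<dots> = \<phi> (t *\<^sub>R y) * nker b y - \<phi> (t *\<^sub>R y) * (of_real (1 - (norm y)\<^sup>2) * nker b y)"
        by (simp add: algebra_simps)
      finally show "(\<Sum>i\<in>Basis. ?Q i y) = \<phi> (t *\<^sub>R y) * nker b y - b * ?P y"
        unfolding nker_succ[symmetric] by (simp add: mult_ac)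
    qed
    also have "?I (\<lambda>y. \<phi> (t *\<^sub>R y) * nker b y - b * ?P y) = ?I (\<lambda>y. \<phi> (t *\<^sub>R y) * nker b y) - ?I (\<lambda>y. b * ?P y)"
      by (intro integral_diff integrable_continuous continuous_intros cR cP)
    finally show ?thesis by (simp add: GL_eq_cbox[OF b \<phi>] GL_eq_cbox[OF b1 \<phi>])
  qed
  have "(\<Sum>i\<in>Basis. ?I (?A i)) = of_real t / 2 * GL (b + 1 + 1) t (lap \<phi>)"
    by (rule vector_derivative_unique_at[OF GL_has_vector_derivative_aux[OF b1 \<phi>] GL_has_vector_derivative[OF b1 \<phi>]])
  then have "of_real t * (of_real t / 2 * GL (b + 1 + 1) t (lap \<phi>)) = (\<Sum>i\<in>Basis. of_real t * ?I (?A i))"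
    by (simp only: sum_distrib_left[symmetric])
  also have "\<dots> = (\<Sum>i\<in>Basis. 2 * ?I (?Q i) - ?I ?P)"
    by (intro sum.cong refl parts)
  also have "\<dots> = 2 * (GL b t \<phi> - b * GL (b + 1) t \<phi>) - of_nat DIM('a) * GL (b + 1) t \<phi>"
    by (simp add: sum_subtractf sum_distrib_left[symmetric] GL_sum GL_eq_cbox[OF b1 \<phi>])
  finally show ?thesis by (simp add: hc_def half_dim_def power2_eq_square add.assoc field_simps)
qed

lemma bounded_on_ball:
  fixes \<phi> :: "'a::euclidean_space \<Rightarrow> complex"
  assumes "smooth \<phi>"
  obtains B where "\<And>y. norm y \<le> R \<Longrightarrow> norm (\<phi> y) \<le> B"
proof -
  have "compact (\<phi> ` cball 0 R)" by (intro compact_continuous_image smooth_continuous assms) auto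
  then have "bounded (\<phi> ` cball 0 R)" by (rule compact_imp_bounded)
  then obtain B where "\<forall>x\<in>\<phi> ` cball 0 R. norm x \<le> B" unfolding bounded_iff by auto
  then show ?thesis by (intro that[of B]) auto
qed

lemma smooth_scale_measurable: "smooth \<phi> \<Longrightarrow> (\<lambda>y. \<phi> (t *\<^sub>R y)) \<in> borel_measurable borel"
  by (intro borel_measurable_continuous_onI smooth_scale_continuous)

lemma GL_eq_kern:
  fixes \<phi> :: "'a::euclidean_space \<Rightarrow> complex"
  shows "GL b t \<phi> = rGamma b / of_real (pi powr half_dim TYPE('a)) * (LINT y|lborel. \<phi> (t *\<^sub>R y) * kern b y)"
  unfolding GL_def nker_def integral_mult_right_zero[symmetric] by (simp add: mult_ac)

lemma GL_holomorphic:
  fixes \<phi> :: "'a::euclidean_space \<Rightarrow> complex"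
  assumes "smooth \<phi>"
  shows "(\<lambda>b. GL b t \<phi>) holomorphic_on {b. Re b > 0}"
proof -
  obtain B where B: "\<And>y. norm y \<le> \<bar>t\<bar> \<Longrightarrow> norm (\<phi> y) \<le> B" using bounded_on_ball[OF assms] by blast
  have "(\<lambda>b. LINT y|lborel. \<phi> (t *\<^sub>R y) * kern b y) holomorphic_on {b. Re b > 0}"
    by (rule kern_integral_holomorphic[where B = B, OF smooth_scale_measurable[OF assms]])
       (auto intro!: B mult_left_le)
  then show ?thesis unfolding GL_eq_kern by (intro holomorphic_intros) auto
qed

lemma half_plane: "open {b. Re b > r}" "connected {b. Re b > r}" "convex {b. Re b > r}"
  by (simp_all add: open_halfspace_Re_gt convex_halfspace_Re_gt convex_connected)

text \<open>For 0 < Re b <= 1 the kernel is not continuous across the unit sphere, so the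
  integration by parts breaks down; both sides are holomorphic in b, and the identity
  extends.\<close>

lemma GL_recurrence:
  fixes \<phi> :: "'a::euclidean_space \<Rightarrow> complex"
  assumes b: "Re b > 0" and \<phi>: "smooth \<phi>"
  shows "GL b t \<phi> = (b + hc TYPE('a)) * GL (b + 1) t \<phi> + (of_real t)\<^sup>2 / 4 * GL (b + 2) t (lap \<phi>)"
proof (rule analytic_continuation_open[where s = "{b. Re b > 1}" and s' = "{b. Re b > 0}"
    and f = "\<lambda>b. GL b t \<phi>" and g = "\<lambda>b. (b + hc TYPE('a)) * GL (b + 1) t \<phi> + (of_real t)\<^sup>2 / 4 * GL (b + 2) t (lap \<phi>)"])
  have sh: "(\<lambda>b. GL (b + of_nat k) t \<phi>) holomorphic_on {b. Re b > 0}" if "smooth \<phi>" for k and \<phi> :: "'a \<Rightarrow> complex"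
    by (rule holomorphic_on_compose_gen[OF _ GL_holomorphic[OF that], of "\<lambda>b. b + of_nat k", unfolded o_def])
       (auto intro!: holomorphic_intros)
  show "(\<lambda>b. (b + hc TYPE('a)) * GL (b + 1) t \<phi> + (of_real t)\<^sup>2 / 4 * GL (b + 2) t (lap \<phi>)) holomorphic_on {b. Re b > 0}"
    using sh[OF \<phi>, of 1] sh[OF smooth_lap[OF \<phi>], of 2] by (intro holomorphic_intros) auto
  have "2 \<in> {b. Re b > 1}" by simp
  then show "{b. Re b > 1} \<noteq> {}" by blast
  show "GL b t \<phi> = (b + hc TYPE('a)) * GL (b + 1) t \<phi> + (of_real t)\<^sup>2 / 4 * GL (b + 2) t (lap \<phi>)" if "b \<in> {b. Re b > 1}" for b
    using that by (intro GL_recurrence_gt1[OF _ \<phi>]) simp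
qed (use b half_plane GL_holomorphic[OF \<phi>] in auto)

lemma kern_of_real: "kern (of_real x) y = of_real (rker x y)"
proof (cases "norm y < 1")
  case True
  then have "1 - (norm y)\<^sup>2 > 0" by (simp add: power_less_one_iff)
  then show ?thesis using True
    by (simp add: kern_def rker_def pw_def powr_def exp_of_real[symmetric])
qed (simp add: kern_outside rker_def)

lemma GL_norm_le:
  fixes \<phi> :: "'a::euclidean_space \<Rightarrow> complex"
  assumes b: "Re b > 0" and \<phi>: "smooth \<phi>" and B: "\<And>y. norm y \<le> \<bar>t\<bar> \<Longrightarrow> norm (\<phi> y) \<le> B"
  shows "norm (GL b t \<phi>) \<le> norm (rGamma b) * (B * (Gamma (Re b) / Gamma (Re b + half_dim TYPE('a))))"
proof -
  have "norm (LINT y|lborel. \<phi> (t *\<^sub>R y) * kern b y) \<le> B * (LINT y|lborel. rker (Re b) (y::'a))"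
    by (rule kern_integral_norm_le[OF b smooth_scale_measurable[OF \<phi>]]) (auto intro!: B mult_left_le)
  then have "norm (GL b t \<phi>) \<le> norm (rGamma b) / pi powr half_dim TYPE('a) * (B * (LINT y|lborel. rker (Re b) (y::'a)))"
    unfolding GL_eq_kern norm_mult by (intro mult_mono) (auto simp: norm_divide)
  then show ?thesis by (simp add: rker_integrable(2)[OF b])
qed

lemma GL_concentration:
  fixes \<phi> :: "'a::euclidean_space \<Rightarrow> complex"
  assumes \<phi>: "smooth \<phi>" and b0: "b0 > 0"
  shows "(\<lambda>N. Gamma (of_real (b0 + real N) + hc TYPE('a)) * GL (of_real (b0 + real N)) t \<phi>) \<longlonglongrightarrow> \<phi> 0"
proof (rule LIMSEQ_I)
  fix e :: real assume e: "e > 0"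
  define a where "a = half_dim TYPE('a)"
  have a: "a > 0" by (simp add: a_def half_dim_def)
  define f where "f y = \<phi> (t *\<^sub>R y) - \<phi> 0" for y
  have fm[measurable]: "f \<in> borel_measurable borel"
    unfolding f_def by (intro borel_measurable_diff smooth_scale_measurable \<phi>) auto
  obtain B where B: "\<And>y. norm y \<le> \<bar>t\<bar> \<Longrightarrow> norm (\<phi> y) \<le> B" using bounded_on_ball[OF \<phi>] by blast
  have fB: "norm (f y) \<le> 2 * B" if "norm y < 1" for y
  proof -
    have "norm (t *\<^sub>R y) \<le> \<bar>t\<bar>" using that by (auto intro!: mult_left_le)
    then show ?thesis using norm_triangle_ineq4[of "\<phi> (t *\<^sub>R y)" "\<phi> 0"] B[of "t *\<^sub>R y"] B[of 0] by (simp add: f_def)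
  qed
  have "isCont f 0"
    using smooth_scale_continuous[OF \<phi>, of UNIV t] unfolding f_def
    by (intro continuous_intros) (simp add: continuous_on_eq_continuous_at)
  moreover have "f 0 = 0" by (simp add: f_def)
  ultimately obtain \<delta> where \<delta>: "\<delta> > 0" "\<And>y. norm y < \<delta> \<Longrightarrow> norm (f y) < e / 2"
    using e unfolding continuous_at_eps_delta by (metis dist_0_norm dist_commute half_gt_zero norm_minus_cancel diff_0_right dist_norm)
  \<comment> \<open>Away from the origin the bound 2 B for f is absorbed by a multiple of norm y ^
    2. What remains is a second moment, which the masses of \<open>rker b\<close> and
    \<open>rker (b + 1)\<close> evaluate as a / (b + a), and this tends to 0.\<close>
  define M where "M = 2 * B / \<delta>\<^sup>2"
  have B0: "B \<ge> 0" using B[of 0] norm_ge_zero[of "\<phi> 0"] by (simp del: norm_ge_zero)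
  have M: "M \<ge> 0" using B0 by (simp add: M_def)
  have fb: "norm (f y) \<le> e / 2 + M * (norm y)\<^sup>2" if "norm y < 1" for y
  proof (cases "norm y < \<delta>")
    case True
    then show ?thesis using \<delta>(2)[OF True] M by (simp add: add_increasing2)
  next
    case False
    then have "M * \<delta>\<^sup>2 \<le> M * (norm y)\<^sup>2" using \<delta> M by (intro mult_left_mono power_mono) auto
    then show ?thesis using fB[OF that] \<delta> e by (simp add: M_def)
  qed
  obtain N0 :: nat where N0: "real N0 > 2 * M * a / e" using reals_Archimedean2 by blast
  show "\<exists>no. \<forall>n\<ge>no. norm (Gamma (of_real (b0 + real n) + hc TYPE('a)) * GL (of_real (b0 + real n)) t \<phi> - \<phi> 0) < e"
  proof (intro exI allI impI)
    fix n assume n: "n \<ge> N0"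
    define b where "b = b0 + real n"
    have b: "b > 0" using b0 by (simp add: b_def)
    have M1: "M * a / (b + a) < e / 2"
    proof -
      have "2 * M * a < e * real N0" using N0 e by (simp add: field_simps)
      also have "\<dots> \<le> e * (b + a)" using n a b0 e by (intro mult_left_mono) (auto simp: b_def)
      finally show ?thesis using a b by (simp add: field_simps)
    qed
    define W where "W = Gamma (b + a) / (pi powr a * Gamma b)"
    have W: "W > 0" using b a by (simp add: W_def Gamma_real_pos)
    have G: "Gamma b \<noteq> 0" "Gamma (b + a) \<noteq> 0"
      using b a Gamma_real_pos[of b, THEN less_imp_neq, THEN not_sym] Gamma_real_pos[of "b + a", THEN less_imp_neq, THEN not_sym]
      by simp_all
    have m1: "W * (LINT y|lborel. rker b (y::'a)) = 1"
      using G by (simp add: W_def rker_integrable(2)[OF b] a_def[symmetric])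
    have m2: "W * (LINT y|lborel. rker (b + 1) (y::'a)) = b / (b + a)"
    proof -
      have g1: "Gamma (b + 1) = b * Gamma b" by (rule Gamma_plus1) (use b in \<open>auto elim!: nonpos_Ints_cases\<close>)
      have g2: "Gamma (b + a + 1) = (b + a) * Gamma (b + a)" by (rule Gamma_plus1) (use b a in \<open>auto elim!: nonpos_Ints_cases\<close>)
      have "(LINT y|lborel. rker (b + 1) (y::'a)) = pi powr a * Gamma (b + 1) / Gamma (b + a + 1)"
        using rker_integrable(2)[of "b + 1", where 'a = 'a] b by (simp add: a_def add_ac)
      then show ?thesis using b a G
        by (simp add: W_def g1 g2)
    qed
    have i1: "integrable lborel (\<lambda>y::'a. rker b y)" "integrable lborel (\<lambda>y::'a. rker (b + 1) y)"
      using rker_integrable(1)[of b, where 'a = 'a] rker_integrable(1)[of "b + 1", where 'a = 'a] b by auto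
    have i2: "integrable lborel (\<lambda>y::'a. f y * kern (of_real b) y)"
      by (rule kern_integrable[OF _ fm fB]) (use b in auto)
    have i3: "integrable lborel (\<lambda>y::'a. \<phi> (t *\<^sub>R y) * kern (of_real b) y)"
      by (rule kern_integrable[OF _ smooth_scale_measurable[OF \<phi>], where B = B]) (use b in \<open>auto intro!: B mult_left_le\<close>)
    have i4: "integrable lborel (\<lambda>y::'a. \<phi> 0 * kern (of_real b) y)"
      by (rule kern_integrable[where B = "norm (\<phi> 0)"]) (use b in auto)
    have Weq: "Gamma (of_real b + hc TYPE('a)) * (rGamma (of_real b) / of_real (pi powr half_dim TYPE('a))) = of_real W"
      using b a by (simp add: hc_def W_def a_def Gamma_complex_of_real rGamma_inverse_Gamma divide_inverse flip: of_real_add of_real_mult of_real_inverse)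
    have "Gamma (of_real b + hc TYPE('a)) * GL (of_real b) t \<phi> = of_real W * (LINT y|lborel. \<phi> (t *\<^sub>R y) * kern (of_real b) y)"
      unfolding GL_eq_kern mult.assoc[symmetric] Weq ..
    moreover have "\<phi> 0 = of_real W * (LINT y|lborel. \<phi> 0 * kern (of_real b) (y::'a))"
    proof -
      have "of_real W * (LINT y|lborel. \<phi> 0 * kern (of_real b) (y::'a)) = of_real (W * (LINT y|lborel. rker b (y::'a))) * \<phi> 0"
        by (simp add: kern_of_real)
      then show ?thesis by (simp add: m1)
    qed
    ultimately have "Gamma (of_real b + hc TYPE('a)) * GL (of_real b) t \<phi> - \<phi> 0 =
        of_real W * ((LINT y|lborel. \<phi> (t *\<^sub>R y) * kern (of_real b) y) - (LINT y|lborel. \<phi> 0 * kern (of_real b) (y::'a)))"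
      by (simp add: right_diff_distrib)
    also have "(LINT y|lborel. \<phi> (t *\<^sub>R y) * kern (of_real b) y) - (LINT y|lborel. \<phi> 0 * kern (of_real b) (y::'a)) = (LINT y|lborel. f y * kern (of_real b) y)"
      by (subst Bochner_Integration.integral_diff[OF i3 i4, symmetric]) (simp add: f_def left_diff_distrib)
    finally have "norm (Gamma (of_real b + hc TYPE('a)) * GL (of_real b) t \<phi> - \<phi> 0) = W * norm (LINT y|lborel. f y * kern (of_real b) y)"
      using W by (simp add: norm_mult)
    also have "\<dots> \<le> W * (LINT y|lborel. (e / 2 + M) * rker b (y::'a) - M * rker (b + 1) y)"
    proof (intro mult_left_mono Bochner_Integration.integral_norm_bound_integral i2)
      show "integrable lborel (\<lambda>y::'a. (e / 2 + M) * rker b y - M * rker (b + 1) y)"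
        using i1 by (intro Bochner_Integration.integrable_diff integrable_mult_right)
      show "norm (f y * kern (of_real b) y) \<le> (e / 2 + M) * rker b y - M * rker (b + 1) y" for y
      proof (cases "norm y < 1")
        case True
        then have u: "1 - (norm y)\<^sup>2 > 0" by (simp add: power_less_one_iff)
        have rk: "rker (b + 1) y = (1 - (norm y)\<^sup>2) * rker b y"
          using u True by (simp add: rker_def powr_diff)
        have "(e / 2 + M) * rker b y - M * rker (b + 1) y = (e / 2 + M * (norm y)\<^sup>2) * rker b y"
          unfolding rk by (simp add: algebra_simps)
        then show ?thesis using fb[OF True] by (simp add: norm_mult norm_kern mult_right_mono rker_def)
      qed (simp add: rker_def kern_outside)
    qed (use W in auto)
    also have "(LINT y|lborel. (e / 2 + M) * rker b (y::'a) - M * rker (b + 1) y) = (e / 2 + M) * (LINT y|lborel. rker b (y::'a)) - M * (LINT y|lborel. rker (b + 1) (y::'a))"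
      using i1 by (subst Bochner_Integration.integral_diff) auto
    also have "W * \<dots> = (e / 2 + M) * (W * (LINT y|lborel. rker b (y::'a))) - M * (W * (LINT y|lborel. rker (b + 1) (y::'a)))"
      by (simp add: algebra_simps)
    also have "\<dots> = e / 2 + M * a / (b + a)" unfolding m1 m2 using a b by (simp add: field_simps)
    also have "\<dots> < e" using M1 by linarith
    finally show "norm (Gamma (of_real (b0 + real n) + hc TYPE('a)) * GL (of_real (b0 + real n)) t \<phi> - \<phi> 0) < e"
      by (simp add: b_def)
  qed
qed

section \<open>Analytic continuation in the order\<close>

lemma rGamma_bounded_locally:
  fixes c :: complex
  obtains K where "K \<ge> 0" "\<And>x k. x \<in> cball c 1 \<Longrightarrow> norm (rGamma (x + of_nat k)) \<le> K"
proof -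
  \<comment> \<open>The 2 leaves room for the radius 1 of the disc: shifted by n, all its points
    have real part at least 1, and from there 1/\<Gamma> does not grow under further shifts.\<close>
  obtain n :: nat where n: "real n \<ge> 2 - Re c" using real_arch_simple by blast
  have "\<exists>B. \<forall>x\<in>cball c 1. norm (rGamma (x + of_nat k)) \<le> B" for k
  proof -
    have "continuous_on (cball c 1) (\<lambda>x. rGamma (x + of_nat k))"
      by (intro holomorphic_on_imp_continuous_on holomorphic_intros)
    then have "bounded ((\<lambda>x. rGamma (x + of_nat k)) ` cball c 1)"
      by (intro compact_imp_bounded compact_continuous_image) auto
    then show ?thesis unfolding bounded_iff by auto
  qed
  then obtain B where B: "\<And>k x. x \<in> cball c 1 \<Longrightarrow> norm (rGamma (x + of_nat k)) \<le> B k" by metis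
  have B0: "B k \<ge> 0" for k by (rule order_trans[OF norm_ge_zero B[of c k]]) simp
  define K where "K = (\<Sum>k\<le>n. B k)"
  have BK: "B k \<le> K" if "k \<le> n" for k
    unfolding K_def by (rule member_le_sum) (use that B0 in auto)
  show ?thesis
  proof (rule that[of K])
    show "K \<ge> 0" using B0 by (simp add: K_def sum_nonneg)
    fix x k assume x: "x \<in> cball c 1"
    show "norm (rGamma (x + of_nat k)) \<le> K"
    proof (cases "k \<le> n")
      case True
      then show ?thesis using B[OF x, of k] BK by force
    next
      case False
      have "Re (c - x) \<le> 1" using x complex_Re_le_cmod[of "c - x"] by (simp add: dist_norm)
      then have r: "Re (x + of_nat n) \<ge> 1" using n by simp
      have "norm (rGamma (x + of_nat n + of_nat (k - n))) \<le> norm (rGamma (x + of_nat n)) / 1 ^ (k - n)"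
        by (rule norm_rGamma_le[OF r]) simp
      moreover have "x + of_nat n + of_nat (k - n) = x + of_nat k" using False by (simp add: of_nat_diff)
      ultimately show ?thesis using B[OF x, of n] BK[of n] by simp
    qed
  qed
qed

lemma bcf_holomorphic_order: "(\<lambda>c. bcf c u) holomorphic_on UNIV"
proof (rule holomorphic_uniform_sequence[where f = "\<lambda>n c. \<Sum>k<n. rGamma (c + of_nat k) / fact k * u ^ k"])
  show "(\<lambda>c. \<Sum>k<n. rGamma (c + of_nat k) / fact k * u ^ k) holomorphic_on UNIV" for n
    by (intro holomorphic_intros) auto
  fix c :: complex
  obtain K where K: "K \<ge> 0" "\<And>x k. x \<in> cball c 1 \<Longrightarrow> norm (rGamma (x + of_nat k)) \<le> K"
    using rGamma_bounded_locally by blast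
  have "uniform_limit (cball c 1) (\<lambda>n c. \<Sum>k<n. rGamma (c + of_nat k) / fact k * u ^ k) (\<lambda>c. bcf c u) sequentially"
    unfolding bcf_def
  proof (rule Weierstrass_m_test)
    show "summable (\<lambda>k. K * (norm u ^ k /\<^sub>R fact k))" by (intro summable_mult summable_exp_generic)
    fix k x assume "x \<in> cball c 1"
    then have "norm (rGamma (x + of_nat k)) * (norm u ^ k / fact k) \<le> K * (norm u ^ k / fact k)"
      by (intro mult_right_mono K) auto
    then show "norm (rGamma (x + of_nat k) / fact k * u ^ k) \<le> K * (norm u ^ k /\<^sub>R fact k)"
      by (simp add: norm_mult norm_divide norm_power divide_simps mult_ac)
  qed
  then show "\<exists>d>0. cball c d \<subseteq> UNIV \<and> uniform_limit (cball c d) (\<lambda>n c. \<Sum>k<n. rGamma (c + of_nat k) / fact k * u ^ k) (\<lambda>c. bcf c u) sequentially"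
    by (intro exI[of _ 1]) auto
qed auto

text \<open>Reading \<open>GL_recurrence\<close> as a definition of its left side continues \<open>GL\<close> analytically in \<open>b\<close>, and
  \<open>GG N\<close> does so up to \<open>Re b > - N\<close>.\<close>

primrec GG :: "nat \<Rightarrow> complex \<Rightarrow> real \<Rightarrow> ('a::euclidean_space \<Rightarrow> complex) \<Rightarrow> complex" where
  "GG 0 b t \<phi> = GL b t \<phi>"
| "GG (Suc N) b t \<phi> = (b + hc TYPE('a)) * GG N (b + 1) t \<phi> + (of_real t)\<^sup>2 / 4 * GG N (b + 2) t (lap \<phi>)"

lemma GG_agree_Suc: "Re b > - real N \<Longrightarrow> smooth \<phi> \<Longrightarrow> GG (Suc N) b t \<phi> = GG N b t \<phi>"
proof (induction N arbitrary: b \<phi>)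
  case 0
  then show ?case using GL_recurrence[of b \<phi> t] by simp
next
  case (Suc N)
  have "GG (Suc (Suc N)) b t \<phi> = (b + hc TYPE('a)) * GG (Suc N) (b + 1) t \<phi> + (of_real t)\<^sup>2 / 4 * GG (Suc N) (b + 2) t (lap \<phi>)"
    by (rule GG.simps(2))
  also have "GG (Suc N) (b + 1) t \<phi> = GG N (b + 1) t \<phi>" by (rule Suc.IH) (use Suc.prems in auto)
  also have "GG (Suc N) (b + 2) t (lap \<phi>) = GG N (b + 2) t (lap \<phi>)" by (rule Suc.IH) (use Suc.prems smooth_lap in auto)
  finally show ?case by (simp only: GG.simps(2))
qed

lemma GG_agree:
  assumes "smooth \<phi>" "N \<le> M" "Re b > - real N"
  shows "GG M b t \<phi> = GG N b t \<phi>"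
  using assms(2)
proof (induction M rule: dec_induct)
  case (step M)
  have "GG (Suc M) b t \<phi> = GG M b t \<phi>" by (rule GG_agree_Suc) (use assms step in auto)
  then show ?case using step by simp
qed simp

lemma GG_holomorphic: "smooth \<phi> \<Longrightarrow> (\<lambda>b. GG N b t \<phi>) holomorphic_on {b. Re b > - real N}"
proof (induction N arbitrary: \<phi>)
  case 0
  then show ?case using GL_holomorphic by simp
next
  case (Suc N)
  have sh: "(\<lambda>b. GG N (b + of_nat (Suc k)) t \<phi>) holomorphic_on {b. Re b > - real (Suc N)}" if "smooth \<phi>" for k and \<phi> :: "'a \<Rightarrow> complex"
    by (rule holomorphic_on_compose_gen[OF _ Suc.IH[OF that], of "\<lambda>b. b + of_nat (Suc k)", unfolded o_def])
       (auto intro!: holomorphic_intros)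
  show ?case using sh[OF Suc.prems, of 0] sh[OF smooth_lap[OF Suc.prems], of 1]
    by (auto intro!: holomorphic_intros)
qed

text \<open>The entire continuation in b of the mean divided by \<Gamma>(b + n/2). Every index N
  with N > - Re b gives the same value on smooth functions, by \<open>GG_agree\<close>; the ceiling
  is one explicit choice.\<close>

definition Gd :: "complex \<Rightarrow> real \<Rightarrow> ('a::euclidean_space \<Rightarrow> complex) \<Rightarrow> complex" where
  "Gd b t \<phi> = GG (nat \<lceil>1 - Re b\<rceil>) b t \<phi>"

lemma Gd_eq_GG:
  assumes "smooth \<phi>" "Re b > - real N"
  shows "Gd b t \<phi> = GG N b t \<phi>"
proof -
  let ?M = "nat \<lceil>1 - Re b\<rceil>"
  have M: "Re b > - real ?M" by linarith
  show ?thesis unfolding Gd_def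
    using GG_agree[OF assms(1), of ?M N b t] GG_agree[OF assms(1), of N ?M b t] M assms(2)
    by (cases "?M \<le> N") auto
qed

lemma Gd_eq_GL: "smooth \<phi> \<Longrightarrow> Re b > 0 \<Longrightarrow> Gd b t \<phi> = GL b t \<phi>"
  using Gd_eq_GG[of \<phi> 0 b t] by simp

lemma Gd_holomorphic:
  assumes "smooth \<phi>"
  shows "(\<lambda>b. Gd b t \<phi>) holomorphic_on A"
proof -
  have "(\<lambda>b. Gd b t \<phi>) field_differentiable at b" for b
  proof -
    obtain N :: nat where N: "real N > - Re b" using reals_Archimedean2 by blast
    have "(\<lambda>b. GG N b t \<phi>) field_differentiable at b"
      using GG_holomorphic[OF assms, of N t] N half_plane(1)[of "- real N"]
      by (intro holomorphic_on_imp_differentiable_at) auto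
    moreover have "\<forall>\<^sub>F b in nhds b. Gd b t \<phi> = GG N b t \<phi>"
      using eventually_nhds_in_open[OF half_plane(1)[of "- real N"], of b] N
      by (auto elim!: eventually_mono intro!: Gd_eq_GG assms)
    ultimately show ?thesis
      unfolding field_differentiable_def by (auto cong: DERIV_cong_ev)
  qed
  then show ?thesis by (auto simp: holomorphic_on_def field_differentiable_at_within)
qed

lemma Gd_rec:
  fixes \<phi> :: "'a::euclidean_space \<Rightarrow> complex"
  assumes "smooth \<phi>"
  shows "Gd b t \<phi> = (b + hc TYPE('a)) * Gd (b + 1) t \<phi> + (of_real t)\<^sup>2 / 4 * Gd (b + 2) t (lap \<phi>)"
proof -
  obtain N :: nat where N: "real N > - Re b" using reals_Archimedean2 by blast
  have "Gd b t \<phi> = GG (Suc N) b t \<phi>" by (rule Gd_eq_GG[OF assms]) (use N in simp)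
  moreover have "Gd (b + 1) t \<phi> = GG N (b + 1) t \<phi>" by (rule Gd_eq_GG[OF assms]) (use N in simp)
  moreover have "Gd (b + 2) t (lap \<phi>) = GG N (b + 2) t (lap \<phi>)" by (rule Gd_eq_GG[OF smooth_lap[OF assms]]) (use N in simp)
  ultimately show ?thesis by simp
qed

text \<open>The base form of \<open>nice\<close> integrates over a box with an additional real
  coordinate because \<open>EI\<close> has a radial variable. Here that coordinate runs idle through
  [0,1] and contributes a factor 1.\<close>

lemma nice_GL:
  assumes "Re b > 1"
  shows "nice (GL b t :: ('a::euclidean_space \<Rightarrow> complex) \<Rightarrow> complex)"
proof (rule nice_ext[OF nice_base])
  let ?k = "\<lambda>z::real \<times> 'a. nker b (snd z)" and ?X = "\<lambda>z::real \<times> 'a. t *\<^sub>R snd z"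
  show k: "continuous_on (cbox (0, - One) (1, One)) ?k"
    by (rule continuous_on_compose2[OF continuous_on_nker[OF assms, of UNIV]]) (auto intro!: continuous_intros)
  show X: "continuous_on (cbox (0, - One) (1, One)) ?X" by (intro continuous_intros)
  fix \<phi> :: "'a \<Rightarrow> complex" assume \<phi>: "smooth \<phi>"
  have "continuous_on (cbox (0, - One) (1, One)) (\<lambda>z. ?k z * \<phi> (?X z))"
    by (intro continuous_on_mult k smooth_compose_continuous[OF \<phi> X])
  from integral_prod_continuous[OF this]
  show "GL b t \<phi> = integral (cbox (0, - One) (1, One)) (\<lambda>z. ?k z * \<phi> (?X z))"
    by (simp add: GL_eq_cbox[OF assms \<phi>] mult.commute)
qed

lemma nice_GG: "Re b > 1 - real N \<Longrightarrow> nice (GG N b t :: ('a::euclidean_space \<Rightarrow> complex) \<Rightarrow> complex)"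
proof (induction N arbitrary: b)
  case 0
  have "nice (GL b t)" by (rule nice_GL) (use 0 in simp)
  then show ?case by (rule nice_ext) simp
next
  case (Suc N)
  have n1: "nice (GG N (b + 1) t :: ('a \<Rightarrow> complex) \<Rightarrow> complex)" by (rule Suc.IH) (use Suc.prems in simp)
  have n2: "nice (GG N (b + 2) t :: ('a \<Rightarrow> complex) \<Rightarrow> complex)" by (rule Suc.IH) (use Suc.prems in simp)
  show ?case
    by (rule nice_ext[OF nice_sum[OF nice_scale[OF n1, of "b + hc TYPE('a)"] nice_scale[OF nice_lap[OF n2], of "(of_real t)\<^sup>2 / 4"]]]) simp
qed

lemma nice_Gd: "nice (Gd b t)"
proof -
  obtain N :: nat where N: "real N > 1 - Re b" using reals_Archimedean2 by blast
  have r: "Re b > 1 - real N" "Re b > - real N" using N by auto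
  show ?thesis by (rule nice_ext[OF nice_GG[OF r(1)]]) (rule Gd_eq_GG[OF _ r(2)])
qed

text \<open>Uniqueness for a recurrence with data at infinity. For \<open>M k\<close>, the larger of
  two neighbours, one step costs at most the factor 1 + C / ((k+1)(k+2)) <= exp (C/(k+1) - C/(k+2)).
  The exponents telescope, so \<open>X\<close> increases; as its limit is 0, it is never
  positive.\<close>

lemma decaying_sequence_zero:
  fixes e :: "nat \<Rightarrow> complex"
  assumes lim: "e \<longlonglongrightarrow> 0" and C: "C \<ge> 0"
    and le: "\<And>k. norm (e k) \<le> norm (e (Suc k)) + C / (real (k + 1) * real (k + 2)) * norm (e (Suc (Suc k)))"
  shows "e k = 0"
proof -
  define M where "M k = max (norm (e k)) (norm (e (Suc k)))" for k
  define X where "X k = M k * exp (- (C / real (k + 1)))" for k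
  have M0: "M k \<ge> 0" for k by (simp add: M_def max.coboundedI1)
  have "M k \<le> M (Suc k) * exp (C / real (k + 1) - C / real (k + 2))" for k
  proof -
    have q: "C / (real (k + 1) * real (k + 2)) = C / real (k + 1) - C / real (k + 2)" by (simp add: field_simps)
    have q0: "C / (real (k + 1) * real (k + 2)) \<ge> 0" using C by simp
    have "norm (e k) \<le> M (Suc k) + C / (real (k + 1) * real (k + 2)) * M (Suc k)"
      using le[of k] mult_left_mono[OF _ q0, of "norm (e (Suc (Suc k)))" "M (Suc k)"] by (simp add: M_def)
    moreover have "norm (e (Suc k)) \<le> M (Suc k) + C / (real (k + 1) * real (k + 2)) * M (Suc k)"
      using mult_nonneg_nonneg[OF q0 M0[of "Suc k"]] by (simp add: M_def)
    ultimately have "M k \<le> M (Suc k) * (1 + C / (real (k + 1) * real (k + 2)))"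
      unfolding M_def[of k] by (simp add: algebra_simps)
    also have "\<dots> \<le> M (Suc k) * exp (C / (real (k + 1) * real (k + 2)))"
      by (intro mult_left_mono exp_ge_add_one_self M0)
    finally show ?thesis unfolding q .
  qed
  then have "M k * exp (- (C / real (k + 1))) \<le> M (Suc k) * exp (C / real (k + 1) - C / real (k + 2)) * exp (- (C / real (k + 1)))" for k
    by (intro mult_right_mono) auto
  moreover have "exp (C / real (k + 1) - C / real (k + 2)) * exp (- (C / real (k + 1))) = exp (- (C / real (Suc k + 1)))" for k
    unfolding exp_add[symmetric] by simp
  ultimately have "X k \<le> X (Suc k)" for k
    unfolding X_def by (simp only: mult.assoc)
  then have inc: "incseq X" by (simp add: incseq_SucI)
  have "M \<longlonglongrightarrow> max 0 0"
    unfolding M_def using LIMSEQ_Suc[OF lim] lim by (intro tendsto_max) (auto intro: tendsto_norm_zero)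
  moreover have "(\<lambda>k. exp (- (C / real (k + 1)))) \<longlonglongrightarrow> exp (- 0)"
    by (intro tendsto_intros real_tendsto_divide_at_top[OF tendsto_const])
       (use filterlim_compose[OF filterlim_real_sequentially filterlim_Suc] in simp)
  ultimately have "X \<longlonglongrightarrow> max 0 0 * exp (- 0)" unfolding X_def by (rule tendsto_mult)
  then have "X k \<le> 0" using incseq_le[OF inc, of 0 k] by simp
  then have "M k \<le> 0" by (simp add: X_def mult_le_0_iff)
  then show ?thesis by (simp add: M_def max_def split: if_splits)
qed

text \<open>Both sides satisfy the same recurrence in \<open>b\<close>, and after multiplication by \<open>\<Gamma>\<close> both tend to \<open>F 0\<close>
  as \<open>b\<close> grows, since the kernels concentrate at the origin.\<close>

lemma GL_eigenfunction_real:
  fixes F :: "'a::euclidean_space \<Rightarrow> complex"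
  assumes F: "smooth F" "lap F = (\<lambda>x. - (l\<^sup>2) * F x)" and b: "b \<ge> 1"
  shows "GL (of_real b) t F = bj (of_real b + hc TYPE('a)) (l * of_real t) * F 0"
proof -
  define c where "c = of_real b + hc TYPE('a)"
  define a where "a = half_dim TYPE('a)"
  have a: "a > 0" by (simp add: a_def half_dim_def)
  have cab: "c = of_real (b + a)" by (simp add: c_def hc_def a_def)
  define w where "w = (l * of_real t)\<^sup>2 / 4"
  define d where "d k = GL (of_real b + of_nat k) t F - bj (c + of_nat k) (l * of_real t) * F 0" for k
  have rec: "d k = (c + of_nat k) * d (Suc k) - w * d (Suc (Suc k))" for k
  proof -
    let ?b = "of_real b + of_nat k :: complex"
    have lin: "GL (?b + 2) t (lap F) = - (l\<^sup>2) * GL (?b + 2) t F"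
    proof -
      have "GL (?b + 2) t (lap F) = (LINT y|lborel. - (l\<^sup>2) * (F (t *\<^sub>R y) * nker (?b + 2) y))"
        unfolding GL_def F(2) by (simp add: mult.assoc)
      also have "\<dots> = - (l\<^sup>2) * GL (?b + 2) t F" unfolding GL_def by (rule integral_mult_right_zero)
      finally show ?thesis .
    qed
    have "GL ?b t F = (?b + hc TYPE('a)) * GL (?b + 1) t F + (of_real t)\<^sup>2 / 4 * GL (?b + 2) t (lap F)"
      by (rule GL_recurrence) (use b F in auto)
    then have 1: "GL ?b t F = (c + of_nat k) * GL (of_real b + of_nat (Suc k)) t F - w * GL (of_real b + of_nat (Suc (Suc k))) t F"
      unfolding lin by (simp add: c_def w_def add_ac power_mult_distrib)
    have 2: "bj (c + of_nat k) (l * of_real t) = (c + of_nat k) * bj (c + of_nat (Suc k)) (l * of_real t) - w * bj (c + of_nat (Suc (Suc k))) (l * of_real t)"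
      using bj_rec[of "c + of_nat k" "l * of_real t"] by (simp add: w_def add_ac)
    show ?thesis unfolding d_def 1 2 by (simp add: algebra_simps)
  qed
  \<comment> \<open>Multiplying by \<Gamma>(c + k) turns the growing coefficient c + k into 1 and
    the other one into w / ((c+k)(c+k+1)), the form required by
    \<open>decaying_sequence_zero\<close>. For b >= 1 the two factors have modulus at least k + 1
    and k + 2.\<close>
  define e where "e k = Gamma (c + of_nat k) * d k" for k
  have lim: "e \<longlonglongrightarrow> 0"
  proof -
    have "(\<lambda>k. Gamma (of_real (b + real k) + hc TYPE('a)) * GL (of_real (b + real k)) t F) \<longlonglongrightarrow> F 0"
      by (rule GL_concentration) (use F b in auto)
    moreover have "(\<lambda>k. Gamma (c + of_nat k) * bcf (c + of_nat k) (- ((l * of_real t)\<^sup>2) / 4) * F 0) \<longlonglongrightarrow> 1 * F 0"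
      by (intro tendsto_mult Gamma_bcf_tendsto_1 tendsto_const)
    ultimately have "(\<lambda>k. Gamma (of_real (b + real k) + hc TYPE('a)) * GL (of_real (b + real k)) t F -
        Gamma (c + of_nat k) * bcf (c + of_nat k) (- ((l * of_real t)\<^sup>2) / 4) * F 0) \<longlonglongrightarrow> F 0 - 1 * F 0"
      by (rule tendsto_diff)
    moreover have "(\<lambda>k. Gamma (of_real (b + real k) + hc TYPE('a)) * GL (of_real (b + real k)) t F -
        Gamma (c + of_nat k) * bcf (c + of_nat k) (- ((l * of_real t)\<^sup>2) / 4) * F 0) = e"
      by (rule ext) (simp add: e_def d_def c_def bj_def add_ac right_diff_distrib mult.assoc)
    moreover have "F 0 - 1 * F 0 = 0" by simp
    ultimately show ?thesis by (simp only:)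
  qed
  have cn: "c + of_nat k \<notin> \<int>\<^sub>\<le>\<^sub>0" "c + of_nat k \<noteq> 0" for k
  proof -
    have "Re (c + of_nat k) > 0" using a b by (simp add: cab add_pos_nonneg)
    then show "c + of_nat k \<notin> \<int>\<^sub>\<le>\<^sub>0" "c + of_nat k \<noteq> 0"
      by (auto elim!: nonpos_Ints_cases simp: complex_eq_iff)
  qed
  have Gs: "Gamma (c + of_nat (Suc k)) = (c + of_nat k) * Gamma (c + of_nat k)" for k
    using Gamma_plus1[OF cn(1), of k] by (simp add: add_ac)
  have erec: "e k = e (Suc k) - w / ((c + of_nat k) * (c + of_nat (Suc k))) * e (Suc (Suc k))" for k
  proof -
    have "w / ((c + of_nat k) * (c + of_nat (Suc k))) * e (Suc (Suc k)) = w * Gamma (c + of_nat k) * d (Suc (Suc k))"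
      unfolding e_def Gs using cn(2)[of k] cn(2)[of "Suc k"] by (simp del: of_nat_Suc)
    then show ?thesis unfolding e_def Gs[of k] by (subst rec) (simp add: algebra_simps)
  qed
  have "norm (e k) \<le> norm (e (Suc k)) + norm w / (real (k + 1) * real (k + 2)) * norm (e (Suc (Suc k)))" for k
  proof -
    have n1: "norm (c + of_nat k) \<ge> real (k + 1)" "norm (c + of_nat (Suc k)) \<ge> real (k + 2)"
      using complex_Re_le_cmod[of "c + of_nat k"] complex_Re_le_cmod[of "c + of_nat (Suc k)"] a b by (auto simp: cab)
    have "norm (e k) \<le> norm (e (Suc k)) + norm (w / ((c + of_nat k) * (c + of_nat (Suc k))) * e (Suc (Suc k)))"
      by (subst erec) (rule norm_triangle_ineq4)
    also have "norm (w / ((c + of_nat k) * (c + of_nat (Suc k))) * e (Suc (Suc k))) =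
      norm w / (norm (c + of_nat k) * norm (c + of_nat (Suc k))) * norm (e (Suc (Suc k)))"
      by (simp add: norm_mult norm_divide)
    also have "\<dots> \<le> norm w / (real (k + 1) * real (k + 2)) * norm (e (Suc (Suc k)))"
      using n1 by (intro mult_right_mono divide_left_mono mult_mono mult_pos_pos) (auto intro: less_le_trans[of 0 "real (k+1)"] less_le_trans[of 0 "real (k+2)"])
    finally show ?thesis by simp
  qed
  from decaying_sequence_zero[OF lim norm_ge_zero this, of 0]
  have "e 0 = 0" .
  then have "d 0 = 0" using cn(1)[of 0] by (simp add: e_def Gamma_eq_zero_iff)
  then show ?thesis by (simp add: d_def c_def)
qed

text \<open>Both sides are entire in the order and agree for real orders at least 1, a set that
  accumulates at 2.\<close>

theorem Gd_eigenfunction: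
  fixes F :: "'a::euclidean_space \<Rightarrow> complex"
  assumes F: "smooth F" "lap F = (\<lambda>x. - (l\<^sup>2) * F x)"
  shows "Gd b t F = bj (b + hc TYPE('a)) (l * of_real t) * F 0"
proof -
  let ?d = "\<lambda>b. Gd b t F - bj (b + hc TYPE('a)) (l * of_real t) * F 0"
  have hol: "?d holomorphic_on UNIV"
  proof -
    have "(\<lambda>b. bcf (b + hc TYPE('a)) u) holomorphic_on UNIV" for u
      by (rule holomorphic_on_compose_gen[OF _ bcf_holomorphic_order, of "\<lambda>b. b + hc TYPE('a)", unfolded o_def])
         (auto intro!: holomorphic_intros)
    then show ?thesis unfolding bj_def by (intro holomorphic_intros Gd_holomorphic F)
  qed
  have lp: "(2::complex) islimpt (of_real ` {1..})"
    unfolding islimpt_approachable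
  proof (intro allI impI)
    fix e :: real assume "e > 0"
    then have d: "dist (complex_of_real (2 + e / 2)) 2 = e / 2" by (simp add: dist_norm norm_divide)
    then have "complex_of_real (2 + e / 2) \<noteq> 2" using \<open>e > 0\<close> by fastforce
    moreover have "complex_of_real (2 + e / 2) \<in> complex_of_real ` {1..}" using \<open>e > 0\<close> by (intro imageI) simp
    ultimately show "\<exists>x'\<in>complex_of_real ` {1..}. x' \<noteq> 2 \<and> dist x' 2 < e"
      using d \<open>e > 0\<close> by (intro bexI[of _ "complex_of_real (2 + e / 2)"]) simp_all
  qed
  have "?d b = 0"
  proof (rule analytic_continuation[OF hol open_UNIV connected_UNIV _ UNIV_I lp])
    fix z :: complex assume "z \<in> of_real ` {1..}"
    then obtain x where x: "z = of_real x" "x \<ge> 1" by auto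
    then show "?d z = 0" using GL_eigenfunction_real[OF F x(2), of t] Gd_eq_GL[OF F(1), of z t] by simp
  qed auto
  then show ?thesis by simp
qed

lemma Gd_wave: "u \<in> Basis \<Longrightarrow> Gd b t (wave l (u::'a::euclidean_space)) = bj (b + hc TYPE('a)) (l * of_real t)"
  using Gd_eigenfunction[OF smooth_wave lap_wave[of u l], of b t] by (simp add: wave_def)

section \<open>Growth of Bessel functions in strips and on the imaginary axis\<close>

text \<open>In dimension one this is Poisson's integral for the Bessel function.\<close>

lemma bj_poisson:
  assumes "Re c > 1/2"
  shows "bj c z = GL (c - 1/2) 1 (wave z (1::real))"
proof -
  have h: "c - 1/2 + hc TYPE(real) = c" by (simp add: hc_def half_dim_def)
  show ?thesis using Gd_wave[of "1::real" "c - 1/2" 1 z, unfolded h] Gd_eq_GL[OF smooth_wave, of "c - 1/2" 1 z "1::real"] assms by simp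
qed

text \<open>For Re c > 1/2 Poisson's integral is bounded on the strip, the exponential in it having
  modulus at most exp Y. The steps of the recurrence towards lower orders only multiply by c and by
  z^2 / 4, so the growth stays polynomial.\<close>

lemma bj_strip_bound:
  assumes Y: "Y \<ge> 0"
  shows "\<exists>C A. C > 0 \<and> (\<forall>z. \<bar>Im z\<bar> \<le> Y \<longrightarrow> norm (bj c z) \<le> C * (1 + norm z) ^ A)"
proof -
  have large: "\<exists>C. C > 0 \<and> (\<forall>z. \<bar>Im z\<bar> \<le> Y \<longrightarrow> norm (bj c z) \<le> C)" if "Re c > 1/2" for c
  proof -
    let ?b = "c - 1/2"
    let ?K = "norm (rGamma ?b) * (exp Y * (Gamma (Re ?b) / Gamma (Re ?b + half_dim TYPE(real))))"
    have "norm (bj c z) \<le> ?K" if z: "\<bar>Im z\<bar> \<le> Y" for z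
      unfolding bj_poisson[OF \<open>Re c > 1/2\<close>]
      by (rule GL_norm_le) (use \<open>Re c > 1/2\<close> norm_wave_le[OF z, where R = 1 and u = "1::real"] in auto)
    then show ?thesis by (intro exI[of _ "max 1 ?K"]) (auto simp: le_max_iff_disj)
  qed
  have "\<exists>C A. C > 0 \<and> (\<forall>z. \<bar>Im z\<bar> \<le> Y \<longrightarrow> norm (bj c z) \<le> C * (1 + norm z) ^ A)" if "Re c > 1/2 - real N" for N c
    using that
  proof (induction N arbitrary: c)
    case 0
    then obtain C where "C > 0" "\<forall>z. \<bar>Im z\<bar> \<le> Y \<longrightarrow> norm (bj c z) \<le> C" using large[of c] by auto
    then show ?case by (intro exI[of _ C] exI[of _ 0]) auto
  next
    case (Suc N)
    obtain C1 A1 where 1: "C1 > 0" "\<And>z. \<bar>Im z\<bar> \<le> Y \<Longrightarrow> norm (bj (c + 1) z) \<le> C1 * (1 + norm z) ^ A1"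
      using Suc.IH[of "c + 1"] Suc.prems by auto
    obtain C2 A2 where 2: "C2 > 0" "\<And>z. \<bar>Im z\<bar> \<le> Y \<Longrightarrow> norm (bj (c + 2) z) \<le> C2 * (1 + norm z) ^ A2"
      using Suc.IH[of "c + 2"] Suc.prems by auto
    have "norm (bj c z) \<le> (norm c * C1 + C2) * (1 + norm z) ^ (A1 + A2 + 2)" if z: "\<bar>Im z\<bar> \<le> Y" for z
    proof -
      have p1: "(1 + norm z) ^ A1 \<le> (1 + norm z) ^ (A1 + A2 + 2)" by (intro power_increasing) auto
      have p2: "(1 + norm z) ^ (A2 + 2) \<le> (1 + norm z) ^ (A1 + A2 + 2)" by (intro power_increasing) auto
      have "norm (bj c z) \<le> norm (c * bj (c + 1) z) + norm (z\<^sup>2 / 4 * bj (c + 2) z)"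
        unfolding bj_rec[of c z] by (rule norm_triangle_ineq4)
      also have "\<dots> = norm c * norm (bj (c + 1) z) + (norm z)\<^sup>2 / 4 * norm (bj (c + 2) z)"
        by (simp add: norm_mult norm_power norm_divide)
      also have "\<dots> \<le> norm c * (C1 * (1 + norm z) ^ A1) + (1 + norm z)\<^sup>2 * (C2 * (1 + norm z) ^ A2)"
      proof (intro add_mono mult_mono 1 2 z mult_left_mono)
        have "(norm z)\<^sup>2 \<le> (1 + norm z)\<^sup>2" by (intro power_mono) auto
        then show "(norm z)\<^sup>2 / 4 \<le> (1 + norm z)\<^sup>2" using zero_le_power2[of "norm z"] by linarith
      qed auto
      also have "\<dots> = norm c * C1 * (1 + norm z) ^ A1 + C2 * (1 + norm z) ^ (A2 + 2)"
        by (simp add: power_add power2_eq_square mult_ac)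
      also have "\<dots> \<le> norm c * C1 * (1 + norm z) ^ (A1 + A2 + 2) + C2 * (1 + norm z) ^ (A1 + A2 + 2)"
        using 1 2 by (intro add_mono mult_left_mono p1 p2) auto
      finally show ?thesis by (simp add: algebra_simps)
    qed
    moreover have "norm c * C1 + C2 > 0" using 1 2 by (simp add: add_nonneg_pos)
    ultimately show ?case by blast
  qed
  moreover obtain N :: nat where "real N > 1/2 - Re c" using reals_Archimedean2 by blast
  ultimately show ?thesis by (metis less_diff_eq diff_less_eq add.commute)
qed

lemma pw_mult: "x > 0 \<or> y > 0 \<Longrightarrow> pw (x * y) b = pw x b * pw y b"
  by (cases "x > 0"; cases "y > 0")
     (auto simp: pw_def mult_le_0_iff ln_mult distrib_left exp_add)

text \<open>Laplace's method at the endpoint of Poisson's integral.\<close>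

lemma bj_imaginary_asymptotics:
  assumes c: "Re c > 3/2"
  defines "b \<equiv> c - 1/2"
  shows "((\<lambda>\<eta>. of_real (exp (- \<eta>)) * pw \<eta> b * bj c (\<i> * of_real \<eta>)) \<longlongrightarrow>
    of_real (1 / sqrt pi) * pw 2 (b - 1)) at_top"
proof -
  have b: "Re b > 1" using c by (simp add: b_def)
  \<comment> \<open>At i \<eta> the exponential in Poisson's integral is largest at the endpoint y =
    -1. With y = -1 + u / \<eta> one has 1 - y^2 = (u / \<eta>) (2 - u / \<eta>); \<open>s\<close>
    is the integrand freed of its powers of \<eta> and of exp \<eta>, and \<open>f\<close> is its
    limit.\<close>
  define s where "s \<eta> u = of_real (exp (- u)) * pw u (b - 1) * pw (2 - u / \<eta>) (b - 1)" for \<eta> u :: real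
  define f where "f u = of_real (exp (- u)) * pw u (b - 1) * pw 2 (b - 1)" for u :: real
  \<comment> \<open>The majorant bounds the last power by its value at u = 0, which is possible
    because its exponent has positive real part; this uses Re c > 3/2.\<close>
  define w where "w u = (if u \<le> 0 then 0 else exp (- u) * u powr (Re b - 1)) * 2 powr (Re b - 1)" for u :: real
  have [measurable]: "(\<lambda>u. pw (g u) b') \<in> borel_measurable borel" if "g \<in> borel_measurable borel" for g :: "real \<Rightarrow> real" and b'
    using measurable_compose[OF that measurable_pw] .
  have sm: "s \<eta> \<in> borel_measurable lborel" for \<eta> unfolding s_def by measurable
  have fm: "f \<in> borel_measurable lborel" unfolding f_def by measurable
  have gam: "set_integrable lebesgue {0<..} (\<lambda>t. complex_of_real t powr (b - 1) / of_real (exp t))"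
    using absolutely_integrable_Gamma_integral'[of b] b by simp
  have geq: "indicator {0<..} t *\<^sub>R (complex_of_real t powr (b - 1) / of_real (exp t)) = of_real (exp (- t)) * pw t (b - 1)" for t :: real
  proof (cases "t > 0")
    case False
    then show ?thesis by (simp add: pw_def)
  qed (simp add: pw_eq_powr exp_minus divide_inverse exp_of_real)
  have gint: "integrable lborel (\<lambda>t. of_real (exp (- t)) * pw t (b - 1))"
    using gam unfolding set_integrable_def geq by (subst (asm) integrable_completion) (auto simp: fm)
  have gval: "(LINT t|lborel. of_real (exp (- t)) * pw t (b - 1)) = Gamma b"
  proof -
    have "(LINT t|lborel. of_real (exp (- t)) * pw t (b - 1)) = integral UNIV (\<lambda>t. of_real (exp (- t)) * pw t (b - 1))"
      by (rule integral_lborel[OF gint, symmetric])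
    also have "\<dots> = integral UNIV (\<lambda>t. if t \<in> {0<..} then complex_of_real t powr (b - 1) / of_real (exp t) else 0)"
    proof (intro arg_cong[where f = "integral UNIV"] ext)
      show "of_real (exp (- t)) * pw t (b - 1) = (if t \<in> {0<..} then complex_of_real t powr (b - 1) / of_real (exp t) else 0)" for t :: real
        unfolding geq[of t, symmetric] by simp
    qed
    also have "\<dots> = integral {0<..} (\<lambda>t. complex_of_real t powr (b - 1) / of_real (exp t))"
      by (rule integral_restrict_UNIV)
    also have "\<dots> = Gamma b" by (rule integral_unique[OF Gamma_integral_complex']) (use b in auto)
    finally show ?thesis .
  qed
  have wint: "integrable lborel w"
  proof -
    have "integrable lborel (\<lambda>t. norm (of_real (exp (- t)) * pw t (b - 1)) * 2 powr (Re b - 1))"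
      by (intro integrable_mult_left integrable_norm gint)
    moreover have "norm (of_real (exp (- t)) * pw t (b - 1)) * 2 powr (Re b - 1) = w t" for t
      by (simp add: w_def norm_mult norm_pw)
    ultimately show ?thesis by simp
  qed
  have lim: "((\<lambda>\<eta>. LINT u|lborel. s \<eta> u) \<longlongrightarrow> (LINT u|lborel. f u)) at_top"
  proof (rule integral_dominated_convergence_at_top[OF fm sm wint])
    show "\<forall>\<^sub>F \<eta> in at_top. AE u in lborel. norm (s \<eta> u) \<le> w u"
      using eventually_gt_at_top[of 0]
    proof eventually_elim
      case (elim \<eta>)
      have "norm (s \<eta> u) \<le> w u" for u
      proof (cases "u > 0")
        case True
        have "norm (pw (2 - u / \<eta>) (b - 1)) \<le> 2 powr (Re b - 1)"
          using True elim b by (auto simp: norm_pw intro!: powr_mono2)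
        then show ?thesis using True by (simp add: s_def w_def norm_mult norm_pw mult_left_mono)
      qed (simp add: s_def w_def pw_def)
      then show ?case by simp
    qed
    have "((\<lambda>\<eta>. s \<eta> u) \<longlongrightarrow> f u) at_top" for u
    proof -
      have l: "((\<lambda>\<eta>. u / \<eta>) \<longlongrightarrow> 0) at_top" by (intro real_tendsto_divide_at_top[OF tendsto_const] filterlim_ident)
      have "((\<lambda>\<eta>. 2 - u / \<eta>) \<longlongrightarrow> 2) at_top" using tendsto_diff[OF tendsto_const l, of 2] by simp
      moreover have "isCont (\<lambda>x. pw x (b - 1)) 2"
        using continuous_on_pw[of "b - 1" UNIV] b by (simp add: continuous_on_eq_continuous_at)
      ultimately have "((\<lambda>\<eta>. pw (2 - u / \<eta>) (b - 1)) \<longlongrightarrow> pw 2 (b - 1)) at_top"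
        using isCont_tendsto_compose by blast
      then show ?thesis unfolding s_def f_def by (intro tendsto_mult tendsto_const)
    qed
    then show "AE u in lborel. ((\<lambda>\<eta>. s \<eta> u) \<longlongrightarrow> f u) at_top" by simp
  qed
  have fval: "(LINT u|lborel. f u) = Gamma b * pw 2 (b - 1)"
    unfolding f_def by (simp add: gval)
  define R where "R = rGamma b / of_real (sqrt pi)"
  have main: "\<forall>\<^sub>F \<eta> in at_top. R * (LINT u|lborel. s \<eta> u) = of_real (exp (- \<eta>)) * pw \<eta> b * bj c (\<i> * of_real \<eta>)"
    using eventually_gt_at_top[of 0]
  proof eventually_elim
    case (elim \<eta>)
    let ?g = "\<lambda>y::real. wave (\<i> * of_real \<eta>) 1 y * kern b y"
    have "bj c (\<i> * of_real \<eta>) = GL b 1 (wave (\<i> * of_real \<eta>) (1::real))"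
      unfolding b_def by (rule bj_poisson) (use c in simp)
    also have "\<dots> = R * (LINT y|lborel. ?g y)"
      by (simp add: GL_eq_kern R_def half_dim_def powr_half_sqrt)
    also have "(LINT y|lborel. ?g y) = (1 / \<eta>) *\<^sub>R (LINT u|lborel. ?g (-1 + (1 / \<eta>) * u))"
      using elim by (subst lborel_integral_real_affine[of "1 / \<eta>" _ "-1"]) auto
    also have "(\<lambda>u. ?g (-1 + (1 / \<eta>) * u)) = (\<lambda>u. of_real (exp \<eta>) / pw \<eta> (b - 1) * s \<eta> u)"
    proof
      fix u :: real
      have e1: "1 - (norm (-1 + (1 / \<eta>) * u))\<^sup>2 = (u * (1 / \<eta>)) * (2 - u / \<eta>)"
        using elim by (simp add: power2_eq_square field_simps)
      have pos: "u * (1 / \<eta>) > 0 \<or> 2 - u / \<eta> > 0"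
        using elim by (cases "u > 0") (auto simp: field_simps)
      have "kern b (-1 + (1 / \<eta>) * u) = pw (u * (1 / \<eta>)) (b - 1) * pw (2 - u / \<eta>) (b - 1)"
        unfolding kern_def e1 by (rule pw_mult[OF pos])
      also have "pw (u * (1 / \<eta>)) (b - 1) = pw u (b - 1) * pw (1 / \<eta>) (b - 1)"
        by (rule pw_mult) (use elim in simp)
      also have "pw (1 / \<eta>) (b - 1) = 1 / pw \<eta> (b - 1)"
        using elim by (simp add: pw_def ln_inverse exp_minus divide_inverse)
      finally have k: "kern b (-1 + (1 / \<eta>) * u) = pw u (b - 1) / pw \<eta> (b - 1) * pw (2 - u / \<eta>) (b - 1)" by simp
      have "wave (\<i> * of_real \<eta>) (1::real) (-1 + (1 / \<eta>) * u) = exp (of_real (\<eta> - u))"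
      proof -
        have "\<i> * (\<i> * of_real \<eta>) * of_real ((-1 + (1 / \<eta>) * u) \<bullet> 1) = complex_of_real (- \<eta> * (-1 + (1 / \<eta>) * u))" by simp
        also have "- \<eta> * (-1 + (1 / \<eta>) * u) = \<eta> - u" using elim by (simp add: field_simps)
        finally show ?thesis by (simp add: wave_def)
      qed
      also have "\<dots> = of_real (exp \<eta>) * of_real (exp (- u))"
        by (simp add: exp_of_real exp_diff exp_minus divide_inverse)
      finally show "?g (-1 + (1 / \<eta>) * u) = of_real (exp \<eta>) / pw \<eta> (b - 1) * s \<eta> u"
        unfolding k s_def by simp
    qed
    also have "(LINT u|lborel. of_real (exp \<eta>) / pw \<eta> (b - 1) * s \<eta> u) = of_real (exp \<eta>) / pw \<eta> (b - 1) * (LINT u|lborel. s \<eta> u)"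
      by (rule integral_mult_right_zero)
    finally have "bj c (\<i> * of_real \<eta>) = R * ((1 / \<eta>) *\<^sub>R (of_real (exp \<eta>) / pw \<eta> (b - 1) * (LINT u|lborel. s \<eta> u)))" .
    moreover have "pw \<eta> b = of_real \<eta> * pw \<eta> (b - 1)" using pw_add1[of \<eta> "b - 1"] elim by simp
    moreover have "pw \<eta> (b - 1) \<noteq> 0" using elim by (simp add: pw_def)
    moreover have "complex_of_real (exp (- \<eta>)) * of_real (exp \<eta>) = 1" by (simp add: exp_minus flip: of_real_mult)
    moreover have "e * (of_real \<eta> * p) * (R * ((1 / \<eta>) *\<^sub>R (E / p * I))) = R * I"
      if "p \<noteq> 0" "e * E = 1" for e E p I :: complex
    proof -
      have "e * (of_real \<eta> * p) * (R * ((1 / \<eta>) *\<^sub>R (E / p * I))) = (e * E) * (R * I)"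
        using that(1) elim by (simp add: scaleR_conv_of_real)
      then show ?thesis using that(2) by simp
    qed
    ultimately show ?case by simp
  qed
  have "((\<lambda>\<eta>. R * (LINT u|lborel. s \<eta> u)) \<longlongrightarrow> R * (Gamma b * pw 2 (b - 1))) at_top"
    using lim unfolding fval by (intro tendsto_mult tendsto_const)
  moreover have "R * (Gamma b * pw 2 (b - 1)) = of_real (1 / sqrt pi) * pw 2 (b - 1)"
  proof -
    have "b \<notin> \<int>\<^sub>\<le>\<^sub>0" using b by (auto elim!: nonpos_Ints_cases)
    then have "rGamma b * Gamma b = 1" by (simp add: Gamma_def rGamma_eq_zero_iff)
    then show ?thesis by (simp add: R_def mult.assoc[symmetric])
  qed
  ultimately show ?thesis using Lim_transform_eventually[OF _ main] by simp
qed

lemma bj_ratio_all: "bj_ratio c"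
proof -
  have large: "bj_ratio c" if c: "Re c > 3/2" for c
  proof -
    let ?y = "\<lambda>c \<eta>. bj c (\<i> * of_real \<eta>)"
    define b where "b = c - 1/2"
    define K where "K = of_real (1 / sqrt pi) * pw 2 (b - 1)"
    define A where "A \<eta> = of_real (exp (- \<eta>)) * pw \<eta> b * ?y c \<eta>" for \<eta>
    define B where "B \<eta> = of_real (exp (- \<eta>)) * pw \<eta> (b + 1) * ?y (c + 1) \<eta>" for \<eta>
    have K0: "K \<noteq> 0" by (simp add: K_def pw_def)
    have A: "(A \<longlongrightarrow> K) at_top"
      unfolding A_def K_def b_def by (rule bj_imaginary_asymptotics[OF c])
    \<comment> \<open>The limit 2 originates here: passing from c to c + 1 raises the exponent of
      the factor 2 - u / \<eta>, whose limit is 2.\<close>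
    have "pw 2 b = 2 * pw 2 (b - 1)" using pw_add1[of 2 "b - 1"] by simp
    then have "of_real (1 / sqrt pi) * pw 2 (b + 1 - 1) = 2 * K" by (simp add: K_def)
    then have B: "(B \<longlongrightarrow> 2 * K) at_top"
      using bj_imaginary_asymptotics[of "c + 1"] c unfolding B_def b_def by (simp add: algebra_simps)
    have "\<forall>\<^sub>F \<eta> in at_top. A \<eta> \<noteq> 0" using tendsto_imp_eventually_ne[OF A K0] .
    then have 1: "\<forall>\<^sub>F \<eta> in at_top. ?y c \<eta> \<noteq> 0" by eventually_elim (auto simp: A_def)
    have "((\<lambda>\<eta>. B \<eta> / A \<eta>) \<longlongrightarrow> 2 * K / K) at_top" by (intro tendsto_divide A B K0)
    then have l: "((\<lambda>\<eta>. B \<eta> / A \<eta>) \<longlongrightarrow> 2) at_top" using K0 by simp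
    have "\<forall>\<^sub>F \<eta> in at_top. B \<eta> / A \<eta> = of_real \<eta> * ?y (c + 1) \<eta> / ?y c \<eta>"
      using 1 eventually_gt_at_top[of 0]
    proof eventually_elim
      case (elim \<eta>)
      have "pw \<eta> (b + 1) = of_real \<eta> * pw \<eta> b" using pw_add1[of \<eta> b] elim by simp
      moreover have "pw \<eta> b \<noteq> 0" using elim by (simp add: pw_def)
      ultimately show ?case using elim by (simp add: A_def B_def)
    qed
    from Lim_transform_eventually[OF l this] 1 show ?thesis by (simp add: bj_ratio_def)
  qed
  obtain N :: nat where "real N > 3/2 - Re c" using reals_Archimedean2 by blast
  then have "bj_ratio (c + of_nat N)" by (intro large) simp
  then show ?thesis by (rule bj_ratio_of_shift)
qed

section \<open>Division by the Helmholtz operator\<close>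

lemma mean_integral_eq_Gd:
  fixes \<phi> :: "real ^ 'n::finite \<Rightarrow> complex"
  assumes \<beta>: "Re \<beta> > 0" and t: "t > 0" and \<phi>: "smooth \<phi>"
  shows "mean_integral \<beta> t \<phi> = Gamma (\<beta> + of_nat CARD('n) / 2) * Gd \<beta> t \<phi>"
proof -
  let ?n = "CARD('n)"
  define f where "f x = indicator (cball 0 t) x *\<^sub>R (\<phi> x * of_real (t\<^sup>2 - (norm x)\<^sup>2) powr (\<beta> - 1))" for x :: "real ^ 'n"
  have [measurable]: "\<phi> \<in> borel_measurable borel"
    by (intro borel_measurable_continuous_onI smooth_continuous \<phi>)
  have feq: "f (t *\<^sub>R y) = of_real t powr (2 * \<beta> - 2) * (\<phi> (t *\<^sub>R y) * kern \<beta> y)" for y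
  proof (cases "norm y < 1")
    case True
    then have u: "1 - (norm y)\<^sup>2 > 0" by (simp add: power_less_one_iff)
    have "t\<^sup>2 - (norm (t *\<^sub>R y))\<^sup>2 = t\<^sup>2 * (1 - (norm y)\<^sup>2)"
      by (simp add: power_mult_distrib algebra_simps)
    then have "of_real (t\<^sup>2 - (norm (t *\<^sub>R y))\<^sup>2) powr (\<beta> - 1) = pw (t\<^sup>2 * (1 - (norm y)\<^sup>2)) (\<beta> - 1)"
      using u t by (simp add: pw_eq_powr)
    also have "\<dots> = pw (t\<^sup>2) (\<beta> - 1) * kern \<beta> y"
      unfolding kern_def by (rule pw_mult) (use t in simp)
    also have "pw (t\<^sup>2) (\<beta> - 1) = of_real t powr (2 * \<beta> - 2)"
      using t by (simp add: pw_def powr_def Ln_of_real ln_realpow algebra_simps)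
    finally show ?thesis using True t by (simp add: f_def indicator_def mult_le_cancel_left1 dist_norm)
  next
    case False
    \<comment> \<open>On the unit sphere the base vanishes and 0 \<open>powr\<close> is 0, in
      agreement with \<open>kern\<close>; outside the closed ball the indicator vanishes.\<close>
    have "f (t *\<^sub>R y) = 0"
    proof (cases "norm y = 1")
      case True
      then show ?thesis by (simp add: f_def)
    next
      case False
      then have "norm (t *\<^sub>R y) > t" using \<open>\<not> norm y < 1\<close> t by simp
      then show ?thesis by (simp add: f_def indicator_def)
    qed
    then show ?thesis using False by (simp add: kern_outside)
  qed
  have fm: "f \<in> borel_measurable borel"
  proof -
    have "(\<lambda>x::real ^ 'n. pw (t\<^sup>2 - (norm x)\<^sup>2) (\<beta> - 1)) \<in> borel_measurable borel"
      by (rule measurable_compose[OF _ measurable_pw]) measurable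
    then have "(\<lambda>x. indicator (cball 0 t) x *\<^sub>R (\<phi> x * pw (t\<^sup>2 - (norm x)\<^sup>2) (\<beta> - 1))) \<in> borel_measurable borel"
      by (intro borel_measurable_scaleR borel_measurable_indicator borel_measurable_times) auto
    also have "(\<lambda>x. indicator (cball 0 t) x *\<^sub>R (\<phi> x * pw (t\<^sup>2 - (norm x)\<^sup>2) (\<beta> - 1))) = f"
    proof
      fix x :: "real ^ 'n"
      have "pw (t\<^sup>2 - (norm x)\<^sup>2) (\<beta> - 1) = of_real (t\<^sup>2 - (norm x)\<^sup>2) powr (\<beta> - 1)" if "norm x \<le> t"
      proof (cases "t\<^sup>2 - (norm x)\<^sup>2 = 0")
        case True
        then show ?thesis unfolding True by (simp add: pw_def)
      next
        case False
        moreover have "t\<^sup>2 - (norm x)\<^sup>2 \<ge> 0" using that t by (simp add: power_mono)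
        ultimately show ?thesis by (intro pw_eq_powr) simp
      qed
      then show "indicator (cball 0 t) x *\<^sub>R (\<phi> x * pw (t\<^sup>2 - (norm x)\<^sup>2) (\<beta> - 1)) = f x"
        by (auto simp: f_def indicator_def)
    qed
    finally show ?thesis .
  qed
  have "(LINT x|lborel. f x) = (LINT x|density (distr lborel borel (\<lambda>x. 0 + t *\<^sub>R x)) (\<lambda>_. ennreal (\<bar>t\<bar> ^ DIM(real ^ 'n))). f x)"
    using lborel_affine[of t "0 :: real ^ 'n"] t by (simp add: ennreal_power)
  also have "\<dots> = (LINT x|distr lborel borel (\<lambda>x. 0 + t *\<^sub>R x). (t ^ ?n) *\<^sub>R f x)"
    using t by (subst integral_density) (auto simp: fm)
  also have "\<dots> = (LINT y|lborel. (t ^ ?n) *\<^sub>R f (0 + t *\<^sub>R y))"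
    by (rule integral_distr) (auto intro!: borel_measurable_scaleR fm)
  also have "\<dots> = (LINT y|lborel. (of_real t ^ ?n * of_real t powr (2 * \<beta> - 2)) * (\<phi> (t *\<^sub>R y) * kern \<beta> y))"
    by (simp only: add_0_left feq scaleR_conv_of_real[where 'a = complex] of_real_power mult.assoc)
  also have "\<dots> = (of_real t ^ ?n * of_real t powr (2 * \<beta> - 2)) * (LINT y|lborel. \<phi> (t *\<^sub>R y) * kern \<beta> y)"
    by (rule integral_mult_right_zero)
  finally have L: "(LINT x|lborel. f x) = (of_real t ^ ?n * of_real t powr (2 * \<beta> - 2)) * (LINT y|lborel. \<phi> (t *\<^sub>R y) * kern \<beta> y)" .
  \<comment> \<open>The Jacobian t^n of x = t y and the power t^(2 \<beta> - 2) taken out of the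
    kernel cancel the power of t in front of the integral.\<close>
  have T: "of_real t powr (2 - of_nat ?n - 2 * \<beta>) * (of_real t ^ ?n * of_real t powr (2 * \<beta> - 2)) = (1::complex)"
  proof -
    have "of_real t ^ ?n = of_real t powr (of_nat ?n :: complex)" using t by (simp add: powr_nat)
    then have "of_real t powr (2 - of_nat ?n - 2 * \<beta>) * (of_real t ^ ?n * of_real t powr (2 * \<beta> - 2)) =
      of_real t powr ((2 - of_nat ?n - 2 * \<beta>) + (of_nat ?n + (2 * \<beta> - 2)))" by (simp only: powr_add)
    also have "(2 - of_nat ?n - 2 * \<beta>) + (of_nat ?n + (2 * \<beta> - 2)) = (0::complex)" by simp
    finally show ?thesis using t by simp
  qed
  have "\<beta> \<notin> \<int>\<^sub>\<le>\<^sub>0" using \<beta> by (auto elim!: nonpos_Ints_cases)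
  have "mean_integral \<beta> t \<phi> = Gamma (\<beta> + of_nat ?n / 2) / (of_real (pi powr (real ?n / 2)) * Gamma \<beta>)
     * of_real t powr (2 - of_nat ?n - 2 * \<beta>) * (LINT x|lborel. f x)"
    by (simp add: mean_integral_def set_lebesgue_integral_def f_def)
  also have "\<dots> = Gamma (\<beta> + of_nat ?n / 2) / (of_real (pi powr (real ?n / 2)) * Gamma \<beta>)
     * (of_real t powr (2 - of_nat ?n - 2 * \<beta>) * (of_real t ^ ?n * of_real t powr (2 * \<beta> - 2))) * (LINT y|lborel. \<phi> (t *\<^sub>R y) * kern \<beta> y)"
    unfolding L by (simp only: mult.assoc)
  also have "\<dots> = Gamma (\<beta> + of_nat ?n / 2) * GL \<beta> t \<phi>"
  proof -
    have "A / (P * G) * 1 * I = A * (inverse G / P * I)" for A P G I :: complex by (simp add: divide_inverse)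
    moreover have "real DIM(real ^ 'n) = real ?n" by simp
    ultimately show ?thesis unfolding T GL_eq_kern half_dim_def rGamma_inverse_Gamma by (simp only:)
  qed
  finally show ?thesis by (simp add: Gd_eq_GL[OF \<phi> \<beta>])
qed

lemma exceptional_set_iff: "\<beta> \<in> exceptional_set n \<longleftrightarrow> \<beta> + of_nat n / 2 \<in> \<int>\<^sub>\<le>\<^sub>0"
proof -
  have "\<beta> \<in> exceptional_set n \<longleftrightarrow> (\<exists>k. \<beta> + of_nat n / 2 = - of_nat k)"
  proof -
    have "\<beta> = - of_nat n / 2 - of_nat k \<longleftrightarrow> \<beta> + of_nat n / 2 = - of_nat k" for k
    proof
      assume e: "\<beta> + of_nat n / 2 = - of_nat k"
      have "\<beta> = (\<beta> + of_nat n / 2) - of_nat n / 2" by simp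
      then show "\<beta> = - of_nat n / 2 - of_nat k" unfolding e by simp
    qed simp
    then show ?thesis unfolding exceptional_set_def by blast
  qed
  also have "\<dots> \<longleftrightarrow> \<beta> + of_nat n / 2 \<in> \<int>\<^sub>\<le>\<^sub>0"
    by (metis nonpos_Ints_cases' minus_of_nat_in_nonpos_Ints)
  finally show ?thesis .
qed

lemma exceptional_complement: "open (- exceptional_set n)" "connected (- exceptional_set n)"
proof -
  have e: "exceptional_set n = (\<lambda>x. - of_nat n / 2 + x) ` (uminus ` (of_nat ` UNIV))"
    unfolding exceptional_set_def by (auto simp: image_iff)
  show "open (- exceptional_set n)"
    unfolding e by (intro open_Compl closed_translation closed_negations closed_of_nat_image)
  have "countable (exceptional_set n)" unfolding e by (intro countable_image) auto
  then have "connected (UNIV - exceptional_set n :: complex set)"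
    by (intro connected_open_diff_countable) auto
  then show "connected (- exceptional_set n)" by (simp add: Compl_eq_Diff_UNIV)
qed

text \<open>The exceptional set consists of the poles of \<Gamma>(\<beta> + n/2), so this factor
  times the entire \<open>Gd\<close> is an admissible F. Uniqueness follows by analytic
  continuation, as removing a countable set leaves the plane connected.\<close>

lemma m_dist_eq_Gd:
  fixes \<phi> :: "real ^ 'n::finite \<Rightarrow> complex"
  assumes \<alpha>: "\<alpha> \<notin> exceptional_set CARD('n)" and t: "t > 0" and \<phi>: "smooth \<phi>"
  shows "m_dist \<alpha> t \<phi> = Gamma (\<alpha> + of_nat CARD('n) / 2) * Gd \<alpha> t \<phi>"
  unfolding m_dist_def
proof (rule the_equality)
  let ?F = "\<lambda>\<beta>. Gamma (\<beta> + of_nat CARD('n) / 2) * Gd \<beta> t \<phi>"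
  have Fhol: "?F holomorphic_on - exceptional_set CARD('n)"
    by (intro holomorphic_intros Gd_holomorphic \<phi>) (auto simp: exceptional_set_iff)
  have Fmer: "?F meromorphic_on UNIV"
  proof -
    have "(\<lambda>\<beta>. inverse (rGamma (\<beta> + of_nat CARD('n) / 2))) meromorphic_on UNIV"
      by (intro meromorphic_on_inverse analytic_on_imp_meromorphic_on)
         (auto simp: analytic_on_open intro!: holomorphic_intros)
    moreover have "(\<lambda>\<beta>. Gd \<beta> t \<phi>) meromorphic_on UNIV"
      by (intro analytic_on_imp_meromorphic_on) (auto simp: analytic_on_open intro!: Gd_holomorphic \<phi>)
    ultimately show ?thesis unfolding Gamma_def by (rule meromorphic_on_mult)
  qed
  have Fval: "Re \<beta> > 0 \<longrightarrow> ?F \<beta> = mean_integral \<beta> t \<phi>" for \<beta>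
    using mean_integral_eq_Gd[OF _ t \<phi>] by simp
  show "\<exists>F. F meromorphic_on UNIV \<and> F holomorphic_on - exceptional_set CARD('n) \<and>
     (\<forall>\<beta>. Re \<beta> > 0 \<longrightarrow> F \<beta> = mean_integral \<beta> t \<phi>) \<and> ?F \<alpha> = F \<alpha>"
    using Fhol Fmer Fval by (intro exI[of _ ?F]) auto
  fix w assume "\<exists>F. F meromorphic_on UNIV \<and> F holomorphic_on - exceptional_set CARD('n) \<and>
     (\<forall>\<beta>. Re \<beta> > 0 \<longrightarrow> F \<beta> = mean_integral \<beta> t \<phi>) \<and> w = F \<alpha>"
  then obtain F where F: "F holomorphic_on - exceptional_set CARD('n)"
    "\<And>\<beta>. Re \<beta> > 0 \<Longrightarrow> F \<beta> = mean_integral \<beta> t \<phi>" "w = F \<alpha>" by blast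
  have "F \<alpha> = ?F \<alpha>"
  proof (rule analytic_continuation_open[where s = "{b. Re b > 0}" and s' = "- exceptional_set CARD('n)" and f = F and g = ?F])
    have "1 \<in> {b. Re b > 0}" by simp
    then show "{b. Re b > 0} \<noteq> {}" by blast
    show "{b. Re b > 0} \<subseteq> - exceptional_set CARD('n)" by (auto simp: exceptional_set_def)
    show "F z = ?F z" if "z \<in> {b. Re b > 0}" for z using F(2)[of z] Fval[of z] that by simp
  qed (use half_plane exceptional_complement F Fhol \<alpha> in auto)
  then show "w = ?F \<alpha>" using F by simp
qed

lemma convolve_m_dist:
  fixes f :: "real ^ 'n::finite \<Rightarrow> complex"
  assumes "\<alpha> \<notin> exceptional_set CARD('n)" "t > 0" "smooth f"
  shows "convolve f (m_dist \<alpha> t) = (\<lambda>x. Gamma (\<alpha> + of_nat CARD('n) / 2) * cv f (Gd \<alpha> t) x)"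
  unfolding convolve_def[abs_def] cv_def using assms by (intro ext m_dist_eq_Gd smooth_reflect)

text \<open>\<open>EI b l s\<close> is the quotient of \<open>Gd b s\<close> by the operator \<open>\<Delta> + l\<^sup>2\<close>, up to a factor, in case \<open>l s\<close> is
  a zero of the Bessel function; \<open>EE\<close> continues it to lower orders \<open>b\<close>.\<close>

definition EI :: "complex \<Rightarrow> complex \<Rightarrow> real \<Rightarrow> ('a::euclidean_space \<Rightarrow> complex) \<Rightarrow> complex" where
  "EI b l s \<phi> = integral {0..1} (\<lambda>\<sigma>. pw \<sigma> (2 * (b + hc TYPE('a)) - 1) * bj (b + hc TYPE('a)) (l * of_real (s * \<sigma>)) * GL b (s * \<sigma>) \<phi>)"

primrec EE :: "nat \<Rightarrow> complex \<Rightarrow> complex \<Rightarrow> real \<Rightarrow> ('a::euclidean_space \<Rightarrow> complex) \<Rightarrow> complex" where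
  "EE 0 b l s \<phi> = EI b l s \<phi>"
| "EE (Suc N) b l s \<phi> = bj (b + hc TYPE('a)) (l * of_real s) / 2 * Gd (b + 1) s \<phi> + (l * of_real s)\<^sup>2 / 4 * EE N (b + 1) l s \<phi>"

lemma hc_pos: "Re (hc TYPE('a::euclidean_space)) > 0"
  by (simp add: hc_def half_dim_def)

lemma continuous_on_GL:
  assumes "Re b > 1" "smooth \<phi>"
  shows "continuous_on A (\<lambda>t. GL b t \<phi>)"
  using GL_has_vector_derivative[OF assms] has_vector_derivative_continuous
  by (meson continuous_at_imp_continuous_on)

lemma continuous_on_EI_integrand:
  fixes \<phi> :: "'a::euclidean_space \<Rightarrow> complex"
  assumes b: "Re b > 1" and \<phi>: "smooth \<phi>"
  shows "continuous_on A (\<lambda>\<sigma>. pw \<sigma> (2 * (b + hc TYPE('a)) - 1) * bj (b + hc TYPE('a)) (l * of_real (s * \<sigma>)) * GL b (s * \<sigma>) \<phi>)"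
proof -
  have "continuous_on A (\<lambda>\<sigma>. GL b (s * \<sigma>) \<phi>)"
    by (rule continuous_on_compose2[OF continuous_on_GL[OF b \<phi>, of UNIV]]) (auto intro!: continuous_intros)
  moreover have "Re (2 * (b + hc TYPE('a)) - 1) > 0" using b hc_pos[where 'a = 'a] by simp
  ultimately show ?thesis by (intro continuous_intros continuous_on_pw)
qed

text \<open>The fundamental theorem of calculus for \<sigma>^(2c) / 2 times the Bessel function
  times \<open>GL (b + 1)\<close>. Differentiating the power and the mean gives, by
  \<open>GL_recurrence_gt1\<close>, the integrand of \<open>EI b\<close>; differentiating the Bessel
  function gives that of \<open>EI (b + 1)\<close>. At lower orders the formula becomes the
  definition of \<open>EE\<close>.\<close>

lemma EI_recurrence:
  fixes \<phi> :: "'a::euclidean_space \<Rightarrow> complex"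
  assumes b: "Re b > 1" and \<phi>: "smooth \<phi>"
  shows "EI b l s \<phi> = bj (b + hc TYPE('a)) (l * of_real s) / 2 * GL (b + 1) s \<phi> + (l * of_real s)\<^sup>2 / 4 * EI (b + 1) l s \<phi>"
proof -
  define c where "c = b + hc TYPE('a)"
  have b1: "Re (b + 1) > 1" using b by simp
  have c1: "b + 1 + hc TYPE('a) = c + 1" by (simp add: c_def)
  have c2: "Re (2 * c) > 1" using b hc_pos[where 'a = 'a] by (simp add: c_def)
  let ?H = "\<lambda>\<sigma>. (pw \<sigma> (2 * c) / 2 * bj c (l * of_real (s * \<sigma>))) * GL (b + 1) (s * \<sigma>) \<phi>"
  let ?A = "\<lambda>\<sigma>. pw \<sigma> (2 * c - 1) * bj c (l * of_real (s * \<sigma>)) * GL b (s * \<sigma>) \<phi>"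
  let ?B = "\<lambda>\<sigma>. pw \<sigma> (2 * (c + 1) - 1) * bj (c + 1) (l * of_real (s * \<sigma>)) * GL (b + 1) (s * \<sigma>) \<phi>"
  let ?w = "(l * of_real s)\<^sup>2 / 4"
  have cA: "continuous_on {0..1} ?A" using continuous_on_EI_integrand[OF b \<phi>] by (simp add: c_def)
  have cB: "continuous_on {0..1} ?B" using continuous_on_EI_integrand[OF b1 \<phi>, of "{0..1}" l s] unfolding c1 .
  have "((\<lambda>\<sigma>. ?A \<sigma> - ?w * ?B \<sigma>) has_integral (?H 1 - ?H 0)) {0..1}"
  proof (rule fundamental_theorem_of_calculus)
    fix \<sigma> :: real assume \<sigma>: "\<sigma> \<in> {0..1}"
    define p where "p = pw \<sigma> (2 * c - 1)"
    have p1: "pw \<sigma> (2 * c) = of_real \<sigma> * p" using pw_add1[of \<sigma> "2 * c - 1"] \<sigma> by (simp add: p_def)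
    have p2: "pw \<sigma> (2 * (c + 1) - 1) = of_real \<sigma> * (of_real \<sigma> * p)"
      using pw_add1[of \<sigma> "2 * c"] \<sigma> p1 by (simp add: algebra_simps)
    have d1: "((\<lambda>\<sigma>. pw \<sigma> (2 * c) / 2) has_vector_derivative c * p) (at \<sigma>)"
      using has_vector_derivative_divide[OF pw_has_vector_derivative[OF c2, of \<sigma>], of 2] by (simp add: p_def)
    define \<zeta> where "\<zeta> = l * of_real (s * \<sigma>)"
    have "((\<lambda>\<sigma>. l * of_real (s * \<sigma>)) has_vector_derivative l * of_real s) (at \<sigma>)"
      by (auto intro!: derivative_eq_intros)
    from field_vector_diff_chain_at[OF this bj_has_field_derivative]
    have d2: "((\<lambda>\<sigma>. bj c (l * of_real (s * \<sigma>))) has_vector_derivative (l * of_real s) * (- (\<zeta> / 2) * bj (c + 1) \<zeta>)) (at \<sigma>)"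
      by (simp add: o_def \<zeta>_def)
    have "((\<lambda>\<sigma>. s * \<sigma>) has_vector_derivative s) (at \<sigma>)" by (auto intro!: derivative_eq_intros)
    from vector_diff_chain_at[OF this GL_has_vector_derivative[OF b1 \<phi>]]
    have d3: "((\<lambda>\<sigma>. GL (b + 1) (s * \<sigma>) \<phi>) has_vector_derivative s *\<^sub>R (of_real (s * \<sigma>) / 2 * GL (b + 2) (s * \<sigma>) (lap \<phi>))) (at \<sigma>)"
      by (simp add: o_def add.assoc)
    have R: "GL b (s * \<sigma>) \<phi> = c * GL (b + 1) (s * \<sigma>) \<phi> + (of_real (s * \<sigma>))\<^sup>2 / 4 * GL (b + 2) (s * \<sigma>) (lap \<phi>)"
      unfolding c_def by (rule GL_recurrence_gt1[OF b \<phi>])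
    have "(?H has_vector_derivative ?A \<sigma> - ?w * ?B \<sigma>) (at \<sigma>)"
    proof (rule has_vector_derivative_eq_rhs[OF has_vector_derivative_mult[OF has_vector_derivative_mult[OF d1 d2] d3]])
      show "pw \<sigma> (2 * c) / 2 * bj c (l * of_real (s * \<sigma>)) * (s *\<^sub>R (of_real (s * \<sigma>) / 2 * GL (b + 2) (s * \<sigma>) (lap \<phi>))) +
        (pw \<sigma> (2 * c) / 2 * (l * of_real s * (- (\<zeta> / 2) * bj (c + 1) \<zeta>)) + c * p * bj c (l * of_real (s * \<sigma>))) * GL (b + 1) (s * \<sigma>) \<phi> =
        ?A \<sigma> - ?w * ?B \<sigma>"
        unfolding R p1 p2 p_def[symmetric]
        by (simp add: \<zeta>_def scaleR_conv_of_real power2_eq_square field_simps)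
    qed
    then show "(?H has_vector_derivative ?A \<sigma> - ?w * ?B \<sigma>) (at \<sigma> within {0..1})" by (rule has_vector_derivative_at_within)
  qed simp
  then have i1: "integral {0..1} (\<lambda>\<sigma>. ?A \<sigma> - ?w * ?B \<sigma>) = ?H 1 - ?H 0" by (rule integral_unique)
  have i2: "integral {0..1} (\<lambda>\<sigma>. ?A \<sigma> - ?w * ?B \<sigma>) = integral {0..1} ?A - integral {0..1} (\<lambda>\<sigma>. ?w * ?B \<sigma>)"
    by (intro integral_diff integrable_continuous_interval continuous_on_mult continuous_on_const cA cB)
  have i3: "integral {0..1} (\<lambda>\<sigma>. ?w * ?B \<sigma>) = ?w * EI (b + 1) l s \<phi>" unfolding EI_def c1 by simp
  have i4: "integral {0..1} ?A = EI b l s \<phi>" unfolding EI_def c_def ..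
  have i5: "?H 1 - ?H 0 = bj c (l * of_real s) / 2 * GL (b + 1) s \<phi>" by (simp add: pw_def)
  have "EI b l s \<phi> - ?w * EI (b + 1) l s \<phi> = bj c (l * of_real s) / 2 * GL (b + 1) s \<phi>"
    using i1 unfolding i2 i3 i4 i5 .
  then show ?thesis unfolding c_def by (simp only: diff_eq_eq)
qed

lemma nice_EI:
  assumes b: "Re b > 1"
  shows "nice (EI b l s :: ('a::euclidean_space \<Rightarrow> complex) \<Rightarrow> complex)"
proof (rule nice_ext[OF nice_base])
  let ?p = "\<lambda>\<sigma>. pw \<sigma> (2 * (b + hc TYPE('a)) - 1) * bj (b + hc TYPE('a)) (l * of_real (s * \<sigma>))"
  let ?k = "\<lambda>z::real \<times> 'a. ?p (fst z) * nker b (snd z)" and ?X = "\<lambda>z::real \<times> 'a. (s * fst z) *\<^sub>R snd z"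
  have "Re (2 * (b + hc TYPE('a)) - 1) > 0" using b hc_pos[where 'a = 'a] by simp
  then have p: "continuous_on UNIV ?p" by (intro continuous_intros continuous_on_pw)
  show k: "continuous_on (cbox (0, - One) (1, One)) ?k"
    by (intro continuous_on_mult continuous_on_compose2[OF continuous_on_nker[OF b, of UNIV]] continuous_on_compose2[OF p])
       (auto intro!: continuous_intros)
  show X: "continuous_on (cbox (0, - One) (1, One)) ?X" by (intro continuous_intros)
  fix \<phi> :: "'a \<Rightarrow> complex" assume \<phi>: "smooth \<phi>"
  have "continuous_on (cbox (0, - One) (1, One)) (\<lambda>z. ?k z * \<phi> (?X z))"
    by (intro continuous_on_mult k smooth_compose_continuous[OF \<phi> X])
  from integral_prod_continuous[OF this]
  have "integral (cbox (0, - One) (1, One)) (\<lambda>z. ?k z * \<phi> (?X z)) =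
     integral {0..1} (\<lambda>\<sigma>. integral (cbox (- One) One) (\<lambda>y. ?p \<sigma> * (\<phi> ((s * \<sigma>) *\<^sub>R y) * nker b y)))"
    by (simp add: mult_ac)
  also have "\<dots> = integral {0..1} (\<lambda>\<sigma>. ?p \<sigma> * GL b (s * \<sigma>) \<phi>)"
    unfolding GL_eq_cbox[OF b \<phi>] by simp
  finally show "EI b l s \<phi> = integral (cbox (0, - One) (1, One)) (\<lambda>z. ?k z * \<phi> (?X z))" by (simp add: EI_def)
qed

lemma nice_EE: "Re b > 1 - real N \<Longrightarrow> nice (EE N b l s :: ('a::euclidean_space \<Rightarrow> complex) \<Rightarrow> complex)"
proof (induction N arbitrary: b)
  case 0
  have "nice (EI b l s :: ('a \<Rightarrow> complex) \<Rightarrow> complex)" by (rule nice_EI) (use 0 in simp)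
  then show ?case by (rule nice_ext) simp
next
  case (Suc N)
  have n: "nice (EE N (b + 1) l s :: ('a \<Rightarrow> complex) \<Rightarrow> complex)" by (rule Suc.IH) (use Suc.prems in simp)
  show ?case
    by (rule nice_ext[OF nice_sum[OF nice_scale[OF nice_Gd[of "b + 1" s], of "bj (b + hc TYPE('a)) (l * of_real s) / 2"] nice_scale[OF n, of "(l * of_real s)\<^sup>2 / 4"]]]) simp
qed

lemma rker_mono: "x \<le> x' \<Longrightarrow> rker x' y \<le> rker x y"
proof -
  assume "x \<le> x'"
  moreover have "norm y < 1 \<Longrightarrow> 1 - (norm y)\<^sup>2 > 0" by (simp add: power_less_one_iff)
  ultimately show ?thesis by (auto simp: rker_def intro!: powr_mono')
qed

text \<open>Up to a power of pi the quotient is the integral of \<open>rker x\<close>, whose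
  integrand decreases in x.\<close>

lemma Gamma_ratio_mono:
  fixes x x' :: real
  assumes "0 < x" "x \<le> x'"
  shows "Gamma x' / Gamma (x' + half_dim TYPE('a::euclidean_space)) \<le> Gamma x / Gamma (x + half_dim TYPE('a))"
proof -
  have "(LINT y|lborel. rker x' (y::'a)) \<le> (LINT y|lborel. rker x (y::'a))"
    using assms by (intro Bochner_Integration.integral_mono rker_integrable(1) rker_mono) auto
  then show ?thesis using rker_integrable(2)[of x, where 'a = 'a] rker_integrable(2)[of x', where 'a = 'a] assms
    by (simp add: mult_le_cancel_left_pos flip: times_divide_eq_right)
qed

lemma EI_norm_le:
  fixes \<phi> :: "'a::euclidean_space \<Rightarrow> complex"
  assumes b: "Re b > 1" and \<phi>: "smooth \<phi>" and B: "\<And>y. norm y \<le> \<bar>s\<bar> \<Longrightarrow> norm (\<phi> y) \<le> B"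
    and L: "\<And>\<sigma>. \<sigma> \<in> {0..1} \<Longrightarrow> norm (bj (b + hc TYPE('a)) (l * of_real (s * \<sigma>))) \<le> L"
  shows "norm (EI b l s \<phi>) \<le> L * (norm (rGamma b) * (B * (Gamma (Re b) / Gamma (Re b + half_dim TYPE('a)))))"
proof -
  let ?K = "norm (rGamma b) * (B * (Gamma (Re b) / Gamma (Re b + half_dim TYPE('a))))"
  have L0: "L \<ge> 0" by (rule order_trans[OF norm_ge_zero L[of 0]]) simp
  have "norm (EI b l s \<phi>) \<le> integral {0..1} (\<lambda>\<sigma>::real. L * ?K)"
    unfolding EI_def
  proof (rule integral_norm_bound_integral)
    show "(\<lambda>\<sigma>. pw \<sigma> (2 * (b + hc TYPE('a)) - 1) * bj (b + hc TYPE('a)) (l * of_real (s * \<sigma>)) * GL b (s * \<sigma>) \<phi>) integrable_on {0..1}"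
      by (intro integrable_continuous_interval continuous_on_EI_integrand b \<phi>)
    fix \<sigma> :: real assume \<sigma>: "\<sigma> \<in> {0..1}"
    have "Re (2 * (b + hc TYPE('a)) - 1) \<ge> 0" using b hc_pos[where 'a = 'a] by simp
    then have p: "norm (pw \<sigma> (2 * (b + hc TYPE('a)) - 1)) \<le> 1"
      using \<sigma> by (auto simp: norm_pw intro!: powr_le1)
    have g: "norm (GL b (s * \<sigma>) \<phi>) \<le> ?K"
    proof (rule GL_norm_le)
      fix y :: 'a assume "norm y \<le> \<bar>s * \<sigma>\<bar>"
      also have "\<bar>s * \<sigma>\<bar> \<le> \<bar>s\<bar>" using \<sigma> by (simp add: abs_mult mult_left_le)
      finally show "norm (\<phi> y) \<le> B" by (rule B)
    qed (use b \<phi> in auto)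
    have "norm (pw \<sigma> (2 * (b + hc TYPE('a)) - 1) * bj (b + hc TYPE('a)) (l * of_real (s * \<sigma>)) * GL b (s * \<sigma>) \<phi>) \<le> 1 * L * ?K"
      unfolding norm_mult using L0 by (intro mult_mono p g L \<sigma>) auto
    then show "norm (pw \<sigma> (2 * (b + hc TYPE('a)) - 1) * bj (b + hc TYPE('a)) (l * of_real (s * \<sigma>)) * GL b (s * \<sigma>) \<phi>) \<le> L * ?K" by simp
  qed auto
  then show ?thesis by simp
qed

lemma bj_norm_le_rGamma:
  assumes "Re c \<ge> 1"
  shows "norm (bj c z) \<le> norm (rGamma c) * exp ((norm z)\<^sup>2)"
proof -
  let ?u = "- (z\<^sup>2) / 4"
  have "norm (bj c z - rGamma c) \<le> norm (rGamma c) * (exp (norm ?u / 1) - 1)"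
    unfolding bj_def by (rule norm_bcf_minus_rGamma_le) (use assms in auto)
  moreover have "norm (bj c z) \<le> norm (bj c z - rGamma c) + norm (rGamma c)"
    using norm_triangle_ineq[of "bj c z - rGamma c" "rGamma c"] by simp
  ultimately have "norm (bj c z) \<le> norm (rGamma c) * exp (norm ?u)" by (simp add: algebra_simps)
  also have "\<dots> \<le> norm (rGamma c) * exp ((norm z)\<^sup>2)"
    by (intro mult_left_mono) (simp_all add: norm_divide norm_power)
  finally show ?thesis .
qed

text \<open>Apart from x^N and \<open>rGamma (b + of_nat N)\<close>, all factors stay bounded in N,
  and 1/\<Gamma> decays superexponentially. These limits remove the remainders in
  \<open>divides_EI\<close>.\<close>

lemma EI_shift_tendsto_0:
  fixes \<phi> :: "'a::euclidean_space \<Rightarrow> complex"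
  assumes b: "Re b > 1" and \<phi>: "smooth \<phi>"
  shows "(\<lambda>N. x ^ N * EI (b + of_nat N) l s \<phi>) \<longlonglongrightarrow> 0" "(\<lambda>N. x ^ N * GL (b + of_nat N) s \<phi>) \<longlonglongrightarrow> 0"
proof -
  obtain B where B: "\<And>y. norm y \<le> \<bar>s\<bar> \<Longrightarrow> norm (\<phi> y) \<le> B" using bounded_on_ball[OF \<phi>] by blast
  have B0: "B \<ge> 0" by (rule order_trans[OF norm_ge_zero B[of 0]]) simp
  let ?c = "b + hc TYPE('a)"
  obtain K where K: "K \<ge> 0" "\<And>k. norm (rGamma (?c + of_nat k)) \<le> K" using rGamma_bounded[of ?c] by metis
  define D where "D = B * (Gamma (Re b) / Gamma (Re b + half_dim TYPE('a)))"
  have dd: "B * (Gamma (Re (b + of_nat N)) / Gamma (Re (b + of_nat N) + half_dim TYPE('a))) \<le> D" for N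
    unfolding D_def using b by (intro mult_left_mono Gamma_ratio_mono B0) auto
  define L where "L = K * exp ((norm l * \<bar>s\<bar>)\<^sup>2)"
  have r: "(\<lambda>N. norm (x ^ N * rGamma (b + of_nat N))) \<longlonglongrightarrow> 0"
    using rGamma_shift_tendsto_0 by (rule tendsto_norm_zero)
  have b': "Re (b + of_nat N) > 1" "Re (?c + of_nat N) \<ge> 1" for N using b hc_pos[where 'a = 'a] by auto
  have bjL: "norm (bj (b + of_nat N + hc TYPE('a)) (l * of_real (s * \<sigma>))) \<le> L" if "\<sigma> \<in> {0..1}" for N \<sigma>
  proof -
    have "norm (l * complex_of_real (s * \<sigma>)) \<le> norm l * \<bar>s\<bar>"
      using that by (simp add: norm_mult abs_mult mult_left_mono mult_left_le)
    then have "exp ((norm (l * complex_of_real (s * \<sigma>)))\<^sup>2) \<le> exp ((norm l * \<bar>s\<bar>)\<^sup>2)"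
      by (simp add: power_mono del: norm_mult)
    then have "norm (rGamma (?c + of_nat N)) * exp ((norm (l * complex_of_real (s * \<sigma>)))\<^sup>2) \<le> L"
      unfolding L_def by (intro mult_mono K) auto
    then show ?thesis
      using bj_norm_le_rGamma[OF b'(2), of N "l * of_real (s * \<sigma>)"] by (simp add: add_ac)
  qed
  have L0: "L \<ge> 0" using K by (simp add: L_def)
  show "(\<lambda>N. x ^ N * EI (b + of_nat N) l s \<phi>) \<longlonglongrightarrow> 0"
  proof (rule Lim_null_comparison[where g = "\<lambda>N. norm (x ^ N * rGamma (b + of_nat N)) * (L * D)"])
    show "\<forall>\<^sub>F N in sequentially. norm (x ^ N * EI (b + of_nat N) l s \<phi>) \<le> norm (x ^ N * rGamma (b + of_nat N)) * (L * D)"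
    proof (intro always_eventually allI)
      fix N
      have "norm (EI (b + of_nat N) l s \<phi>) \<le> L * (norm (rGamma (b + of_nat N)) * (B * (Gamma (Re (b + of_nat N)) / Gamma (Re (b + of_nat N) + half_dim TYPE('a)))))"
        by (rule EI_norm_le[OF b'(1) \<phi> B bjL])
      also have "\<dots> \<le> L * (norm (rGamma (b + of_nat N)) * D)" by (intro mult_left_mono dd L0) auto
      finally have "norm (x ^ N) * norm (EI (b + of_nat N) l s \<phi>) \<le> norm (x ^ N) * (L * (norm (rGamma (b + of_nat N)) * D))"
        by (intro mult_left_mono) auto
      then show "norm (x ^ N * EI (b + of_nat N) l s \<phi>) \<le> norm (x ^ N * rGamma (b + of_nat N)) * (L * D)"
        by (simp add: norm_mult mult_ac)
    qed
    show "(\<lambda>N. norm (x ^ N * rGamma (b + of_nat N)) * (L * D)) \<longlonglongrightarrow> 0" by (rule tendsto_mult_left_zero[OF r])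
  qed
  show "(\<lambda>N. x ^ N * GL (b + of_nat N) s \<phi>) \<longlonglongrightarrow> 0"
  proof (rule Lim_null_comparison[where g = "\<lambda>N. norm (x ^ N * rGamma (b + of_nat N)) * D"])
    show "\<forall>\<^sub>F N in sequentially. norm (x ^ N * GL (b + of_nat N) s \<phi>) \<le> norm (x ^ N * rGamma (b + of_nat N)) * D"
    proof (intro always_eventually allI)
      fix N
      have "norm (GL (b + of_nat N) s \<phi>) \<le> norm (rGamma (b + of_nat N)) * (B * (Gamma (Re (b + of_nat N)) / Gamma (Re (b + of_nat N) + half_dim TYPE('a))))"
        by (rule GL_norm_le[OF _ \<phi> B]) (use b'(1)[of N] in auto)
      also have "\<dots> \<le> norm (rGamma (b + of_nat N)) * D" by (intro mult_left_mono dd) auto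
      finally have "norm (x ^ N) * norm (GL (b + of_nat N) s \<phi>) \<le> norm (x ^ N) * (norm (rGamma (b + of_nat N)) * D)"
        by (intro mult_left_mono) auto
      then show "norm (x ^ N * GL (b + of_nat N) s \<phi>) \<le> norm (x ^ N * rGamma (b + of_nat N)) * D"
        by (simp add: norm_mult mult_ac)
    qed
    show "(\<lambda>N. norm (x ^ N * rGamma (b + of_nat N)) * D) \<longlonglongrightarrow> 0" by (rule tendsto_mult_left_zero[OF r])
  qed
qed

text \<open>\<open>divides E b l s\<close>: up to the factor \<open>l\<^sup>2 bj (c + 1) (l s) / 2\<close>, the functional \<open>E\<close> solves \<open>(\<Delta> + l\<^sup>2) E = Gd b s\<close>
  when \<open>bj c (l s) = 0\<close>; the second clause is its Fourier transform at the frequency \<open>l\<close>.\<close>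

definition divides :: "(('a::euclidean_space \<Rightarrow> complex) \<Rightarrow> complex) \<Rightarrow> complex \<Rightarrow> complex \<Rightarrow> real \<Rightarrow> bool" where
  "divides E b l s \<longleftrightarrow>
    (\<forall>\<phi>. smooth \<phi> \<longrightarrow> 2 * E (\<lambda>x. lap \<phi> x + l\<^sup>2 * \<phi> x) =
       bj (b + hc TYPE('a)) (l * of_real s) * Gd (b + 1) s (lap \<phi>) + l\<^sup>2 * bj (b + hc TYPE('a) + 1) (l * of_real s) * Gd b s \<phi>) \<and>
    (\<forall>u\<in>Basis. 2 * E (wave (- l) u) = (bj (b + hc TYPE('a)) (l * of_real s))\<^sup>2 -
       bj (b + hc TYPE('a) - 1) (l * of_real s) * bj (b + hc TYPE('a) + 1) (l * of_real s))"

text \<open>The defect of the first identity in \<open>divides\<close> at order b is (l s)^2 / 4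
  times that at order b + 1. Thus the identity passes down from b + 1 to b, and iterating upwards
  allows the defect to be evaluated at infinity.\<close>

lemma divides_defect:
  fixes E E' :: "('a::euclidean_space \<Rightarrow> complex) \<Rightarrow> complex"
  assumes E: "\<And>\<phi>. smooth \<phi> \<Longrightarrow> E \<phi> = bj (b + hc TYPE('a)) (l * of_real s) / 2 * Gd (b + 1) s \<phi> + (l * of_real s)\<^sup>2 / 4 * E' \<phi>"
    and \<phi>: "smooth \<phi>"
  defines "y \<equiv> \<lambda>k. bj (b + hc TYPE('a) + k) (l * of_real s)"
  shows "2 * E (\<lambda>x. lap \<phi> x + l\<^sup>2 * \<phi> x) - (y 0 * Gd (b + 1) s (lap \<phi>) + l\<^sup>2 * y 1 * Gd b s \<phi>) =
    (l * of_real s)\<^sup>2 / 4 * (2 * E' (\<lambda>x. lap \<phi> x + l\<^sup>2 * \<phi> x) - (y 1 * Gd (b + 2) s (lap \<phi>) + l\<^sup>2 * y 2 * Gd (b + 1) s \<phi>))"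
proof -
  define c where "c = b + hc TYPE('a)"
  define w where "w = (l * of_real s)\<^sup>2 / 4"
  define D1 D2 g0 g1 where "D1 = Gd (b + 1) s (lap \<phi>)" and "D2 = Gd (b + 2) s (lap \<phi>)" and "g0 = Gd b s \<phi>" and "g1 = Gd (b + 1) s \<phi>"
  have sm: "smooth (\<lambda>x. lap \<phi> x + l\<^sup>2 * \<phi> x)" by (intro smooth_add smooth_lap smooth_cmult \<phi>)
  have G: "Gd (b + 1) s (\<lambda>x. lap \<phi> x + l\<^sup>2 * \<phi> x) = D1 + l\<^sup>2 * g1"
    unfolding D1_def g1_def
    by (simp add: nice_add[OF nice_Gd smooth_lap[OF \<phi>] smooth_cmult[OF \<phi>]] nice_cmult[OF nice_Gd \<phi>])
  have g0: "g0 = c * g1 + (of_real s)\<^sup>2 / 4 * D2"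
    unfolding g0_def g1_def D2_def c_def by (rule Gd_rec[OF \<phi>])
  have y0: "y 0 = c * y 1 - w * y 2"
    using bj_rec[of c "l * of_real s"] by (simp add: y_def c_def w_def)
  define X where "X = E' (\<lambda>x. lap \<phi> x + l\<^sup>2 * \<phi> x)"
  have Ew: "2 * E (\<lambda>x. lap \<phi> x + l\<^sup>2 * \<phi> x) = y 0 * (D1 + l\<^sup>2 * g1) + 2 * w * X"
    unfolding E[OF sm] G X_def w_def by (simp add: y_def)
  define q :: complex where "q = (of_real s)\<^sup>2 / 4"
  have w2: "w = l\<^sup>2 * q" by (simp add: w_def q_def power_mult_distrib)
  have "(y 0 * (D1 + l\<^sup>2 * g1) + 2 * w * X) - (y 0 * D1 + l\<^sup>2 * y 1 * g0) = w * (2 * X - (y 1 * D2 + l\<^sup>2 * y 2 * g1))"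
    unfolding g0[folded q_def] y0 w2 by (simp add: algebra_simps)
  then show ?thesis unfolding Ew D1_def D2_def g0_def g1_def X_def w_def .
qed

text \<open>The same scheme for Lommel's integral of the square; besides the recurrence at c it uses
  the one at c - 1, which expresses \<open>y (-1)\<close>.\<close>

lemma divides_defect_wave:
  fixes E E' :: "('a::euclidean_space \<Rightarrow> complex) \<Rightarrow> complex"
  assumes E: "\<And>\<phi>. smooth \<phi> \<Longrightarrow> E \<phi> = bj (b + hc TYPE('a)) (l * of_real s) / 2 * Gd (b + 1) s \<phi> + (l * of_real s)\<^sup>2 / 4 * E' \<phi>"
    and u: "u \<in> Basis"
  defines "y \<equiv> \<lambda>k. bj (b + hc TYPE('a) + k) (l * of_real s)"
  shows "2 * E (wave (- l) u) - ((y 0)\<^sup>2 - y (-1) * y 1) = (l * of_real s)\<^sup>2 / 4 * (2 * E' (wave (- l) u) - ((y 1)\<^sup>2 - y 0 * y 2))"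
proof -
  define c where "c = b + hc TYPE('a)"
  define w where "w = (l * of_real s)\<^sup>2 / 4"
  have G: "Gd (b + 1) s (wave (- l) u) = y 1"
    using Gd_wave[OF u, of "b + 1" s "- l"] by (simp add: y_def add_ac)
  have y0: "y 0 = c * y 1 - w * y 2" using bj_rec[of c "l * of_real s"] by (simp add: y_def c_def w_def)
  have e: "c - 1 + 1 = c" "c - 1 + 2 = c + 1" by simp_all
  have ym: "y (-1) = (c - 1) * y 0 - w * y 1"
    using bj_rec[of "c - 1" "l * of_real s"] unfolding e by (simp add: y_def c_def w_def)
  have wy2: "w * y 2 = c * y 1 - y 0" unfolding y0 by simp
  have "2 * E (wave (- l) u) = y 0 * y 1 + 2 * w * E' (wave (- l) u)"
    unfolding E[OF smooth_wave] G w_def by (simp add: y_def)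
  then have "2 * E (wave (- l) u) - ((y 0)\<^sup>2 - y (-1) * y 1) = 2 * w * E' (wave (- l) u) + (y 0 * y 1 - (y 0)\<^sup>2 + y (-1) * y 1)" by simp
  also have "y 0 * y 1 - (y 0)\<^sup>2 + y (-1) * y 1 = - (w * (y 1)\<^sup>2) + y 0 * (c * y 1 - y 0)"
    unfolding ym by (simp add: algebra_simps power2_eq_square)
  also have "\<dots> = - w * ((y 1)\<^sup>2 - y 0 * y 2)" unfolding wy2[symmetric] by (simp add: algebra_simps)
  finally have "2 * E (wave (- l) u) - ((y 0)\<^sup>2 - y (-1) * y 1) = 2 * w * E' (wave (- l) u) + - w * ((y 1)\<^sup>2 - y 0 * y 2)" .
  moreover have "2 * w * e + - w * v = w * (2 * e - v)" for e v by (simp add: algebra_simps)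
  ultimately show ?thesis unfolding w_def by (simp only:)
qed

lemma divides_step:
  fixes E E' :: "('a::euclidean_space \<Rightarrow> complex) \<Rightarrow> complex"
  assumes E: "\<And>\<phi>. smooth \<phi> \<Longrightarrow> E \<phi> = bj (b + hc TYPE('a)) (l * of_real s) / 2 * Gd (b + 1) s \<phi> + (l * of_real s)\<^sup>2 / 4 * E' \<phi>"
    and d: "divides E' (b + 1) l s"
  shows "divides E b l s"
proof -
  have 1: "2 * E' (\<lambda>x. lap \<phi> x + l\<^sup>2 * \<phi> x) - (bj (b + hc TYPE('a) + 1) (l * of_real s) * Gd (b + 2) s (lap \<phi>) + l\<^sup>2 * bj (b + hc TYPE('a) + 2) (l * of_real s) * Gd (b + 1) s \<phi>) = 0"
    if "smooth \<phi>" for \<phi>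
    using d that by (simp add: divides_def add_ac)
  have 2: "2 * E' (wave (- l) u) - ((bj (b + hc TYPE('a) + 1) (l * of_real s))\<^sup>2 - bj (b + hc TYPE('a) + 0) (l * of_real s) * bj (b + hc TYPE('a) + 2) (l * of_real s)) = 0"
    if "u \<in> Basis" for u
    using d that by (simp add: divides_def add_ac)
  show ?thesis unfolding divides_def
  proof (intro conjI allI impI ballI)
    fix \<phi> :: "'a \<Rightarrow> complex" assume \<phi>: "smooth \<phi>"
    show "2 * E (\<lambda>x. lap \<phi> x + l\<^sup>2 * \<phi> x) =
       bj (b + hc TYPE('a)) (l * of_real s) * Gd (b + 1) s (lap \<phi>) + l\<^sup>2 * bj (b + hc TYPE('a) + 1) (l * of_real s) * Gd b s \<phi>"
      using divides_defect[OF E \<phi>] unfolding 1[OF \<phi>] by simp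
  next
    fix u :: 'a assume u: "u \<in> Basis"
    show "2 * E (wave (- l) u) = (bj (b + hc TYPE('a)) (l * of_real s))\<^sup>2 -
       bj (b + hc TYPE('a) - 1) (l * of_real s) * bj (b + hc TYPE('a) + 1) (l * of_real s)"
      using divides_defect_wave[OF E u] unfolding 2[OF u] by simp
  qed
qed

lemma EI_step:
  fixes \<phi> :: "'a::euclidean_space \<Rightarrow> complex"
  assumes "Re b > 1" "smooth \<phi>"
  shows "EI b l s \<phi> = bj (b + hc TYPE('a)) (l * of_real s) / 2 * Gd (b + 1) s \<phi> + (l * of_real s)\<^sup>2 / 4 * EI (b + 1) l s \<phi>"
  using EI_recurrence[OF assms, of l s] Gd_eq_GL[OF assms(2), of "b + 1" s] assms(1) by simp

lemma iterate_recurrence: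
  fixes Q :: "nat \<Rightarrow> 'a::comm_monoid_mult"
  assumes rec: "\<And>N. Q N = w * Q (Suc N)"
  shows "Q 0 = w ^ N * Q N"
proof (induction N)
  case (Suc N)
  have "Q 0 = w ^ N * (w * Q (Suc N))" unfolding rec[of N, symmetric] by (rule Suc.IH)
  then show ?case by (simp add: mult_ac)
qed simp

text \<open>By iteration the defect is w^N times the defect at order b + N. Every product in the
  latter contains an \<open>EI\<close> or a Bessel function whose order rises with N, and their
  decay beats w^N.\<close>

lemma divides_EI:
  assumes b: "Re b > 1"
  shows "divides (EI b l s :: ('a::euclidean_space \<Rightarrow> complex) \<Rightarrow> complex) b l s"
proof -
  define w where "w = (l * of_real s)\<^sup>2 / 4"
  define c where "c = b + hc TYPE('a)"
  define y where "y c = bj c (l * of_real s)" for c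
  have b': "Re (b + of_nat N) > 1" for N using b by simp
  have y_lim: "(\<lambda>N. x ^ N * y (c + k + of_nat N)) \<longlonglongrightarrow> 0" for x k
    unfolding y_def by (rule bj_shift_tendsto_0)
  have G_lim: "(\<lambda>N. 1 ^ N * Gd (b + of_nat k + of_nat N) s \<phi>) \<longlonglongrightarrow> 0" if "smooth \<phi>" for k and \<phi> :: "'a \<Rightarrow> complex"
  proof -
    have "(\<lambda>N. 1 ^ N * GL (b + of_nat k + of_nat N) s \<phi>) \<longlonglongrightarrow> 0"
      by (rule EI_shift_tendsto_0(2)[OF b' that])
    moreover have "Gd (b + of_nat k + of_nat N) s \<phi> = GL (b + of_nat k + of_nat N) s \<phi>" for N
      by (rule Gd_eq_GL[OF that]) (use b in simp)
    ultimately show ?thesis by simp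
  qed
  show ?thesis unfolding divides_def
  proof (intro conjI allI impI ballI)
    fix \<phi> :: "'a \<Rightarrow> complex" assume \<phi>: "smooth \<phi>"
    let ?P = "\<lambda>x. lap \<phi> x + l\<^sup>2 * \<phi> x"
    have P: "smooth ?P" by (intro smooth_add smooth_lap smooth_cmult \<phi>)
    define Q where "Q N = 2 * EI (b + of_nat N) l s ?P - (y (c + of_nat N) * Gd (b + 1 + of_nat N) s (lap \<phi>) + l\<^sup>2 * y (c + 1 + of_nat N) * Gd (b + of_nat N) s \<phi>)" for N
    have rec: "Q N = w * Q (Suc N)" for N
      using divides_defect[OF EI_step[OF b'[of N]] \<phi>, of l s] unfolding Q_def w_def y_def c_def by (simp add: add_ac)
    have Q: "Q 0 = w ^ N * Q N" for N by (rule iterate_recurrence[where Q = Q and w = w, OF rec])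
    have "(\<lambda>N. 2 * (w ^ N * EI (b + of_nat N) l s ?P) - ((w ^ N * y (c + 0 + of_nat N)) * (1 ^ N * Gd (b + of_nat 1 + of_nat N) s (lap \<phi>)) +
      l\<^sup>2 * (w ^ N * y (c + 1 + of_nat N)) * (1 ^ N * Gd (b + of_nat 0 + of_nat N) s \<phi>))) \<longlonglongrightarrow> 2 * 0 - (0 * 0 + l\<^sup>2 * 0 * 0)"
      by (intro tendsto_intros y_lim G_lim EI_shift_tendsto_0(1)[OF b] \<phi> P smooth_lap)
    moreover have "2 * (w ^ N * EI (b + of_nat N) l s ?P) - ((w ^ N * y (c + 0 + of_nat N)) * (1 ^ N * Gd (b + of_nat 1 + of_nat N) s (lap \<phi>)) +
      l\<^sup>2 * (w ^ N * y (c + 1 + of_nat N)) * (1 ^ N * Gd (b + of_nat 0 + of_nat N) s \<phi>)) = Q 0" for N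
      unfolding Q[of N] unfolding Q_def by (simp add: algebra_simps)
    ultimately have "(\<lambda>N::nat. Q 0) \<longlonglongrightarrow> 0" by simp
    then have "Q 0 = 0" using LIMSEQ_unique tendsto_const by blast
    then show "2 * EI b l s ?P = bj (b + hc TYPE('a)) (l * of_real s) * Gd (b + 1) s (lap \<phi>) + l\<^sup>2 * bj (b + hc TYPE('a) + 1) (l * of_real s) * Gd b s \<phi>"
      by (simp add: Q_def y_def c_def)
  next
    fix u :: 'a assume u: "u \<in> Basis"
    let ?P = "wave (- l) u"
    define Q where "Q N = 2 * EI (b + of_nat N) l s ?P - ((y (c + of_nat N))\<^sup>2 - y (c + of_nat N - 1) * y (c + 1 + of_nat N))" for N
    have rec: "Q N = w * Q (Suc N)" for N
      using divides_defect_wave[OF EI_step[OF b'[of N]] u, of l s] unfolding Q_def w_def y_def c_def by (simp add: add_ac add_diff_eq)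
    have Q: "Q 0 = w ^ N * Q N" for N by (rule iterate_recurrence[where Q = Q and w = w, OF rec])
    have "(\<lambda>N. 2 * (w ^ N * EI (b + of_nat N) l s ?P) - ((w ^ N * y (c + 0 + of_nat N)) * (1 ^ N * y (c + 0 + of_nat N)) -
      (w ^ N * y (c + (-1) + of_nat N)) * (1 ^ N * y (c + 1 + of_nat N)))) \<longlonglongrightarrow> 2 * 0 - (0 * 0 - 0 * 0)"
      by (intro tendsto_intros y_lim EI_shift_tendsto_0(1)[OF b] smooth_wave)
    moreover have "2 * (w ^ N * EI (b + of_nat N) l s ?P) - ((w ^ N * y (c + 0 + of_nat N)) * (1 ^ N * y (c + 0 + of_nat N)) -
      (w ^ N * y (c + (-1) + of_nat N)) * (1 ^ N * y (c + 1 + of_nat N))) = Q 0" for N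
      unfolding Q[of N] unfolding Q_def by (simp add: algebra_simps power2_eq_square)
    ultimately have "(\<lambda>N::nat. Q 0) \<longlonglongrightarrow> 0" by simp
    then have "Q 0 = 0" using LIMSEQ_unique tendsto_const by blast
    then show "2 * EI b l s ?P = (bj (b + hc TYPE('a)) (l * of_real s))\<^sup>2 - bj (b + hc TYPE('a) - 1) (l * of_real s) * bj (b + hc TYPE('a) + 1) (l * of_real s)"
      by (simp add: Q_def y_def c_def)
  qed
qed

lemma divides_EE: "Re b > 1 - real N \<Longrightarrow> divides (EE N b l s :: ('a::euclidean_space \<Rightarrow> complex) \<Rightarrow> complex) b l s"
proof (induction N arbitrary: b)
  case 0
  then have "divides (EI b l s :: ('a \<Rightarrow> complex) \<Rightarrow> complex) b l s" by (intro divides_EI) simp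
  then show ?case by (simp add: divides_def)
next
  case (Suc N)
  have "divides (EE N (b + 1) l s :: ('a \<Rightarrow> complex) \<Rightarrow> complex) (b + 1) l s" by (rule Suc.IH) (use Suc.prems in simp)
  then show ?case by (rule divides_step[rotated]) simp
qed

text \<open>The constants depend on f but not on the frequency, as long as l s stays in the strip.
  The factor (l s)^2 at each level of \<open>EE\<close> and the growth of the Bessel factor merely
  raise the exponent.\<close>

lemma EE_bound:
  fixes f :: "'a::euclidean_space \<Rightarrow> complex"
  assumes f: "smooth f" and Y: "Y \<ge> 0"
  shows "Re b > 1 - real N \<Longrightarrow> \<exists>C A. C > 0 \<and> (\<forall>l. \<bar>Im (l * of_real s)\<bar> \<le> Y \<longrightarrow> norm (EE N b l s f) \<le> C * (1 + norm (l * of_real s)) ^ A)"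
proof (induction N arbitrary: b)
  case 0
  then have b: "Re b > 1" by simp
  obtain B where B: "\<And>y. norm y \<le> \<bar>s\<bar> \<Longrightarrow> norm (f y) \<le> B" using bounded_on_ball[OF f] by blast
  obtain C A where CA: "C > 0" "\<And>z. \<bar>Im z\<bar> \<le> Y \<Longrightarrow> norm (bj (b + hc TYPE('a)) z) \<le> C * (1 + norm z) ^ A"
    using bj_strip_bound[OF Y] by metis
  define K where "K = norm (rGamma b) * (B * (Gamma (Re b) / Gamma (Re b + half_dim TYPE('a))))"
  have "norm (EE 0 b l s f) \<le> max 1 (C * K) * (1 + norm (l * of_real s)) ^ A" if l: "\<bar>Im (l * of_real s)\<bar> \<le> Y" for l
  proof -
    have "norm (EI b l s f) \<le> (C * (1 + norm (l * of_real s)) ^ A) * K"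
      unfolding K_def
    proof (rule EI_norm_le[OF b f B])
      fix \<sigma> :: real assume \<sigma>: "\<sigma> \<in> {0..1}"
      have e: "l * of_real (s * \<sigma>) = of_real \<sigma> * (l * of_real s)" by simp
      have "\<bar>Im (l * of_real (s * \<sigma>))\<bar> \<le> Y"
        unfolding e using \<sigma> l mult_mono[of \<sigma> 1 "\<bar>Im (l * of_real s)\<bar>" Y] by (simp add: abs_mult)
      then have "norm (bj (b + hc TYPE('a)) (l * of_real (s * \<sigma>))) \<le> C * (1 + norm (l * of_real (s * \<sigma>))) ^ A" by (rule CA)
      also have "\<dots> \<le> C * (1 + norm (l * of_real s)) ^ A"
        unfolding e norm_mult using \<sigma> CA(1)
        by (intro mult_left_mono power_mono add_left_mono) (auto simp: mult_left_le_one_le)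
      finally show "norm (bj (b + hc TYPE('a)) (l * of_real (s * \<sigma>))) \<le> C * (1 + norm (l * of_real s)) ^ A" .
    qed
    also have "\<dots> = (C * K) * (1 + norm (l * of_real s)) ^ A" by simp
    also have "\<dots> \<le> max 1 (C * K) * (1 + norm (l * of_real s)) ^ A" by (intro mult_right_mono) auto
    finally show ?thesis by simp
  qed
  then show ?case by (intro exI[of _ "max 1 (C * K)"] exI[of _ A]) auto
next
  case (Suc N)
  obtain C1 A1 where 1: "C1 > 0" "\<And>l. \<bar>Im (l * of_real s)\<bar> \<le> Y \<Longrightarrow> norm (EE N (b + 1) l s f) \<le> C1 * (1 + norm (l * of_real s)) ^ A1"
    using Suc.IH[of "b + 1"] Suc.prems by auto
  obtain C2 A2 where 2: "C2 > 0" "\<And>z. \<bar>Im z\<bar> \<le> Y \<Longrightarrow> norm (bj (b + hc TYPE('a)) z) \<le> C2 * (1 + norm z) ^ A2"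
    using bj_strip_bound[OF Y] by metis
  define g where "g = norm (Gd (b + 1) s f)"
  have g: "g \<ge> 0" by (simp add: g_def)
  have "norm (EE (Suc N) b l s f) \<le> (C2 * g + C1) * (1 + norm (l * of_real s)) ^ (A1 + A2 + 2)" if l: "\<bar>Im (l * of_real s)\<bar> \<le> Y" for l
  proof -
    let ?z = "l * of_real s"
    have p1: "(1 + norm ?z) ^ A2 \<le> (1 + norm ?z) ^ (A1 + A2 + 2)" by (intro power_increasing) auto
    have p2: "(1 + norm ?z) ^ (A1 + 2) \<le> (1 + norm ?z) ^ (A1 + A2 + 2)" by (intro power_increasing) auto
    have "norm (EE (Suc N) b l s f) \<le> norm (bj (b + hc TYPE('a)) ?z / 2 * Gd (b + 1) s f) + norm (?z\<^sup>2 / 4 * EE N (b + 1) l s f)"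
      by (simp only: EE.simps) (rule norm_triangle_ineq)
    also have "\<dots> = norm (bj (b + hc TYPE('a)) ?z) / 2 * g + (norm ?z)\<^sup>2 / 4 * norm (EE N (b + 1) l s f)"
      by (simp only: norm_mult norm_divide norm_power norm_numeral g_def)
    also have "\<dots> \<le> (C2 * (1 + norm ?z) ^ A2) * g + (1 + norm ?z)\<^sup>2 * (C1 * (1 + norm ?z) ^ A1)"
    proof (intro add_mono mult_mono 1 l)
      show "norm (bj (b + hc TYPE('a)) ?z) / 2 \<le> C2 * (1 + norm ?z) ^ A2"
        using 2(2)[OF l] norm_ge_zero[of "bj (b + hc TYPE('a)) ?z"] by linarith
      have "(norm ?z)\<^sup>2 \<le> (1 + norm ?z)\<^sup>2" by (intro power_mono) auto
      then show "(norm ?z)\<^sup>2 / 4 \<le> (1 + norm ?z)\<^sup>2" using zero_le_power2[of "norm ?z"] by linarith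
    qed (use g 2(1) in auto)
    also have "\<dots> = (C2 * g) * (1 + norm ?z) ^ A2 + C1 * (1 + norm ?z) ^ (A1 + 2)"
      by (simp add: power_add power2_eq_square mult_ac)
    also have "\<dots> \<le> (C2 * g) * (1 + norm ?z) ^ (A1 + A2 + 2) + C1 * (1 + norm ?z) ^ (A1 + A2 + 2)"
      using 1 2 g by (intro add_mono mult_left_mono p1 p2) auto
    finally show ?thesis by (simp only: distrib_right)
  qed
  moreover have "C2 * g + C1 > 0" using 1 2 g by (simp add: add_nonneg_pos)
  ultimately show ?case by blast
qed

text \<open>On the wave of frequency m the operator \<Delta> + l^2 is multiplication by l^2 - m^2,
  which is nonzero, while \<open>Gd b s\<close> vanishes on that wave. This lets \<open>E\<close>
  select a single frequency from a series.\<close>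

lemma divides_wave_other:
  fixes E :: "('a::euclidean_space \<Rightarrow> complex) \<Rightarrow> complex"
  assumes E: "nice E" "divides E b l s" and u: "u \<in> Basis"
    and zl: "bj (b + hc TYPE('a)) (l * of_real s) = 0" and zm: "bj (b + hc TYPE('a)) (m * of_real s) = 0" and ne: "m\<^sup>2 \<noteq> l\<^sup>2"
  shows "E (wave (- m) u) = 0"
proof -
  have "(\<lambda>x. lap (wave (- m) u) x + l\<^sup>2 * wave (- m) u x) = (\<lambda>x. (l\<^sup>2 - m\<^sup>2) * wave (- m) u x)"
    using lap_wave[OF u, of "- m"] by (simp add: algebra_simps)
  then have "2 * E (\<lambda>x. (l\<^sup>2 - m\<^sup>2) * wave (- m) u x) = 0"
    using E(2) smooth_wave[of "- m" u] Gd_wave[OF u, of b s "- m"] zl zm unfolding divides_def by fastforce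
  then show ?thesis using nice_cmult[OF E(1) smooth_wave, of "l\<^sup>2 - m\<^sup>2" "- m" u] ne by auto
qed

text \<open>At a zero the recurrence one order lower turns \<open>bj (c - 1)\<close> into - (l s)^2
  / 4 times \<open>bj (c + 1)\<close>, so Lommel's value becomes a square; it is nonzero when l s
  is, since the zeros are simple.\<close>

lemma divides_wave_same:
  fixes E :: "('a::euclidean_space \<Rightarrow> complex) \<Rightarrow> complex"
  assumes E: "divides E b l s" and u: "u \<in> Basis" and z: "bj (b + hc TYPE('a)) (l * of_real s) = 0"
  shows "E (wave (- l) u) = (l * of_real s)\<^sup>2 / 8 * (bj (b + hc TYPE('a) + 1) (l * of_real s))\<^sup>2"
proof -
  have "2 * E (wave (- l) u) = - (bj (b + hc TYPE('a) - 1) (l * of_real s) * bj (b + hc TYPE('a) + 1) (l * of_real s))"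
    using E u z by (simp add: divides_def)
  also have "bj (b + hc TYPE('a) - 1) (l * of_real s) = - ((l * of_real s)\<^sup>2 / 4) * bj (b + hc TYPE('a) + 1) (l * of_real s)"
  proof -
    have e: "b + hc TYPE('a) - 1 + 1 = b + hc TYPE('a)" "b + hc TYPE('a) - 1 + 2 = b + hc TYPE('a) + 1" by simp_all
    show ?thesis using bj_rec[of "b + hc TYPE('a) - 1" "l * of_real s"] z unfolding e by simp
  qed
  finally show ?thesis by (simp add: power2_eq_square mult_ac)
qed

text \<open>If \<open>f * Gd b s = 0\<close>, then \<open>f * E\<close> is an eigenfunction of the Laplacian, on which \<open>Gd b r\<close> acts as a scalar.\<close>

lemma divides_commute:
  fixes E :: "('a::euclidean_space \<Rightarrow> complex) \<Rightarrow> complex"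
  assumes E: "nice E" "divides E b l s" and f: "smooth f" and f0: "cv f (Gd b s) = (\<lambda>x. 0)"
    and z: "bj (b + hc TYPE('a)) (l * of_real s) = 0"
  shows "bj (b + hc TYPE('a)) (l * of_real r) * cv f E 0 = cv (cv f (Gd b r)) E 0"
proof -
  define F where "F = cv f E"
  have F: "smooth F" "lap F = cv (lap f) E" unfolding F_def using nice_cv[OF E(1) f] by auto
  have "lap F x + l\<^sup>2 * F x = 0" for x
  proof -
    let ?\<phi> = "\<lambda>y. f (x - y)"
    have s: "smooth ?\<phi>" by (rule smooth_reflect[OF f])
    have "lap F x = E (lap ?\<phi>)" "F x = E ?\<phi>"
      unfolding F(2) lap_reflect[OF f] by (simp_all add: F_def cv_def)
    then have "lap F x + l\<^sup>2 * F x = E (\<lambda>y. lap ?\<phi> y + l\<^sup>2 * ?\<phi> y)"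
      by (simp only: nice_add[OF E(1) smooth_lap[OF s] smooth_cmult[OF s]] nice_cmult[OF E(1) s])
    moreover have "2 * E (\<lambda>y. lap ?\<phi> y + l\<^sup>2 * ?\<phi> y) = l\<^sup>2 * bj (b + hc TYPE('a) + 1) (l * of_real s) * Gd b s ?\<phi>"
      using E(2) s z by (simp add: divides_def)
    moreover have "Gd b s ?\<phi> = 0" using fun_cong[OF f0, of x] by (simp add: cv_def)
    ultimately show ?thesis by simp
  qed
  then have lF: "lap F = (\<lambda>x. - (l\<^sup>2) * F x)" by (simp add: fun_eq_iff eq_neg_iff_add_eq_0)
  have r: "smooth (\<lambda>y. F (0 - y))" "lap (\<lambda>y. F (0 - y)) = (\<lambda>y. - (l\<^sup>2) * F (0 - y))"
    using smooth_reflect[OF F(1), of 0] lap_reflect[OF F(1), of 0] lF by auto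
  have "cv F (Gd b r) 0 = bj (b + hc TYPE('a)) (l * of_real r) * F 0"
    unfolding cv_def using Gd_eigenfunction[OF r, of b r] by simp
  moreover have "cv F (Gd b r) = cv (cv f (Gd b r)) E"
    unfolding F_def by (rule nice_commute[OF E(1) nice_Gd f])
  ultimately show ?thesis by (simp add: F_def)
qed

section \<open>The two obstructions\<close>

text \<open>Were \<open>bj c\<close> constant, its derivative would make \<open>bj (c + 1)\<close>
  vanish off the origin, hence also \<open>bj (c + 2)\<close> at 1, against
  \<open>bj_not_both_zero\<close>.\<close>

lemma finite_bj_zeros: "finite {b \<in> cball 0 R. bj c b = 0}"
proof (rule holomorphic_compact_finite_zeros[OF bj_holomorphic open_UNIV connected_UNIV])
  show "\<not> bj c constant_on UNIV"
  proof
    assume "bj c constant_on UNIV"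
    then obtain k where k: "\<And>z. bj c z = k" by (auto simp: constant_on_def)
    have d: "- (z / 2) * bj (c + 1) z = 0" for z
    proof -
      have "bj c = (\<lambda>_. k)" using k by (rule ext)
      then have "(bj c has_field_derivative 0) (at z)" by simp
      then show ?thesis by (rule DERIV_unique[OF bj_has_field_derivative])
    qed
    have z: "bj (c + 1) z = 0" if "z \<noteq> 0" for z using d[of z] that by simp
    have "- (1 / 2) * bj (c + 1 + 1) 1 = (0::complex)"
    proof -
      have "((\<lambda>_. 0) has_field_derivative - (1 / 2) * bj (c + 1 + 1) 1) (at (1::complex))"
        by (rule has_field_derivative_transform_within_open[OF bj_has_field_derivative[of "c + 1" 1], of "- {0}"]) (use z in auto)
      then show ?thesis using DERIV_unique[OF _ DERIV_const] by blast
    qed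
    then show False using bj_not_both_zero[of 1 "c + 1"] z[of 1] by simp
  qed
qed auto

lemma j_rationalI: "z \<noteq> 0 \<Longrightarrow> bj (\<nu> + 1) a = 0 \<Longrightarrow> bj (\<nu> + 1) b = 0 \<Longrightarrow> b \<noteq> 0 \<Longrightarrow> z = a / b \<Longrightarrow> j_rational \<nu> z"
  unfolding j_rational_def bessel_j_eq_bj by blast

text \<open>The Liouville property gives norm b > 1 but no growth of b. Zeros of bounded modulus
  leave only finitely many quotients a / b near x, none equal to x, so their distance to x has a
  positive minimum \<delta>; as norm b >= q > 1, a large exponent forces the approximation below
  \<delta>.\<close>

lemma Liouville_large_zeros:
  assumes x: "x > 0" and nr: "\<not> j_rational \<nu> (of_real x)"
    and L: "\<And>N::nat. \<exists>a b. bj (\<nu> + 1) a = 0 \<and> bj (\<nu> + 1) b = 0 \<and> norm b > 1 \<and> norm (of_real x - a / b) < 1 / norm b ^ N"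
  shows "\<exists>a b. bj (\<nu> + 1) a = 0 \<and> bj (\<nu> + 1) b = 0 \<and> norm b > R \<and> norm b > 1 \<and> norm (of_real x - a / b) < 1 / norm b ^ N"
proof (rule ccontr)
  assume no: "\<not> ?thesis"
  define c where "c = \<nu> + 1"
  define S where "S = {b \<in> cball 0 R. bj c b = 0} \<inter> {b. norm b > 1}"
  define A where "A = {a \<in> cball 0 (R * (x + 1)). bj c a = 0}"
  have fS: "finite S" "finite A" unfolding S_def A_def using finite_bj_zeros by auto
  \<comment> \<open>The inserted 1, and the 2 in \<open>q\<close>, keep both minima defined and in
    range when there are no such zeros.\<close>
  define D where "D = insert 1 ((\<lambda>(a, b). norm (of_real x - a / b)) ` (A \<times> S))"
  define q where "q = Min (insert 2 (norm ` S))"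
  have fD: "finite D" using fS by (simp add: D_def)
  have Dpos: "d > 0" if "d \<in> D" for d
  proof -
    have "norm (of_real x - a / b) > 0" if "a \<in> A" "b \<in> S" for a b
    proof -
      have b0: "b \<noteq> 0" using that by (auto simp: S_def)
      have "of_real x \<noteq> a / b"
      proof
        assume "complex_of_real x = a / b"
        then have "j_rational \<nu> (of_real x)"
          using that b0 x by (intro j_rationalI[of _ _ a b]) (auto simp: A_def S_def c_def)
        then show False using nr by simp
      qed
      then show ?thesis by simp
    qed
    then show ?thesis using that by (auto simp: D_def)
  qed
  define \<delta> where "\<delta> = Min D"
  have \<delta>: "\<delta> > 0" unfolding \<delta>_def using fD Dpos by (subst Min_gr_iff) (auto simp: D_def)
  have q: "q > 1" unfolding q_def using fS by (subst Min_gr_iff) (auto simp: S_def)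
  obtain n where n: "(1 / q) ^ n < \<delta>" using real_arch_pow_inv[OF \<delta>, of "1 / q"] q by auto
  define M where "M = max n N"
  obtain a b where ab: "bj c a = 0" "bj c b = 0" "norm b > 1" "norm (of_real x - a / b) < 1 / norm b ^ M"
    using L[of M] unfolding c_def by blast
  have mono: "1 / norm b ^ M \<le> 1 / norm b ^ k" if "k \<le> M" for k
  proof -
    have "norm b ^ k \<le> norm b ^ M" using ab that by (intro power_increasing) auto
    moreover have "norm b ^ k > 0" using ab(3) by (intro zero_less_power) linarith
    ultimately show ?thesis by (intro divide_left_mono mult_pos_pos) auto
  qed
  have bR: "norm b \<le> R"
  proof (rule ccontr)
    assume "\<not> norm b \<le> R"
    moreover have "norm (of_real x - a / b) < 1 / norm b ^ N" using ab(4) mono[of N] by (simp add: M_def)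
    ultimately show False using no ab unfolding c_def by (meson not_le)
  qed
  have bS: "b \<in> S" using ab bR by (simp add: S_def)
  have "norm (of_real x - a / b) < 1" using ab(4) mono[of 0] by simp
  then have "norm (a / b) \<le> x + 1"
    using norm_triangle_ineq2[of "a / b" "of_real x"] x by (simp add: norm_minus_commute)
  moreover have "b \<noteq> 0" using ab(3) by auto
  then have "norm (a / b) * norm b = norm a" by (simp add: norm_divide)
  ultimately have "norm a \<le> (x + 1) * norm b" by (metis mult_right_mono norm_ge_zero)
  also have "\<dots> \<le> (x + 1) * R" using bR x by (intro mult_left_mono) auto
  finally have aA: "a \<in> A" using ab by (simp add: A_def mult.commute)
  have "\<delta> \<le> norm (of_real x - a / b)"
    unfolding \<delta>_def using fD aA bS by (intro Min_le) (auto simp: D_def)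
  also have "\<dots> < 1 / norm b ^ n" using ab(4) mono[of n] by (simp add: M_def)
  also have "\<dots> \<le> 1 / q ^ n"
  proof -
    have "q \<le> norm b" unfolding q_def using fS bS by (intro Min_le) auto
    then have "q ^ n \<le> norm b ^ n" using q by (intro power_mono) auto
    moreover have "q ^ n > 0" using q by simp
    ultimately show ?thesis by (intro divide_left_mono mult_pos_pos) auto
  qed
  also have "\<dots> < \<delta>" using n by (simp add: power_one_over)
  finally show False .
qed

text \<open>The point x b is so close to the zero a that the mean value inequality applies on a
  segment of length at most 1, inside the strip of half-width Y + 1, where the derivative is
  polynomially bounded.\<close>

lemma Liouville_small_values:
  assumes x: "x > 0" and nr: "\<not> j_rational \<nu> (of_real x)"
    and L: "\<And>N::nat. \<exists>a b. bj (\<nu> + 1) a = 0 \<and> bj (\<nu> + 1) b = 0 \<and> norm b > 1 \<and> norm (of_real x - a / b) < 1 / norm b ^ N"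
    and Y: "Y > 0" "\<And>z. bj (\<nu> + 1) z = 0 \<Longrightarrow> \<bar>Im z\<bar> \<le> Y"
  shows "\<exists>b. bj (\<nu> + 1) b = 0 \<and> norm b > R \<and> norm (bj (\<nu> + 1) (of_real x * b)) * norm b ^ K \<le> 1"
proof -
  define c where "c = \<nu> + 1"
  obtain C A where CA: "C > 0" "\<And>z. \<bar>Im z\<bar> \<le> Y + 1 \<Longrightarrow> norm (bj (c + 1) z) \<le> C * (1 + norm z) ^ A"
    using bj_strip_bound[of "Y + 1" "c + 1"] Y by auto
  define C' where "C' = C * (2 + x) ^ Suc A"
  \<comment> \<open>Of the exponent N one power is lost in passing from x - a / b to x b - a, A + 1
    to the derivative, and one to the constant \<open>C'\<close> < norm b; K powers remain.\<close>
  define N where "N = A + K + 3"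
  obtain a b where ab: "bj c a = 0" "bj c b = 0" "norm b > max R C'" "norm b > 1" "norm (of_real x - a / b) < 1 / norm b ^ N"
    using Liouville_large_zeros[OF x nr L, of "max R C'" N] unfolding c_def by blast
  define m where "m = norm b"
  have m: "m > 1" "m > R" "m > C'" using ab by (auto simp: m_def)
  have b0: "b \<noteq> 0" using ab(4) by auto
  have dist: "norm (of_real x * b - a) \<le> 1 / m ^ (A + K + 2)"
  proof -
    have "norm (of_real x * b - a) = norm (of_real x - a / b) * m"
      using b0 by (simp add: m_def norm_mult[symmetric] left_diff_distrib)
    also have "\<dots> \<le> 1 / m ^ N * m" using ab(5) m by (intro mult_right_mono) (auto simp: m_def)
    also have "\<dots> = 1 / m ^ (A + K + 2)" using m by (simp add: N_def numeral_3_eq_3)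
    finally show ?thesis .
  qed
  also have "1 / m ^ (A + K + 2) \<le> 1" using one_le_power[of m "A + K + 2"] m by (simp only: divide_le_eq_1) simp
  finally have dist1: "norm (of_real x * b - a) \<le> 1" .
  have "norm (bj c (of_real x * b) - bj c a) \<le> (C * (m * (2 + x)) ^ Suc A) * norm (of_real x * b - a)"
  proof (rule field_differentiable_bound[where S = "closed_segment (of_real x * b) a" and f' = "\<lambda>z. - (z / 2) * bj (c + 1) z"])
    show "(bj c has_field_derivative - (z / 2) * bj (c + 1) z) (at z within closed_segment (of_real x * b) a)" for z
      by (rule has_field_derivative_at_within[OF bj_has_field_derivative])
    fix z assume z: "z \<in> closed_segment (of_real x * b) a"
    have za: "norm (z - a) \<le> 1" and zb: "norm (z - of_real x * b) \<le> 1"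
      using segment_bound[OF z] dist1 by (auto simp: norm_minus_commute)
    have "\<bar>Im z\<bar> \<le> \<bar>Im a\<bar> + \<bar>Im (z - a)\<bar>" by simp
    also have "\<dots> \<le> Y + 1" using Y(2)[of a] ab(1) za abs_Im_le_cmod[of "z - a"] by (simp add: c_def)
    finally have I: "\<bar>Im z\<bar> \<le> Y + 1" .
    have "norm z \<le> norm (of_real x * b) + norm (z - of_real x * b)" using norm_triangle_sub by blast
    then have "1 + norm z \<le> 2 + x * m" using zb x by (simp add: norm_mult m_def)
    also have "\<dots> \<le> m * (2 + x)" using m by (simp add: algebra_simps)
    finally have nz: "1 + norm z \<le> m * (2 + x)" .
    have "norm (- (z / 2) * bj (c + 1) z) = norm z / 2 * norm (bj (c + 1) z)" by (simp add: norm_mult norm_divide)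
    also have "\<dots> \<le> (1 + norm z) * (C * (1 + norm z) ^ A)"
      by (intro mult_mono CA I) auto
    also have "\<dots> = C * (1 + norm z) ^ Suc A" by simp
    also have "\<dots> \<le> C * (m * (2 + x)) ^ Suc A" using CA(1) nz by (intro mult_left_mono power_mono) auto
    finally show "norm (- (z / 2) * bj (c + 1) z) \<le> C * (m * (2 + x)) ^ Suc A" .
  qed auto
  also have "C * (m * (2 + x)) ^ Suc A = C' * m ^ Suc A" by (simp add: C'_def power_mult_distrib mult_ac)
  finally have "norm (bj c (of_real x * b)) \<le> C' * m ^ Suc A * norm (of_real x * b - a)" using ab(1) by simp
  also have "\<dots> \<le> m * m ^ Suc A * (1 / m ^ (A + K + 2))"
    using m x CA(1) by (intro mult_mono dist) (auto simp: C'_def)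
  also have "\<dots> = 1 / m ^ K" using m by (simp add: power_add power2_eq_square)
  finally have "norm (bj c (of_real x * b)) * m ^ K \<le> 1" using m by (simp add: pos_le_divide_eq)
  then show ?thesis using ab m unfolding c_def m_def by blast
qed

text \<open>The exponent 2 k is spent in two halves, one on the weight norm (b k) ^ k and one on the
  rapid decay of the weighted coefficients. The squares have to differ because l and - l give the
  same eigenvalue; strictly increasing moduli ensure this.\<close>

lemma Liouville_sequence:
  assumes x: "x > 0" and nr: "\<not> j_rational \<nu> (of_real x)"
    and L: "\<And>N::nat. \<exists>a b. bj (\<nu> + 1) a = 0 \<and> bj (\<nu> + 1) b = 0 \<and> norm b > 1 \<and> norm (of_real x - a / b) < 1 / norm b ^ N"
    and Y: "Y > 0" "\<And>z. bj (\<nu> + 1) z = 0 \<Longrightarrow> \<bar>Im z\<bar> \<le> Y"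
  obtains b :: "nat \<Rightarrow> complex" where "\<And>k. bj (\<nu> + 1) (b k) = 0" "\<And>k. norm (b k) > R"
    "\<And>k. norm (bj (\<nu> + 1) (of_real x * b k)) * norm (b k) ^ (2 * k) \<le> 1" "\<And>j k. (b j)\<^sup>2 = (b k)\<^sup>2 \<Longrightarrow> j = k"
proof -
  let ?P = "\<lambda>k b. bj (\<nu> + 1) b = 0 \<and> norm b > R \<and> norm (bj (\<nu> + 1) (of_real x * b)) * norm b ^ (2 * k) \<le> 1"
  have "\<exists>f. \<forall>n. ?P n (f n) \<and> norm (f n) < norm (f (Suc n))"
  proof (rule dependent_nat_choice)
    show "\<exists>b. ?P 0 b" using Liouville_small_values[OF x nr L Y, of R "2 * 0"] by blast
    fix b :: complex and n assume "?P n b"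
    show "\<exists>b'. ?P (Suc n) b' \<and> norm b < norm b'"
      using Liouville_small_values[OF x nr L Y, of "max R (norm b)" "2 * Suc n"] by auto
  qed
  then obtain f where f: "\<And>n. ?P n (f n)" "\<And>n. norm (f n) < norm (f (Suc n))" by blast
  have "strict_mono (\<lambda>n. norm (f n))" using f(2) by (simp add: strict_mono_Suc_iff)
  then have inj: "norm (f j) = norm (f k) \<Longrightarrow> j = k" for j k using strict_mono_eq by blast
  have "j = k" if "(f j)\<^sup>2 = (f k)\<^sup>2" for j k
    using that inj[of j k] by (auto simp: power2_eq_iff)
  then show ?thesis using f that by blast
qed

lemma exponential_beats_constant:
  fixes \<epsilon> M :: real
  assumes \<epsilon>: "\<epsilon> > 0" and le: "\<And>k::nat. \<exists>m\<ge>2. \<epsilon> * m ^ k \<le> M * m ^ A"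
  shows False
proof -
  \<comment> \<open>Nothing but m >= 2 is known about m, which may vary with k; so j is fixed first
    and k = A + j is taken afterwards.\<close>
  obtain j where j: "M / \<epsilon> < 2 ^ j" using real_arch_pow[of 2 "M / \<epsilon>"] by auto
  obtain m :: real where m: "m \<ge> 2" "\<epsilon> * m ^ (A + j) \<le> M * m ^ A" using le by blast
  have mA: "m ^ A > 0" using m by simp
  have "(\<epsilon> * m ^ j) * m ^ A \<le> M * m ^ A" using m(2) by (simp add: power_add mult_ac)
  then have "\<epsilon> * m ^ j \<le> M" using mA by simp
  moreover have "\<epsilon> * 2 ^ j \<le> \<epsilon> * m ^ j" using m(1) \<epsilon> by (intro mult_left_mono power_mono) auto
  moreover have "M < \<epsilon> * 2 ^ j" using j \<epsilon> by (simp add: pos_divide_less_eq mult.commute)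
  ultimately show False by simp
qed

lemma obtain_divides:
  obtains N where "\<And>l s. nice (EE N b l s :: ('a::euclidean_space \<Rightarrow> complex) \<Rightarrow> complex)"
    "\<And>l s. divides (EE N b l s :: ('a \<Rightarrow> complex) \<Rightarrow> complex) b l s" "Re b > 1 - real N"
proof -
  obtain N :: nat where "real N > 1 - Re b" using reals_Archimedean2 by blast
  then have "Re b > 1 - real N" by simp
  then show ?thesis using nice_EE divides_EE that by blast
qed

text \<open>\<open>divides_commute\<close> is applied with E belonging to the radius r, where the
  convolution of f vanishes. As l s is also a zero, the wave convolved with E would be 0 at the
  origin, yet its value there is the nonzero one of \<open>divides_wave_same\<close>.\<close>

lemma common_frequency_obstruction:
  fixes r s :: real
  assumes r: "r > 0" and s: "s > 0"
    and ab: "bj (b + hc TYPE('a::euclidean_space)) (l * of_real r) = 0" "bj (b + hc TYPE('a)) (l * of_real s) = 0" and l: "l \<noteq> 0"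
    and u: "u \<in> Basis" and f: "smooth (f :: 'a \<Rightarrow> complex)"
    and K: "K \<noteq> 0" and fs: "\<And>x. wave l u x = K * cv f (Gd b s) x" and fr: "\<And>x. 0 = K * cv f (Gd b r) x"
  shows False
proof -
  obtain N where N: "\<And>l s. nice (EE N b l s :: ('a \<Rightarrow> complex) \<Rightarrow> complex)"
    "\<And>l s. divides (EE N b l s :: ('a \<Rightarrow> complex) \<Rightarrow> complex) b l s" using obtain_divides by metis
  let ?E = "EE N b l r :: ('a \<Rightarrow> complex) \<Rightarrow> complex"
  have f0: "cv f (Gd b r) = (\<lambda>x. 0)" using fr K by auto
  have "cv f (Gd b s) = (\<lambda>x. (1 / K) * wave l u x)" using fs K by (simp add: fun_eq_iff)
  then have "cv (cv f (Gd b s)) ?E 0 = ?E (\<lambda>y. (1 / K) * wave (- l) u y)"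
    by (simp add: cv_def wave_def inner_diff_left)
  also have "\<dots> = (1 / K) * ?E (wave (- l) u)" by (rule nice_cmult[OF N(1) smooth_wave])
  finally have "(1 / K) * ?E (wave (- l) u) = 0"
    using divides_commute[OF N(1) N(2) f f0 ab(1), of s] ab(2) by simp
  moreover have "l * of_real r \<noteq> 0" using l r by simp
  ultimately show False
    using K divides_wave_same[OF N(2) u ab(1)] bj_not_both_zero[OF _ ab(1)] by simp
qed

theorem theorem6p5:
  fixes \<alpha> \<nu> :: complex and r s :: real
  assumes "CARD('n::finite) \<ge> 2"
    and "\<alpha> \<notin> exceptional_set CARD('n)"
    and "\<nu> = \<alpha> + (of_nat CARD('n) - 2) / 2"
    and "r > 0" and "s > 0" and "r \<noteq> s"
    and "j_rational \<nu> (of_real (r / s)) \<or> j_Liouville \<nu> (of_real (r / s))"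
  shows "\<exists>g h :: real ^ 'n \<Rightarrow> complex.
           g \<in> smooth_functions \<and> h \<in> smooth_functions \<and>
           convolve g (m_dist \<alpha> r) = convolve h (m_dist \<alpha> s) \<and>
           \<not> (\<exists>f \<in> smooth_functions.
                 g = convolve f (m_dist \<alpha> s) \<and> h = convolve f (m_dist \<alpha> r))"
proof -
  note \<alpha> = assms(2) and r = assms(4) and s = assms(5)
  define c where "c = \<nu> + 1"
  define K where "K = Gamma (\<alpha> + of_nat CARD('n) / 2)"
  have c: "\<alpha> + hc TYPE(real ^ 'n) = c" by (simp add: c_def hc_def half_dim_def assms(3) field_simps)
  have K: "K \<noteq> 0" using \<alpha> by (simp add: K_def Gamma_eq_zero_iff exceptional_set_iff)
  obtain u :: "real ^ 'n" where u: "u \<in> Basis" using nonempty_Basis by blast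
  have u1: "norm u \<le> 1" using u by simp
  have cvm: "convolve f (m_dist \<alpha> t) = (\<lambda>x. K * cv f (Gd \<alpha> t) x)" if "t > 0" "smooth f" for t and f :: "real ^ 'n \<Rightarrow> complex"
    unfolding K_def by (rule convolve_m_dist[OF \<alpha> that])
  have cv0: "cv (\<lambda>x. 0) (Gd \<alpha> t) x = 0" for t and x :: "real ^ 'n"
    using nice_cmult[OF nice_Gd smooth_const, of \<alpha> t 0 0] by (simp add: cv_def)
  have wave_refl: "(\<lambda>y. wave l u (x - y)) = (\<lambda>y. wave l u x * wave (- l) u y)" for l and x :: "real ^ 'n"
    by (rule ext) (simp add: wave_def inner_diff_left algebra_simps flip: exp_add)
  have cv_wave: "cv (wave l u) (Gd \<alpha> t) x = wave l u x * bj c (l * of_real t)" for l t x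
    unfolding cv_def wave_refl by (simp add: nice_cmult[OF nice_Gd smooth_wave] Gd_wave[OF u] c)
  show ?thesis using assms(7)
  proof
    assume "j_rational \<nu> (of_real (r / s))"
    then obtain a b where ab: "bj c a = 0" "bj c b = 0" "b \<noteq> 0" "of_real (r / s) = a / b"
      unfolding j_rational_def bessel_j_eq_bj c_def by blast
    define l where "l = b / of_real s"
    have l: "l \<noteq> 0" "l * of_real s = b" "l * of_real r = a" using ab s by (auto simp: l_def field_simps)
    show ?thesis
    proof (intro exI conjI notI)
      show "wave l u \<in> smooth_functions" "(\<lambda>x. 0) \<in> smooth_functions" by (simp_all add: smooth_functions_iff)
      show "convolve (wave l u) (m_dist \<alpha> r) = convolve (\<lambda>x. 0) (m_dist \<alpha> s)"
        by (simp add: cvm r s cv_wave l ab cv0)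
      assume "\<exists>f\<in>smooth_functions. wave l u = convolve f (m_dist \<alpha> s) \<and> (\<lambda>x. 0) = convolve f (m_dist \<alpha> r)"
      then obtain f where f: "smooth f" "wave l u = (\<lambda>x. K * cv f (Gd \<alpha> s) x)" "(\<lambda>x. 0) = (\<lambda>x. K * cv f (Gd \<alpha> r) x)"
        by (auto simp: smooth_functions_iff cvm r s)
      show False
        by (rule common_frequency_obstruction[OF r s _ _ l(1) u f(1) K fun_cong[OF f(2)] fun_cong[OF f(3)]]) (simp_all add: c l ab)
    qed
  next
    assume "j_Liouville \<nu> (of_real (r / s))"
    then have nr: "\<not> j_rational \<nu> (of_real (r / s))"
      and L: "\<And>N::nat. \<exists>a b. bj (\<nu> + 1) a = 0 \<and> bj (\<nu> + 1) b = 0 \<and> norm b > 1 \<and> norm (of_real (r / s) - a / b) < 1 / norm b ^ N"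
      unfolding j_Liouville_def bessel_j_eq_bj by blast+
    have x: "r / s > 0" using r s by simp
    obtain Y where Y: "Y > 0" "\<And>z. bj c z = 0 \<Longrightarrow> \<bar>Im z\<bar> \<le> Y"
      using bj_zeros_in_strip[of c] bj_ratio_all[of c] unfolding bj_ratio_def by blast
    obtain \<delta> A0 where \<delta>: "\<delta> > 0"
      "\<And>z. bj c z = 0 \<Longrightarrow> \<bar>Im z\<bar> \<le> Y \<Longrightarrow> \<bar>Re z\<bar> \<ge> 1 \<Longrightarrow> \<delta> \<le> norm z ^ A0 * norm (bj (c + 1) z)"
      using bj_zero_derivative_lower[OF Y(1), of c] by metis
    \<comment> \<open>The bound Y + 2 serves twice: with imaginary parts at most Y it makes the real
      parts at least 1 in modulus, as the lower bound for \<open>bj (c + 1)\<close> requires, and it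
      makes every modulus at least 2.\<close>
    obtain b :: "nat \<Rightarrow> complex" where b: "\<And>k. bj c (b k) = 0" "\<And>k. norm (b k) > Y + 2"
      "\<And>k. norm (bj c (of_real (r / s) * b k)) * norm (b k) ^ (2 * k) \<le> 1" "\<And>j k. (b j)\<^sup>2 = (b k)\<^sup>2 \<Longrightarrow> j = k"
      using Liouville_sequence[OF x nr L Y(1), of "Y + 2"] Y(2) unfolding c_def by metis
    define m where "m k = norm (b k)" for k
    have m: "m k \<ge> 2" "m k > 0" for k using b(2)[of k] Y(1) by (auto simp: m_def)
    define l where "l k = b k / of_real s" for k
    have ls: "l k * of_real s = b k" and lr: "l k * of_real r = of_real (r / s) * b k" for k
      using s by (auto simp: l_def)
    define y where "y k = bj c (l k * of_real r)" for k
    have y0: "y k \<noteq> 0" for k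
    proof
      assume "y k = 0"
      moreover have "b k \<noteq> 0" using m[of k] by (auto simp: m_def)
      ultimately have "j_rational \<nu> (of_real (r / s))"
        using b(1)[of k] x by (intro j_rationalI[of _ _ "of_real (r / s) * b k" "b k"]) (auto simp: y_def lr c_def)
      then show False using nr by simp
    qed
    \<comment> \<open>The factor \<open>y k\<close> is the one that cancels against the scalar of
      radius r, leaving the weight m k ^ k. Since norm (y k) is at most 1 / m k ^ (2 k), the
      coefficients still decay like 1 / m k ^ k.\<close>
    define d where "d k = of_real (m k ^ k) * y k" for k
    have nd: "norm (d k) * m k ^ k \<le> 1" for k
    proof -
      have "norm (d k) * m k ^ k = norm (y k) * m k ^ (2 * k)"
        using m(2)[of k] by (simp add: d_def norm_mult norm_power mult_2 power_add)
      then show ?thesis using b(3)[of k] by (simp add: y_def lr m_def)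
    qed
    have Il: "\<bar>Im (l k)\<bar> \<le> Y / s" "\<bar>Im (- l k)\<bar> \<le> Y / s" for k
      using Y(2)[OF b(1)[of k]] s by (auto simp: l_def divide_right_mono)
    have nl: "norm (l k) = m k / s" for k using s by (simp add: l_def m_def norm_divide)
    have rapid: "rapid l d"
      unfolding rapid_def
    proof
      fix p :: nat
      have "summable (\<lambda>k. (2 / s) ^ p * (1 / 2) ^ k)" by (intro summable_mult summable_geometric) auto
      then show "summable (\<lambda>k. norm (d k) * norm (l k) ^ p)"
      proof (rule summable_comparison_test'[where N = p])
        fix k assume k: "k \<ge> p"
        have "norm (d k) * m k ^ p * 2 ^ k \<le> 2 ^ p"
        proof -
          have "(m k / 2) ^ p \<le> (m k / 2) ^ k" using m(1)[of k] k by (intro power_increasing) auto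
          then have "m k ^ p * 2 ^ k \<le> m k ^ k * 2 ^ p" by (simp add: power_divide divide_le_eq pos_le_divide_eq mult_ac)
          then have "norm (d k) * (m k ^ p * 2 ^ k) \<le> norm (d k) * (m k ^ k * 2 ^ p)" by (intro mult_left_mono) auto
          also have "\<dots> = (norm (d k) * m k ^ k) * 2 ^ p" by simp
          also have "\<dots> \<le> 1 * 2 ^ p" by (intro mult_right_mono nd) auto
          finally show ?thesis by (simp add: mult.assoc)
        qed
        then have "norm (d k) * m k ^ p \<le> 2 ^ p * (1 / 2) ^ k" by (simp add: power_one_over pos_le_divide_eq)
        then have "norm (d k) * m k ^ p / s ^ p \<le> 2 ^ p * (1 / 2) ^ k / s ^ p" using s by (intro divide_right_mono) auto
        then show "norm (norm (d k) * norm (l k) ^ p) \<le> (2 / s) ^ p * (1 / 2) ^ k"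
          using s m(2)[of k] by (simp add: nl power_divide abs_mult mult.commute)
      qed
    qed
    define h :: "real ^ 'n \<Rightarrow> complex" where "h = wave_series d l u"
    have h: "smooth h" unfolding h_def by (rule smooth_wave_series[OF rapid Il(1) u1])
    \<comment> \<open>As a function of y the reflected translate is again a wave series, with
      frequencies - l k and with the values of the waves at x moved into the coefficients.\<close>
    have h_refl: "(\<lambda>y. h (x - y)) = wave_series (\<lambda>k. d k * wave (l k) u x) (\<lambda>k. - l k) u" for x
      unfolding h_def wave_series_def using wave_refl by (simp add: fun_eq_iff mult.assoc)
    have rapid_x: "rapid (\<lambda>k. - l k) (\<lambda>k. d k * wave (l k) u x)" for x
      unfolding rapid_def
    proof
      fix p
      have "summable (\<lambda>k. norm (d k) * norm (l k) ^ p * exp (Y / s * norm x))"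
        using rapid unfolding rapid_def by (intro summable_mult2) blast
      then show "summable (\<lambda>k. norm (d k * wave (l k) u x) * norm (- l k) ^ p)"
      proof (rule summable_comparison_test'[where N = 0])
        fix k
        have "norm (wave (l k) u x) \<le> exp (Y / s * norm x)" by (rule norm_wave_le[OF Il(1) order_refl u1])
        then have "norm (d k) * norm (l k) ^ p * norm (wave (l k) u x) \<le> norm (d k) * norm (l k) ^ p * exp (Y / s * norm x)"
          by (intro mult_left_mono) auto
        then show "norm (norm (d k * wave (l k) u x) * norm (- l k) ^ p) \<le> norm (d k) * norm (l k) ^ p * exp (Y / s * norm x)"
          by (simp add: norm_mult mult_ac)
      qed
    qed
    have cvh: "cv h (Gd \<alpha> s) x = 0" for x
    proof -
      have "(\<lambda>k. d k * wave (l k) u x * Gd \<alpha> s (wave (- l k) u)) sums Gd \<alpha> s (\<lambda>y. h (x - y))"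
        unfolding h_refl by (rule nice_wave_series[OF nice_Gd Il(2) u rapid_x])
      moreover have "Gd \<alpha> s (wave (- l k) u) = 0" for k
        using Gd_wave[OF u, of \<alpha> s "- l k"] by (simp add: c ls b(1))
      ultimately show ?thesis using sums_unique2[OF sums_zero] by (simp add: cv_def)
    qed
    show ?thesis
    proof (intro exI conjI notI)
      show "(\<lambda>x. 0) \<in> smooth_functions" "h \<in> smooth_functions" by (simp_all add: smooth_functions_iff h)
      show "convolve (\<lambda>x. 0) (m_dist \<alpha> r) = convolve h (m_dist \<alpha> s)"
        by (simp add: cvm r s h cvh cv0)
      assume "\<exists>f\<in>smooth_functions. (\<lambda>x. 0) = convolve f (m_dist \<alpha> s) \<and> h = convolve f (m_dist \<alpha> r)"
      then obtain f where f: "smooth f" "(\<lambda>x. 0) = (\<lambda>x. K * cv f (Gd \<alpha> s) x)" "h = (\<lambda>x. K * cv f (Gd \<alpha> r) x)"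
        by (auto simp: smooth_functions_iff cvm r s)
      have f0: "cv f (Gd \<alpha> s) = (\<lambda>x. 0)" using fun_cong[OF f(2)] K by auto
      have fr: "cv f (Gd \<alpha> r) = (\<lambda>x. (1 / K) * h x)" using fun_cong[OF f(3)] K by (simp add: fun_eq_iff)
      obtain N where N: "\<And>l s. nice (EE N \<alpha> l s :: (real ^ 'n \<Rightarrow> complex) \<Rightarrow> complex)"
        "\<And>l s. divides (EE N \<alpha> l s :: (real ^ 'n \<Rightarrow> complex) \<Rightarrow> complex) \<alpha> l s" "Re \<alpha> > 1 - real N"
        using obtain_divides[of \<alpha>] by metis
      have z: "bj (\<alpha> + hc TYPE(real ^ 'n)) (l k * of_real s) = 0" for k by (simp add: c ls b(1))
      \<comment> \<open>\<open>E\<close> annihilates all waves of the series but the k-th. The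
        factor \<open>y k\<close> then cancels, being nonzero because r / s is not rational. The
        left side grows at most polynomially in m k, whereas the right side contains m k ^
        k.\<close>
      have key: "K * cv f (EE N \<alpha> (l k) s) 0 = of_real (m k ^ k) * ((b k)\<^sup>2 / 8 * (bj (c + 1) (b k))\<^sup>2)" for k
      proof -
        let ?E = "EE N \<alpha> (l k) s :: (real ^ 'n \<Rightarrow> complex) \<Rightarrow> complex"
        have "y k * cv f ?E 0 = cv (cv f (Gd \<alpha> r)) ?E 0"
          using divides_commute[OF N(1) N(2) f(1) f0 z[of k], of r] by (simp add: c y_def)
        also have "\<dots> = (1 / K) * ?E (\<lambda>y. h (0 - y))"
          unfolding fr cv_def by (rule nice_cmult[OF N(1) smooth_reflect[OF h]])
        also have "?E (\<lambda>y. h (0 - y)) = d k * ?E (wave (- l k) u)"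
        proof -
          have "(\<lambda>j. d j * wave (l j) u 0 * ?E (wave (- l j) u)) sums ?E (\<lambda>y. h (0 - y))"
            unfolding h_refl by (rule nice_wave_series[OF N(1) Il(2) u rapid_x])
          moreover have "?E (wave (- l j) u) = 0" if "j \<noteq> k" for j
          proof (rule divides_wave_other[OF N(1) N(2) u z z])
            have "(b j)\<^sup>2 \<noteq> (b k)\<^sup>2" using b(4) that by blast
            then show "(l j)\<^sup>2 \<noteq> (l k)\<^sup>2" using s by (simp add: l_def power_divide)
          qed
          then have "(\<lambda>j. d j * wave (l j) u 0 * ?E (wave (- l j) u)) = (\<lambda>j. if j = k then d k * ?E (wave (- l k) u) else 0)"
            by (auto simp: fun_eq_iff wave_def)
          ultimately have "(\<lambda>j. if j = k then d k * ?E (wave (- l k) u) else 0) sums ?E (\<lambda>y. h (0 - y))" by (simp only:)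
          then show ?thesis by (rule sums_unique2[OF _ sums_single[of k "\<lambda>_. d k * ?E (wave (- l k) u)"]])
        qed
        also have "?E (wave (- l k) u) = (b k)\<^sup>2 / 8 * (bj (c + 1) (b k))\<^sup>2"
          using divides_wave_same[OF N(2) u z[of k]] by (simp add: c ls)
        finally have "y k * (K * cv f ?E 0) = y k * (of_real (m k ^ k) * ((b k)\<^sup>2 / 8 * (bj (c + 1) (b k))\<^sup>2))"
          using K by (simp add: d_def mult_ac)
        then show ?thesis using y0[of k] by (simp only: mult_left_cancel not_False_eq_True)
      qed
      obtain C A where CA: "C > 0" "\<And>l. \<bar>Im (l * of_real s)\<bar> \<le> Y \<Longrightarrow>
          norm (EE N \<alpha> l s (\<lambda>y. f (0 - y))) \<le> C * (1 + norm (l * of_real s)) ^ A"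
        using EE_bound[OF smooth_reflect[OF f(1)] less_imp_le[OF Y(1)] N(3)] by metis
      \<comment> \<open>The exponent A comes from \<open>EE_bound\<close>, and 2 A0 from squaring
        the lower bound for \<open>bj (c + 1)\<close>. The 1/2 is 4/8, from m k ^ 2 / 8 with m k >=
        2.\<close>
      show False
      proof (rule exponential_beats_constant[of "\<delta>\<^sup>2 / 2" "norm K * C * 2 ^ A" "A + 2 * A0"])
        show "\<delta>\<^sup>2 / 2 > 0" using \<delta>(1) by simp
        fix k
        have Re1: "\<bar>Re (b k)\<bar> \<ge> 1"
          using b(2)[of k] Y(2)[OF b(1)[of k]] cmod_le[of "b k"] by linarith
        have low: "\<delta> \<le> m k ^ A0 * norm (bj (c + 1) (b k))"
          unfolding m_def by (rule \<delta>(2)[OF b(1) Y(2)[OF b(1)] Re1])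
        have "norm (K * cv f (EE N \<alpha> (l k) s) 0) \<le> norm K * (C * (2 * m k) ^ A)"
        proof -
          have "norm (cv f (EE N \<alpha> (l k) s) 0) \<le> C * (1 + norm (b k)) ^ A"
            unfolding cv_def using CA(2)[of "l k"] Y(2)[OF b(1)[of k]] by (simp add: ls)
          also have "\<dots> \<le> C * (2 * m k) ^ A"
            using CA(1) m(1)[of k] by (intro mult_left_mono power_mono) (auto simp: m_def)
          finally show ?thesis by (simp add: norm_mult mult_left_mono)
        qed
        also have "\<dots> = norm K * C * 2 ^ A * m k ^ A" by (simp add: power_mult_distrib)
        finally have up: "m k ^ k * (m k ^ 2 / 8 * (norm (bj (c + 1) (b k)))\<^sup>2) \<le> norm K * C * 2 ^ A * m k ^ A"
          unfolding key using m(2)[of k] by (simp add: norm_mult norm_power norm_divide m_def)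
        have "\<delta>\<^sup>2 \<le> (m k ^ A0 * norm (bj (c + 1) (b k)))\<^sup>2" using \<delta>(1) low by (intro power_mono) auto
        also have "\<dots> = m k ^ (2 * A0) * (norm (bj (c + 1) (b k)))\<^sup>2" by (simp add: power_mult_distrib power_mult[symmetric] mult.commute)
        finally have "\<delta>\<^sup>2 / 2 * m k ^ k \<le> m k ^ (2 * A0) * (norm (bj (c + 1) (b k)))\<^sup>2 / 2 * m k ^ k"
          using m(2)[of k] by (intro mult_right_mono divide_right_mono) auto
        also have "\<dots> = m k ^ (2 * A0) * (m k ^ k * (4 / 8 * (norm (bj (c + 1) (b k)))\<^sup>2))" by simp
        also have "\<dots> \<le> m k ^ (2 * A0) * (m k ^ k * (m k ^ 2 / 8 * (norm (bj (c + 1) (b k)))\<^sup>2))"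
        proof -
          have "(4::real) \<le> m k ^ 2" using power_mono[OF m(1)[of k], of 2] by simp
          then show ?thesis using m(2)[of k] by (intro mult_left_mono mult_right_mono divide_right_mono) auto
        qed
        also have "\<dots> \<le> m k ^ (2 * A0) * (norm K * C * 2 ^ A * m k ^ A)"
          using m(2)[of k] by (intro mult_left_mono up) auto
        finally have "\<delta>\<^sup>2 / 2 * m k ^ k \<le> norm K * C * 2 ^ A * m k ^ (A + 2 * A0)"
          by (simp add: power_add mult_ac)
        then show "\<exists>m\<ge>2. \<delta>\<^sup>2 / 2 * m ^ k \<le> norm K * C * 2 ^ A * m ^ (A + 2 * A0)" using m(1) by blast
      qed
    qed
  qed
qed


end
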